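(* There is an algorithm that, given a formula $F$ of propositional logic, computes the number (either a non-negative integer or $\infty$) of distinct normal and fair proofs of $F$ in classical natural deduction, i.e. the number of distinct normal and fair $\lambda\mu^{\to\wedge\vee}$-terms $t$ such that $\vdash t:F$ (with empty context).
   Context: **Formulae.** Let $\mathcal A$ be a (possibly infinite) set of atomic constants with $\bot\notin\mathcal A$. Formulae are given by $\mathcal F ::= \mathcal A\cup\{\bot\}\mid \mathcal F\to\mathcal F\mid \mathcal F\wedge\mathcal F\mid\mathcal F\vee\mathcal F$; $\neg F$ abbreviates $F\to\bot$. **Terms.** Let $\mathcal V,\mathcal W$ be disjoint sets of variables ($x,y,\dots\in\mathcal V$; $\alpha,\beta,\dots\in\mathcal W$). The $\lambda\mu^{\to\wedge\vee}$-terms are $$\mathcal T ::= \mathcal V\mid \lambda\mathcal V.\mathcal T\mid(\mathcal T\ \mathcal E)\mid\langle\mathcal T,\mathcal T\rangle\mid\omega_1\mathcal T\mid\omega_2\mathcal T\mid\mu\mathcal W.\mathcal T\mid(\mathcal W\ \mathcal T),\qquad \mathcal E ::= \mathcal T\mid\pi_1\mid\pi_2\mid[\mathcal V.\mathcal T,\mathcal V.\mathcal T].$$ Terms are taken up to renaming of bound variables, and application associates to the left. **Contexts and goals.** A context $\Gamma$ is a finite set of declarations $x:A$ or $\alpha:\neg A$ ($x\in\mathcal V$, $\alpha\in\mathcal W$, $A\in\mathcal F$), each variable occurring only once. A goal is a pair $\Gamma\vdash A$. **Typing rules.** - (ax) $\Gamma,x:A\vdash x:A$. - ($\to_i$) from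 $\Gamma,x:A\vdash M:B$ infer $\Gamma\vdash\lambda x.M:A\to B$. - ($\to_e$) from $\Gamma_1\vdash M:A\to B$ and $\Gamma_2\vdash N:A$ infer $\Gamma_1,\Gamma_2\vdash(M\ N):B$. - ($\bot_i$) from $\Gamma,\alpha:\neg A\vdash M:A$ infer $\Gamma,\alpha:\neg A\vdash(\alpha\ M):\bot$. - ($\bot_e$, proof by contradiction) from $\Gamma,\alpha:\neg A\vdash M:\bot$ infer $\Gamma\vdash\mu\alpha.M:A$. - ($\wedge_i$) from $\Gamma_1\vdash M:A_1$ and $\Gamma_2\vdash N:A_2$ infer $\Gamma_1,\Gamma_2\vdash\langle M,N\rangle:A_1\wedge A_2$. - ($\wedge_e$) from $\Gamma\vdash M:A_1\wedge A_2$ infer $\Gamma\vdash(M\ \pi_i):A_i$. - ($\vee_i$) from $\Gamma\vdash M:A_j$ infer $\Gamma\vdash\omega_jM:A_1\vee A_2$. - ($\vee_e$) from $\Gamma\vdash M:A_1\vee A_2$, $\Gamma_1,x_1:A_1\vdash N_1:C$ and $\Gamma_2,x_2:A_2\vdash N_2:C$ infer $\Gamma,\Gamma_1,\Gamma_2\vdash(M\ [x_1.N_1,x_2.N_2]):C$. A term $t$ is a *proof* of the goal $\Gamma\vdash A$ if $\Gamma\vdash t:A$; a proof of a formula $F$ is a proof of $\vdash F$. **Reduction rules** ($\varepsilon\in\mathcal E$): - $(\lambda x.M\ N)\triangleright M[x:=N]$; - $(\langle M_1,M_2\rangle\ \pi_i)\triangleright M_i$; - $(\omega_iM\ [x_1.N_1,x_2.N_2])\triangleright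 N_i[x_i:=M]$; - $(M\ [x_1.N_1,x_2.N_2]\ \varepsilon)\triangleright(M\ [x_1.(N_1\ \varepsilon),x_2.(N_2\ \varepsilon)])$; - $(\mu\alpha.M\ \varepsilon)\triangleright\mu\alpha.M[(\alpha\ L):=(\alpha\ (L\ \varepsilon))]$, i.e. every subterm $(\alpha\ L)$ of $M$ is replaced by $(\alpha\ (L\ \varepsilon))$. A term is *normal* if it contains no redex, i.e. cannot be reduced by these rules. **Fairness.** A normal proof is *fair* if: - (a) when in one of the branches of a proof by cases, the hypothesis that was used for the case distinction is deleted and may no longer be used: in a subterm $(x\ t_1\cdots t_k\ [x_1.N_1,x_2.N_2])$ with head variable $x$, the hypothesis $x$ is not used in $N_1$ or $N_2$; - (b) neither $\bot$ nor any formula of the form $\neg C$ is proved by contradiction (rule $\bot_e$); - (c) in a part of the proof where a hypothesis $\alpha:\neg B$ ($\alpha\in\mathcal W$) is already present, $B$ is not proved by contradiction. *)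

theory Defs
  imports "HOL-Library.Extended_Nat" "HOL-Library.Nat_Bijection"
begin

section \<open>Formulae\<close>

datatype (atoms: 'a) fm =
    Atom 'a
  | Bot
  | Imp "'a fm" "'a fm"
  | And "'a fm" "'a fm"
  | Or "'a fm" "'a fm"

abbreviation Neg :: "'a fm \<Rightarrow> 'a fm" where
  "Neg A \<equiv> Imp A Bot"


section \<open>Terms\<close>

text \<open>
  Terms up to renaming of bound variables are represented by de Bruijn indices, with one index
  space for each of the two sorts of variables: the \<open>\<lambda>\<close>-variables \<open>x, y\<close>, bound by
  \<open>Lam\<close> and in each branch of \<open>Case\<close>, and the \<open>\<mu>\<close>-variables \<open>\<alpha>, \<beta>\<close>, bound by
  \<open>Mu\<close>. \<open>Named a M\<close> stands for \<open>(\<alpha> M)\<close>.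
\<close>

datatype trm =
    Var nat
  | Lam trm
  | App trm elim
  | MkPair trm trm
  | Inj1 trm
  | Inj2 trm
  | Mu trm
  | Named nat trm
and elim =
    Arg trm
  | Proj1
  | Proj2
  | Case trm trm

primrec subterms :: "trm \<Rightarrow> trm set" and subterms_elim :: "elim \<Rightarrow> trm set" where
  "subterms (Var x) = {Var x}"
| "subterms (Lam M) = insert (Lam M) (subterms M)"
| "subterms (App M E) = insert (App M E) (subterms M \<union> subterms_elim E)"
| "subterms (MkPair M N) = insert (MkPair M N) (subterms M \<union> subterms N)"
| "subterms (Inj1 M) = insert (Inj1 M) (subterms M)"
| "subterms (Inj2 M) = insert (Inj2 M) (subterms M)"
| "subterms (Mu M) = insert (Mu M) (subterms M)"
| "subterms (Named a M) = insert (Named a M) (subterms M)"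
| "subterms_elim (Arg N) = subterms N"
| "subterms_elim Proj1 = {}"
| "subterms_elim Proj2 = {}"
| "subterms_elim (Case N1 N2) = subterms N1 \<union> subterms N2"

text \<open>\<open>occurs x M\<close>: the \<open>\<lambda>\<close>-variable with index \<open>x\<close> occurs free in \<open>M\<close>.\<close>

primrec occurs :: "nat \<Rightarrow> trm \<Rightarrow> bool" and occurs_elim :: "nat \<Rightarrow> elim \<Rightarrow> bool" where
  "occurs x (Var y) \<longleftrightarrow> x = y"
| "occurs x (Lam M) \<longleftrightarrow> occurs (Suc x) M"
| "occurs x (App M E) \<longleftrightarrow> occurs x M \<or> occurs_elim x E"
| "occurs x (MkPair M N) \<longleftrightarrow> occurs x M \<or> occurs x N"
| "occurs x (Inj1 M) \<longleftrightarrow> occurs x M"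
| "occurs x (Inj2 M) \<longleftrightarrow> occurs x M"
| "occurs x (Mu M) \<longleftrightarrow> occurs x M"
| "occurs x (Named a M) \<longleftrightarrow> occurs x M"
| "occurs_elim x (Arg N) \<longleftrightarrow> occurs x N"
| "occurs_elim x Proj1 \<longleftrightarrow> False"
| "occurs_elim x Proj2 \<longleftrightarrow> False"
| "occurs_elim x (Case N1 N2) \<longleftrightarrow> occurs (Suc x) N1 \<or> occurs (Suc x) N2"


section \<open>Reduction and normal terms\<close>

text \<open>
  \<open>lift k\<close> and \<open>lift_mu k\<close> increment the free indices \<open>\<ge> k\<close> of \<open>\<lambda>\<close>-variables and of
  \<open>\<mu>\<close>-variables, respectively.
\<close>

primrec lift :: "nat \<Rightarrow> trm \<Rightarrow> trm" and lift_elim :: "nat \<Rightarrow> elim \<Rightarrow> elim" where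
  "lift k (Var x) = Var (if x < k then x else Suc x)"
| "lift k (Lam M) = Lam (lift (Suc k) M)"
| "lift k (App M E) = App (lift k M) (lift_elim k E)"
| "lift k (MkPair M N) = MkPair (lift k M) (lift k N)"
| "lift k (Inj1 M) = Inj1 (lift k M)"
| "lift k (Inj2 M) = Inj2 (lift k M)"
| "lift k (Mu M) = Mu (lift k M)"
| "lift k (Named a M) = Named a (lift k M)"
| "lift_elim k (Arg N) = Arg (lift k N)"
| "lift_elim k Proj1 = Proj1"
| "lift_elim k Proj2 = Proj2"
| "lift_elim k (Case N1 N2) = Case (lift (Suc k) N1) (lift (Suc k) N2)"

primrec lift_mu :: "nat \<Rightarrow> trm \<Rightarrow> trm" and lift_mu_elim :: "nat \<Rightarrow> elim \<Rightarrow> elim" where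
  "lift_mu k (Var x) = Var x"
| "lift_mu k (Lam M) = Lam (lift_mu k M)"
| "lift_mu k (App M E) = App (lift_mu k M) (lift_mu_elim k E)"
| "lift_mu k (MkPair M N) = MkPair (lift_mu k M) (lift_mu k N)"
| "lift_mu k (Inj1 M) = Inj1 (lift_mu k M)"
| "lift_mu k (Inj2 M) = Inj2 (lift_mu k M)"
| "lift_mu k (Mu M) = Mu (lift_mu (Suc k) M)"
| "lift_mu k (Named a M) = Named (if a < k then a else Suc a) (lift_mu k M)"
| "lift_mu_elim k (Arg N) = Arg (lift_mu k N)"
| "lift_mu_elim k Proj1 = Proj1"
| "lift_mu_elim k Proj2 = Proj2"
| "lift_mu_elim k (Case N1 N2) = Case (lift_mu k N1) (lift_mu k N2)"

text \<open>\<open>subst M k L\<close> is \<open>M[k := L]\<close>; the binder of \<open>k\<close> disappears, so larger indices drop by one.\<close>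

primrec subst :: "trm \<Rightarrow> nat \<Rightarrow> trm \<Rightarrow> trm" and subst_elim :: "elim \<Rightarrow> nat \<Rightarrow> trm \<Rightarrow> elim" where
  "subst (Var x) k L = (if x < k then Var x else if x = k then L else Var (x - 1))"
| "subst (Lam M) k L = Lam (subst M (Suc k) (lift 0 L))"
| "subst (App M E) k L = App (subst M k L) (subst_elim E k L)"
| "subst (MkPair M N) k L = MkPair (subst M k L) (subst N k L)"
| "subst (Inj1 M) k L = Inj1 (subst M k L)"
| "subst (Inj2 M) k L = Inj2 (subst M k L)"
| "subst (Mu M) k L = Mu (subst M k (lift_mu 0 L))"
| "subst (Named a M) k L = Named a (subst M k L)"
| "subst_elim (Arg N) k L = Arg (subst N k L)"
| "subst_elim Proj1 k L = Proj1"
| "subst_elim Proj2 k L = Proj2"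
| "subst_elim (Case N1 N2) k L =
     Case (subst N1 (Suc k) (lift 0 L)) (subst N2 (Suc k) (lift 0 L))"

text \<open>\<open>mu_subst M a E\<close> is \<open>M[(a L) := (a (L E))]\<close>; the \<open>\<mu>\<close>-variable \<open>a\<close> stays bound.\<close>

primrec mu_subst :: "trm \<Rightarrow> nat \<Rightarrow> elim \<Rightarrow> trm"
  and mu_subst_elim :: "elim \<Rightarrow> nat \<Rightarrow> elim \<Rightarrow> elim" where
  "mu_subst (Var x) a E = Var x"
| "mu_subst (Lam M) a E = Lam (mu_subst M a (lift_elim 0 E))"
| "mu_subst (App M F) a E = App (mu_subst M a E) (mu_subst_elim F a E)"
| "mu_subst (MkPair M N) a E = MkPair (mu_subst M a E) (mu_subst N a E)"
| "mu_subst (Inj1 M) a E = Inj1 (mu_subst M a E)"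
| "mu_subst (Inj2 M) a E = Inj2 (mu_subst M a E)"
| "mu_subst (Mu M) a E = Mu (mu_subst M (Suc a) (lift_mu_elim 0 E))"
| "mu_subst (Named b M) a E =
     Named b (if b = a then App (mu_subst M a E) E else mu_subst M a E)"
| "mu_subst_elim (Arg N) a E = Arg (mu_subst N a E)"
| "mu_subst_elim Proj1 a E = Proj1"
| "mu_subst_elim Proj2 a E = Proj2"
| "mu_subst_elim (Case N1 N2) a E =
     Case (mu_subst N1 a (lift_elim 0 E)) (mu_subst N2 a (lift_elim 0 E))"

inductive contracts :: "trm \<Rightarrow> trm \<Rightarrow> bool" (infix "\<rhd>" 50) where
  beta: "App (Lam M) (Arg N) \<rhd> subst M 0 N"
| proj1: "App (MkPair M1 M2) Proj1 \<rhd> M1"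
| proj2: "App (MkPair M1 M2) Proj2 \<rhd> M2"
| case1: "App (Inj1 M) (Case N1 N2) \<rhd> subst N1 0 M"
| case2: "App (Inj2 M) (Case N1 N2) \<rhd> subst N2 0 M"
| commute: "App (App M (Case N1 N2)) E \<rhd>
    App M (Case (App N1 (lift_elim 0 E)) (App N2 (lift_elim 0 E)))"
| mu: "App (Mu M) E \<rhd> Mu (mu_subst M 0 (lift_mu_elim 0 E))"

definition redex :: "trm \<Rightarrow> bool" where
  "redex t \<longleftrightarrow> (\<exists>t'. t \<rhd> t')"

definition normal :: "trm \<Rightarrow> bool" where
  "normal t \<longleftrightarrow> (\<forall>s \<in> subterms t. \<not> redex s)"


section \<open>Typing\<close>

text \<open>
  \<open>derivable R \<Gamma> \<Delta> t A\<close>: the goal with hypotheses \<open>x : \<Gamma> ! x\<close> and \<open>\<alpha> : \<not> (\<Delta> ! \<alpha>)\<close> and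
  conclusion \<open>A\<close> has a derivation with proof term \<open>t\<close> in which every proof by contradiction
  (rule \<open>botE\<close>) of a formula \<open>B\<close> in the presence of the \<open>\<mu>\<close>-hypotheses \<open>\<Delta>'\<close> satisfies
  \<open>R \<Delta>' B\<close>.

  The premises of a rule share one context: since the axiom allows arbitrary side hypotheses,
  this derives the same goals as taking the union \<open>\<Gamma>\<^sub>1, \<Gamma>\<^sub>2\<close> of the contexts of the premises,
  and the context of each subproof then consists of all hypotheses in scope.
\<close>

inductive derivable ::
  "('a fm list \<Rightarrow> 'a fm \<Rightarrow> bool) \<Rightarrow> 'a fm list \<Rightarrow> 'a fm list \<Rightarrow> trm \<Rightarrow> 'a fm \<Rightarrow> bool"
  for R :: "'a fm list \<Rightarrow> 'a fm \<Rightarrow> bool" where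
  ax: "x < length \<Gamma> \<Longrightarrow> derivable R \<Gamma> \<Delta> (Var x) (\<Gamma> ! x)"
| impI: "derivable R (A # \<Gamma>) \<Delta> M B \<Longrightarrow> derivable R \<Gamma> \<Delta> (Lam M) (Imp A B)"
| impE: "derivable R \<Gamma> \<Delta> M (Imp A B) \<Longrightarrow> derivable R \<Gamma> \<Delta> N A \<Longrightarrow>
    derivable R \<Gamma> \<Delta> (App M (Arg N)) B"
| botI: "a < length \<Delta> \<Longrightarrow> derivable R \<Gamma> \<Delta> M (\<Delta> ! a) \<Longrightarrow> derivable R \<Gamma> \<Delta> (Named a M) Bot"
| botE: "derivable R \<Gamma> (A # \<Delta>) M Bot \<Longrightarrow> R \<Delta> A \<Longrightarrow> derivable R \<Gamma> \<Delta> (Mu M) A"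
| andI: "derivable R \<Gamma> \<Delta> M A1 \<Longrightarrow> derivable R \<Gamma> \<Delta> N A2 \<Longrightarrow>
    derivable R \<Gamma> \<Delta> (MkPair M N) (And A1 A2)"
| andE1: "derivable R \<Gamma> \<Delta> M (And A1 A2) \<Longrightarrow> derivable R \<Gamma> \<Delta> (App M Proj1) A1"
| andE2: "derivable R \<Gamma> \<Delta> M (And A1 A2) \<Longrightarrow> derivable R \<Gamma> \<Delta> (App M Proj2) A2"
| orI1: "derivable R \<Gamma> \<Delta> M A1 \<Longrightarrow> derivable R \<Gamma> \<Delta> (Inj1 M) (Or A1 A2)"
| orI2: "derivable R \<Gamma> \<Delta> M A2 \<Longrightarrow> derivable R \<Gamma> \<Delta> (Inj2 M) (Or A1 A2)"
| orE: "derivable R \<Gamma> \<Delta> M (Or A1 A2) \<Longrightarrow> derivable R (A1 # \<Gamma>) \<Delta> N1 C \<Longrightarrow>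
    derivable R (A2 # \<Gamma>) \<Delta> N2 C \<Longrightarrow> derivable R \<Gamma> \<Delta> (App M (Case N1 N2)) C"

definition proof_of :: "trm \<Rightarrow> 'a fm \<Rightarrow> bool" where
  "proof_of t F \<longleftrightarrow> derivable (\<lambda>_ _. True) [] [] t F"


section \<open>Fairness\<close>

fun head_var :: "trm \<Rightarrow> nat option" where
  "head_var (Var x) = Some x"
| "head_var (App M E) = head_var M"
| "head_var _ = None"

text \<open>The index \<open>x\<close> of the head variable becomes \<open>Suc x\<close> under the binder of a branch.\<close>

definition fair_cases :: "trm \<Rightarrow> bool" where
  "fair_cases t \<longleftrightarrow> (\<forall>M N1 N2 x. App M (Case N1 N2) \<in> subterms t \<longrightarrow> head_var M = Some x \<longrightarrow>
     \<not> occurs (Suc x) N1 \<and> \<not> occurs (Suc x) N2)"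

definition fair_contradiction :: "'a fm list \<Rightarrow> 'a fm \<Rightarrow> bool" where
  "fair_contradiction \<Delta> A \<longleftrightarrow> A \<noteq> Bot \<and> (\<forall>C. A \<noteq> Neg C) \<and> A \<notin> set \<Delta>"

text \<open>
  Terms carry no types, so the conditions on proofs by contradiction refer to a derivation; the
  derivation of a given goal by a given normal term is unique.
\<close>

definition fair :: "trm \<Rightarrow> 'a fm \<Rightarrow> bool" where
  "fair t F \<longleftrightarrow> fair_cases t \<and> derivable fair_contradiction [] [] t F"

definition fair_proofs :: "'a fm \<Rightarrow> trm set" where
  "fair_proofs F = {t. proof_of t F \<and> normal t \<and> fair t F}"

definition num_fair_proofs :: "'a fm \<Rightarrow> enat" where
  "num_fair_proofs F =
     (if finite (fair_proofs F) then enat (card (fair_proofs F)) else \<infinity>)"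


section \<open>Algorithms\<close>

text \<open>Algorithms are descriptions of partial recursive functions on tuples of naturals.\<close>

datatype recf =
    Zero
  | Succ
  | Proj nat
  | Comp recf "recf list"
  | PrimRec recf recf
  | Mini recf

text \<open>\<open>computes p xs y\<close>: on input \<open>xs\<close>, \<open>p\<close> terminates with output \<open>y\<close>.\<close>

inductive computes :: "recf \<Rightarrow> nat list \<Rightarrow> nat \<Rightarrow> bool" where
  zero: "computes Zero xs 0"
| succ: "computes Succ [x] (Suc x)"
| id: "i < length xs \<Longrightarrow> computes (Proj i) xs (xs ! i)"
| comp: "list_all2 (\<lambda>g y. computes g xs y) gs ys \<Longrightarrow> computes f ys z \<Longrightarrow>
    computes (Comp f gs) xs z"
| primrec_0: "computes f xs z \<Longrightarrow> computes (PrimRec f g) (0 # xs) z"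
| primrec_Suc: "computes (PrimRec f g) (n # xs) y \<Longrightarrow> computes g (n # y # xs) z \<Longrightarrow>
    computes (PrimRec f g) (Suc n # xs) z"
| mini: "computes f (n # xs) 0 \<Longrightarrow> (\<forall>i<n. \<exists>y. computes f (i # xs) (Suc y)) \<Longrightarrow>
    computes (Mini f) xs n"

inductive_cases computes_zeroE: "computes Zero xs y"
inductive_cases computes_succE: "computes Succ xs y"
inductive_cases computes_idE: "computes (Proj i) xs y"
inductive_cases computes_compE: "computes (Comp f gs) xs y"
inductive_cases computes_primrec_0E: "computes (PrimRec f g) (0 # xs) y"
inductive_cases computes_primrec_SucE: "computes (PrimRec f g) (Suc n # xs) y"
inductive_cases computes_miniE: "computes (Mini f) xs y"

lemma computes_deterministic: "computes p xs y \<Longrightarrow> computes p xs y' \<Longrightarrow> y = y'"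
proof (induction arbitrary: y' rule: computes.induct)
  case (zero xs)
  then show ?case by (auto elim: computes_zeroE)
next
  case (succ x)
  then show ?case by (auto elim: computes_succE)
next
  case (id i xs)
  then show ?case by (auto elim: computes_idE)
next
  case (comp xs gs ys f z)
  from comp.prems obtain ys' where ys': "list_all2 (\<lambda>g y. computes g xs y) gs ys'"
    "computes f ys' y'"
    by (rule computes_compE)
  have "ys = ys'"
    using comp.IH(1) ys'(1) by (auto simp: list_all2_conv_all_nth intro: nth_equalityI)
  with comp.IH(2) ys'(2) show ?case by simp
next
  case (primrec_0 f xs z g)
  from primrec_0.prems have "computes f xs y'" by (rule computes_primrec_0E)
  then show ?case by (rule primrec_0.IH)
next
  case (primrec_Suc f g n xs y z)
  from primrec_Suc.prems obtain w where w: "computes (PrimRec f g) (n # xs) w"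
    "computes g (n # w # xs) y'"
    by (rule computes_primrec_SucE)
  from primrec_Suc.IH(1)[OF w(1)] w(2) show ?case by (simp add: primrec_Suc.IH(2))
next
  case (mini f n xs)
  from mini.prems have y': "computes f (y' # xs) 0"
    "\<forall>i<y'. \<exists>y. computes f (i # xs) (Suc y)"
    by (auto elim: computes_miniE)
  show ?case
  proof (cases n y' rule: linorder_cases)
    case less
    with y'(2) mini.IH(1) show ?thesis by blast
  next
    case greater
    with y'(1) mini.IH(2) show ?thesis by blast
  qed
qed


section \<open>Inputs and outputs as natural numbers\<close>

text \<open>\<open>e\<close> is a numbering of the atomic constants.\<close>

primrec fm_code :: "('a \<Rightarrow> nat) \<Rightarrow> 'a fm \<Rightarrow> nat" where
  "fm_code e (Atom a) = prod_encode (0, e a)"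
| "fm_code e Bot = prod_encode (1, 0)"
| "fm_code e (Imp A B) = prod_encode (2, prod_encode (fm_code e A, fm_code e B))"
| "fm_code e (And A B) = prod_encode (3, prod_encode (fm_code e A, fm_code e B))"
| "fm_code e (Or A B) = prod_encode (4, prod_encode (fm_code e A, fm_code e B))"

lemma fm_code_inject:
  assumes "\<And>a b. a \<in> atoms F \<Longrightarrow> b \<in> atoms G \<Longrightarrow> e a = e b \<Longrightarrow> a = b"
    and "fm_code e F = fm_code e G"
  shows "F = G"
  using assms
proof (induction F arbitrary: G)
  case (Atom a) then show ?case by (cases G) simp_all
next
  case Bot then show ?case by (cases G) simp_all
next
  case (Imp A B) then show ?case by (cases G) simp_all
next
  case (And A B) then show ?case by (cases G) simp_all
next
  case (Or A B) then show ?case by (cases G) simp_all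
qed

fun enat_code :: "enat \<Rightarrow> nat" where
  "enat_code \<infinity> = 0"
| "enat_code (enat n) = Suc n"

end

theory Submission
  imports Defs "HOL-Library.Multiset" "HOL-Library.FuncSet"
begin

text \<open>
  Normal fair proofs are stratified by a level that does not count proofs by cases; the terms of
  bounded level can be counted by a recursion over goals, and everything hinges on a computable
  level \<open>N\<close> such that there are infinitely many proofs iff some proof of level at most \<open>2 * N\<close> has
  level above \<open>N\<close>.

  For the existence of proofs only the multiplicities of the hypotheses matter, and condition (a) of
  fairness makes a case distinction consume one copy of a hypothesis \<open>S\<close>, which is replaced by one of
  its two residues, a smaller formula. If the residue is already present often enough, the case
  distinction can be skipped. As the number of case distinctions that cannot be skipped is bounded
  along every branch, multiplicities may be truncated at a bound depending only on the formula.
  This leaves finitely many goals; the set of goals provable at level \<open>h\<close> increases with \<open>h\<close>, the set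
  of goals with a proof of level above \<open>n\<close> decreases with \<open>n\<close>, and both are constant as soon as
  they do not change in one step, hence from the number of goals on.

  A recursion over goals is turned into a recursive function by searching for a table
  of intermediate results in which every entry is justified by earlier ones.
\<close>

section \<open>Closure properties of computable functions\<close>

text \<open>The obstacle is that the goals are infinite in number: implications may introduce the
  same hypothesis again and again, and condition (a) makes the number of copies matter, so a context
  cannot be replaced by its set of formulae. For \<mu>-hypotheses, which are never deleted, the set
  is enough. Each level contains only finitely many terms, because a case distinction, although it
  is not counted, trades a hypothesis for smaller ones. So there are infinitely many proofs exactly
  when their levels are unbounded. The interval from N to 2 * N has this origin. A proof of level
  above N contains a path that forces its level up; once the decreasing chain has stabilised, such a
  path exists for every length n. Conversely a path of length n is completed to a proof by filling
  all places off the path with proofs of level at most N, which gives level at most n + N. With n =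
  N, unbounded levels become visible at or below 2 * N. Hence comparing the two finite counts for N
  and 2 * N decides finiteness, and in the finite case the count for N is the answer.\<close>

definition computable :: "(nat \<Rightarrow> nat) \<Rightarrow> bool" where
  "computable f \<longleftrightarrow> (\<exists>p. \<forall>x. computes p [x] (f x))"

definition computable2 :: "(nat \<Rightarrow> nat \<Rightarrow> nat) \<Rightarrow> bool" where
  "computable2 f \<longleftrightarrow> (\<exists>p. \<forall>x y. computes p [x, y] (f x y))"

definition computable3 :: "(nat \<Rightarrow> nat \<Rightarrow> nat \<Rightarrow> nat) \<Rightarrow> bool" where
  "computable3 f \<longleftrightarrow> (\<exists>p. \<forall>x y z. computes p [x, y, z] (f x y z))"

lemma computes_Proj: "i < length xs \<Longrightarrow> y = xs ! i \<Longrightarrow> computes (Proj i) xs y"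
  by (simp add: computes.id)

lemma computes_Comp1: "computes g xs y \<Longrightarrow> computes f [y] z \<Longrightarrow> computes (Comp f [g]) xs z"
  by (rule computes.comp[where ys = "[y]"]) auto

lemma computes_Comp2:
  "computes g xs y \<Longrightarrow> computes h xs z \<Longrightarrow> computes f [y, z] w \<Longrightarrow> computes (Comp f [g, h]) xs w"
  by (rule computes.comp[where ys = "[y, z]"]) auto

lemma computable_ident: "computable (\<lambda>x. x)"
  unfolding computable_def by (rule exI[of _ "Proj 0"]) (auto intro: computes_Proj)

lemma computable_succ: "computable Suc"
  unfolding computable_def by (rule exI[of _ Succ]) (auto intro: computes.succ)

lemma computable_const: "computable (\<lambda>x. n)"
proof (induction n)
  case 0
  show ?case unfolding computable_def by (rule exI[of _ Zero]) (auto intro: computes.zero)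
next
  case (Suc n)
  then obtain p where "\<forall>x. computes p [x] n" unfolding computable_def by blast
  then show ?case unfolding computable_def
    by (intro exI[of _ "Comp Succ [p]"]) (auto intro: computes_Comp1 computes.succ)
qed

lemma computable_comp:
  assumes "computable f" and "computable g"
  shows "computable (\<lambda>x. f (g x))"
proof -
  obtain p where p: "\<And>u. computes p [u] (f u)"
    using assms(1) unfolding computable_def by blast
  obtain q where q: "\<And>x. computes q [x] (g x)"
    using assms(2) unfolding computable_def by blast
  have "computes (Comp p [q]) [x] (f (g x))" for x
    by (rule computes_Comp1[OF q p])
  then show ?thesis unfolding computable_def by blast
qed

lemma computable2_comp:
  assumes "computable2 f" and "computable g" and "computable h"
  shows "computable (\<lambda>x. f (g x) (h x))"
proof -
  obtain p where p: "\<And>u v. computes p [u, v] (f u v)"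
    using assms(1) unfolding computable2_def by blast
  obtain q where q: "\<And>x. computes q [x] (g x)"
    using assms(2) unfolding computable_def by blast
  obtain r where r: "\<And>x. computes r [x] (h x)"
    using assms(3) unfolding computable_def by blast
  have "computes (Comp p [q, r]) [x] (f (g x) (h x))" for x
    by (rule computes_Comp2[OF q r p])
  then show ?thesis unfolding computable_def by blast
qed

lemma computable2_comp1:
  assumes "computable f" and "computable2 g"
  shows "computable2 (\<lambda>x y. f (g x y))"
proof -
  obtain p where p: "\<And>u. computes p [u] (f u)"
    using assms(1) unfolding computable_def by blast
  obtain q where q: "\<And>x y. computes q [x, y] (g x y)"
    using assms(2) unfolding computable2_def by blast
  have "computes (Comp p [q]) [x, y] (f (g x y))" for x y
    by (rule computes_Comp1[OF q p])
  then show ?thesis unfolding computable2_def by blast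
qed

lemma computable2_comp2:
  assumes "computable2 f" and "computable2 g" and "computable2 h"
  shows "computable2 (\<lambda>x y. f (g x y) (h x y))"
proof -
  obtain p where p: "\<And>u v. computes p [u, v] (f u v)"
    using assms(1) unfolding computable2_def by blast
  obtain q where q: "\<And>x y. computes q [x, y] (g x y)"
    using assms(2) unfolding computable2_def by blast
  obtain r where r: "\<And>x y. computes r [x, y] (h x y)"
    using assms(3) unfolding computable2_def by blast
  have "computes (Comp p [q, r]) [x, y] (f (g x y) (h x y))" for x y
    by (rule computes_Comp2[OF q r p])
  then show ?thesis unfolding computable2_def by blast
qed

lemma computable3_comp1:
  assumes "computable f" and "computable3 g"
  shows "computable3 (\<lambda>x y z. f (g x y z))"
proof -
  obtain p where p: "\<And>u. computes p [u] (f u)"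
    using assms(1) unfolding computable_def by blast
  obtain q where q: "\<And>x y z. computes q [x, y, z] (g x y z)"
    using assms(2) unfolding computable3_def by blast
  have "computes (Comp p [q]) [x, y, z] (f (g x y z))" for x y z
    by (rule computes_Comp1[OF q p])
  then show ?thesis unfolding computable3_def by blast
qed

lemma computable3_comp2:
  assumes "computable2 f" and "computable3 g" and "computable3 h"
  shows "computable3 (\<lambda>x y z. f (g x y z) (h x y z))"
proof -
  obtain p where p: "\<And>u v. computes p [u, v] (f u v)"
    using assms(1) unfolding computable2_def by blast
  obtain q where q: "\<And>x y z. computes q [x, y, z] (g x y z)"
    using assms(2) unfolding computable3_def by blast
  obtain r where r: "\<And>x y z. computes r [x, y, z] (h x y z)"
    using assms(3) unfolding computable3_def by blast
  have "computes (Comp p [q, r]) [x, y, z] (f (g x y z) (h x y z))" for x y z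
    by (rule computes_Comp2[OF q r p])
  then show ?thesis unfolding computable3_def by blast
qed

lemma computable2_proj: "computable2 (\<lambda>x y. x)" "computable2 (\<lambda>x y. y)"
  unfolding computable2_def
  by (rule exI[of _ "Proj 0"], simp add: computes_Proj) (rule exI[of _ "Proj 1"], simp add: computes_Proj)

lemma computable3_proj: "computable3 (\<lambda>x y z. x)" "computable3 (\<lambda>x y z. y)" "computable3 (\<lambda>x y z. z)"
  unfolding computable3_def
  by (rule exI[of _ "Proj 0"], simp add: computes_Proj)
     (rule exI[of _ "Proj 1"], simp add: computes_Proj, rule exI[of _ "Proj 2"], simp add: computes_Proj)

section \<open>Primitive recursion and arithmetic\<close>

lemma computable2_rec:
  assumes "computable b" and "computable3 s"
  shows "computable2 (\<lambda>n x. rec_nat (b x) (\<lambda>m y. s m y x) n)"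
proof -
  obtain p where p: "\<And>x. computes p [x] (b x)" using assms(1) unfolding computable_def by blast
  obtain q where q: "\<And>x y z. computes q [x, y, z] (s x y z)" using assms(2) unfolding computable3_def by blast
  have "computes (PrimRec p q) [n, x] (rec_nat (b x) (\<lambda>m y. s m y x) n)" for n x
    by (induction n) (auto intro: computes.primrec_0 computes.primrec_Suc p q)
  then show ?thesis unfolding computable2_def by blast
qed

lemma computable2_flip: "computable2 f \<Longrightarrow> computable2 (\<lambda>x y. f y x)"
  using computable2_comp2[of f "\<lambda>x y. y" "\<lambda>x y. x"] computable2_proj by blast

lemma computable2_plus: "computable2 (+)"
proof -
  have "rec_nat x (\<lambda>m y. Suc y) n = n + x" for n x by (induction n) auto
  then show ?thesis
    using computable2_rec[OF computable_ident computable3_comp1[OF computable_succ computable3_proj(2)]] by simp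
qed

lemma computable2_times: "computable2 (*)"
proof -
  have "rec_nat 0 (\<lambda>m y. y + x) n = n * x" for n x :: nat by (induction n) auto
  then show ?thesis
    using computable2_rec[OF computable_const[of 0] computable3_comp2[OF computable2_plus computable3_proj(2,3)]] by simp
qed

lemma computable_pred: "computable (\<lambda>x. x - 1)"
proof -
  have "rec_nat 0 (\<lambda>m y. m) n = n - 1" for n :: nat by (cases n) auto
  then have "computable2 (\<lambda>n x. n - 1)"
    using computable2_rec[OF computable_const[of 0] computable3_proj(1)] by simp
  from computable2_comp[OF this computable_ident computable_ident] show ?thesis .
qed

lemma computable2_minus: "computable2 (-)"
proof -
  have "rec_nat x (\<lambda>m y. y - 1) n = x - n" for n x :: nat by (induction n) auto
  then have "computable2 (\<lambda>n x. x - n)"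
    using computable2_rec[OF computable_ident computable3_comp1[OF computable_pred computable3_proj(2)]] by simp
  then show ?thesis by (rule computable2_flip)
qed

lemma computable2_power: "computable2 (^)"
proof -
  have "rec_nat 1 (\<lambda>m y. y * x) n = x ^ n" for n x :: nat by (induction n) auto
  then have "computable2 (\<lambda>n x. x ^ n)"
    using computable2_rec[OF computable_const[of 1] computable3_comp2[OF computable2_times computable3_proj(2,3)]] by simp
  then show ?thesis by (rule computable2_flip)
qed

lemmas computable_Suc = computable_comp[OF computable_succ]
lemmas computable_plus = computable2_comp[OF computable2_plus]
lemmas computable_times = computable2_comp[OF computable2_times]
lemmas computable_minus = computable2_comp[OF computable2_minus]
lemmas computable_power = computable2_comp[OF computable2_power]

lemma computable_triangle: "computable triangle"
proof -
  have "rec_nat 0 (\<lambda>m y. y + Suc m) n = triangle n" for n :: nat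
    by (induction n) (auto simp: triangle_Suc)
  then have "computable2 (\<lambda>n x. triangle n)"
    using computable2_rec[OF computable_const[of 0] computable3_comp2[OF computable2_plus computable3_proj(2) computable3_comp1[OF computable_succ computable3_proj(1)]]]
    by simp
  from computable2_comp[OF this computable_ident computable_ident] show ?thesis .
qed

section \<open>Pairing and its inverse\<close>

definition pairc :: "nat \<Rightarrow> nat \<Rightarrow> nat" where "pairc a b = prod_encode (a, b)"
definition fstc :: "nat \<Rightarrow> nat" where "fstc z = fst (prod_decode z)"
definition sndc :: "nat \<Rightarrow> nat" where "sndc z = snd (prod_decode z)"

lemma fstc_pairc [simp]: "fstc (pairc a b) = a" and sndc_pairc [simp]: "sndc (pairc a b) = b"
  by (simp_all add: fstc_def sndc_def pairc_def)

lemma pairc_inject [simp]: "pairc a b = pairc c d \<longleftrightarrow> a = c \<and> b = d"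
  by (simp add: pairc_def)

lemma pairc_fstc_sndc [simp]: "pairc (fstc z) (sndc z) = z"
  by (simp add: fstc_def sndc_def pairc_def)

lemma computable_pairc: "computable f \<Longrightarrow> computable g \<Longrightarrow> computable (\<lambda>x. pairc (f x) (g x))"
  unfolding pairc_def prod_encode_def
  by (simp, intro computable_plus computable_comp[OF computable_triangle])

lemma computable2_eq: "computable2 (\<lambda>x y. if x = y then 1 else (0::nat))"
proof -
  have "(if x = y then 1 else 0) = 1 - ((x - y) + (y - x))" for x y :: nat by auto
  moreover have "computable2 (\<lambda>x y. 1 - ((x - y) + (y - x)))"
    using computable2_comp1[OF computable_minus[OF computable_const[of 1] computable_ident]
        computable2_comp2[OF computable2_plus computable2_minus computable2_flip[OF computable2_minus]]] by simp
  ultimately show ?thesis by simp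
qed

text \<open>Pairs are numbered along antidiagonals, and z lies on the one with index
  \<open>fstc z + sndc z\<close>. Passing to \<open>Suc z\<close> changes the antidiagonal exactly
  when \<open>Suc z\<close> is the next triangular number, so the index is obtained by primitive
  recursion; both projections then follow by subtraction.\<close>

lemma rec_diag: "rec_nat 0 (\<lambda>m y. y + (if triangle (Suc y) = Suc m then 1 else 0)) z = fstc z + sndc z"
proof (induction z)
  case 0
  then show ?case by (simp add: fstc_def sndc_def prod_decode_def prod_decode_aux.simps)
next
  case (Suc z)
  define a b where "a = fstc z" and "b = sndc z"
  have z: "z = pairc a b" by (simp add: a_def b_def)
  have tz: "z = triangle (a + b) + a" by (simp add: z pairc_def prod_encode_def)
  have step: "rec_nat 0 (\<lambda>m y. y + (if triangle (Suc y) = Suc m then 1 else 0)) (Suc z) =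
      (a + b) + (if triangle (Suc (a + b)) = Suc z then 1 else 0)"
    using Suc by (simp only: nat.rec a_def b_def)
  show ?case
    unfolding step
  proof (cases b)
    case 0
    then have "Suc z = pairc 0 (Suc a)" using tz by (simp add: pairc_def prod_encode_def triangle_Suc)
    then have "fstc (Suc z) + sndc (Suc z) = Suc a" by simp
    then show "(a + b) + (if triangle (Suc (a + b)) = Suc z then 1 else 0) = fstc (Suc z) + sndc (Suc z)"
      using tz 0 by simp
  next
    case (Suc c)
    then have "Suc z = pairc (Suc a) c" using tz by (simp add: pairc_def prod_encode_def)
    then have "fstc (Suc z) + sndc (Suc z) = a + b" using Suc by simp
    then show "(a + b) + (if triangle (Suc (a + b)) = Suc z then 1 else 0) = fstc (Suc z) + sndc (Suc z)"
      using tz Suc by simp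
  qed
qed

lemma computable_diag: "computable (\<lambda>z. fstc z + sndc z)"
proof -
  have "computable2 (\<lambda>m y. y + (if triangle (Suc y) = Suc m then 1 else 0))"
    by (rule computable2_comp2[OF computable2_plus computable2_proj(2)],
        rule computable2_comp2[OF computable2_eq, of "\<lambda>m y. triangle (Suc y)" "\<lambda>m y. Suc m"])
       (rule computable2_comp1[OF computable_comp[OF computable_triangle computable_succ] computable2_proj(2)]
             computable2_comp1[OF computable_succ computable2_proj(1)])+
  then have "computable3 (\<lambda>m y x. y + (if triangle (Suc y) = Suc m then 1 else 0))"
    by (rule computable3_comp2[OF _ computable3_proj(1,2)])
  from computable2_rec[OF computable_const[of 0] this] have "computable2 (\<lambda>z x. fstc z + sndc z)"
    by (simp only: rec_diag)
  from computable2_comp[OF this computable_ident computable_ident] show ?thesis .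
qed

lemma computable_fstc: "computable f \<Longrightarrow> computable (\<lambda>x. fstc (f x))"
proof -
  have "fstc z = z - triangle (fstc z + sndc z)" for z
  proof -
    have "pairc (fstc z) (sndc z) = z" by simp
    then show ?thesis unfolding pairc_def prod_encode_def by simp
  qed
  moreover have "computable (\<lambda>z. z - triangle (fstc z + sndc z))"
    by (intro computable_minus computable_ident computable_comp[OF computable_triangle] computable_diag)
  ultimately have "computable fstc" by simp
  then show "computable f \<Longrightarrow> computable (\<lambda>x. fstc (f x))" by (rule computable_comp)
qed

lemma computable_sndc: "computable f \<Longrightarrow> computable (\<lambda>x. sndc (f x))"
proof -
  have "sndc z = (fstc z + sndc z) - fstc z" for z by simp
  moreover have "computable (\<lambda>z. (fstc z + sndc z) - fstc z)"
    by (intro computable_minus computable_diag computable_fstc computable_ident)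
  ultimately have "computable sndc" by simp
  then show "computable f \<Longrightarrow> computable (\<lambda>x. sndc (f x))" by (rule computable_comp)
qed

text \<open>Once pairing is available, closure lemmas can be stated for unary functions throughout:
  the step of a primitive recursion is read as a function of the nested pair of counter, previous
  value and parameter.\<close>

lemma computable_curry:
  assumes "computable (\<lambda>z. s (fstc z) (fstc (sndc z)) (sndc (sndc z)))"
  shows "computable3 s"
proof -
  have pr2: "computable2 pairc" unfolding pairc_def prod_encode_def
    using computable2_comp2[OF computable2_plus computable2_comp1[OF computable_triangle computable2_plus] computable2_proj(1)] by simp
  show ?thesis
    using computable3_comp1[OF assms computable3_comp2[OF pr2 computable3_proj(1) computable3_comp2[OF pr2 computable3_proj(2,3)]]] by simp
qed

lemma computable_rec:
  assumes "computable n" and "computable b" and "computable (\<lambda>z. s (fstc z) (fstc (sndc z)) (sndc (sndc z)))"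
  shows "computable (\<lambda>x. rec_nat (b x) (\<lambda>m y. s m y x) (n x))"
  using computable2_comp[OF computable2_rec[OF assms(2) computable_curry[OF assms(3)]] assms(1) computable_ident] .

lemma computable_funpow:
  assumes "computable n" and "computable b" and "computable f"
  shows "computable (\<lambda>x. (f ^^ n x) (b x))"
proof -
  have "(f ^^ k) c = rec_nat c (\<lambda>m y. f y) k" for k c
    by (induction k) auto
  then show ?thesis
    using computable_rec[OF assms(1,2), of "\<lambda>m y x. f y"] computable_comp[OF assms(3) computable_fstc[OF computable_sndc[OF computable_ident]]]
    by simp
qed

section \<open>Decidable predicates, bounded quantifiers and unbounded search\<close>

definition decidable :: "(nat \<Rightarrow> bool) \<Rightarrow> bool" where
  "decidable P \<longleftrightarrow> computable (\<lambda>x. if P x then 1 else 0)"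

lemma decidable_eq: "computable f \<Longrightarrow> computable g \<Longrightarrow> decidable (\<lambda>x. f x = g x)"
  unfolding decidable_def by (rule computable2_comp[OF computable2_eq])

lemma decidable_not: assumes "decidable P" shows "decidable (\<lambda>x. \<not> P x)"
proof -
  have "(if \<not> P x then 1 else 0) = 1 - (if P x then 1 else (0::nat))" for x by simp
  then show ?thesis using computable_minus[OF computable_const[of 1] assms[unfolded decidable_def]]
    unfolding decidable_def by simp
qed

lemma decidable_conj: assumes "decidable P" "decidable Q" shows "decidable (\<lambda>x. P x \<and> Q x)"
proof -
  have "(if P x \<and> Q x then 1 else 0) = (if P x then 1 else 0) * (if Q x then 1 else (0::nat))" for x
    by simp
  then show ?thesis using computable_times[OF assms[unfolded decidable_def]] unfolding decidable_def by simp
qed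

lemma decidable_disj: "decidable P \<Longrightarrow> decidable Q \<Longrightarrow> decidable (\<lambda>x. P x \<or> Q x)"
  using decidable_not[OF decidable_conj[OF decidable_not decidable_not], of P Q] by simp

lemma decidable_ex:
  assumes "computable n" and "decidable (\<lambda>z. P (fstc z) (sndc z))"
  shows "decidable (\<lambda>x. \<exists>i < n x. P i x)"
proof -
  \<comment> \<open>\<open>1 - (1 - n)\<close> is 1 for positive n and 0 for n = 0, so the
    accumulator remains a truth value.\<close>
  have *: "(if \<exists>i < k. P i x then 1 else (0::nat)) =
      rec_nat 0 (\<lambda>m y. 1 - (1 - (y + (if P m x then 1 else 0)))) k" for k x
  proof (induction k)
    case (Suc k)
    have "rec_nat (0::nat) (\<lambda>m y. 1 - (1 - (y + (if P m x then 1 else 0)))) (Suc k) =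
        1 - (1 - ((if \<exists>i < k. P i x then 1 else 0) + (if P k x then 1 else 0)))"
      by (simp only: nat.rec Suc.IH)
    then show ?case by (auto simp: less_Suc_eq)
  qed simp
  have "computable (\<lambda>z. if P (fstc z) (sndc (sndc z)) then 1 else 0)"
    using computable_comp[OF assms(2)[unfolded decidable_def] computable_pairc[OF computable_fstc[OF computable_ident] computable_sndc[OF computable_sndc[OF computable_ident]]]]
    by simp
  then have "computable (\<lambda>z. 1 - (1 - (fstc (sndc z) + (if P (fstc z) (sndc (sndc z)) then 1 else 0))))"
    by (intro computable_minus computable_const computable_plus computable_fstc computable_sndc computable_ident)
  from computable_rec[OF assms(1) computable_const[of 0] this] show ?thesis
    unfolding decidable_def * .
qed

lemma decidable_all:
  assumes "computable n" and "decidable (\<lambda>z. P (fstc z) (sndc z))"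
  shows "decidable (\<lambda>x. \<forall>i < n x. P i x)"
  using decidable_not[OF decidable_ex[OF assms(1) decidable_not[OF assms(2)]]] by simp

lemma computable_if:
  assumes "decidable P" and "computable f" and "computable g"
  shows "computable (\<lambda>x. if P x then f x else g x)"
proof -
  have "(if P x then f x else g x) = (if P x then 1 else 0) * f x + (1 - (if P x then 1 else 0)) * g x" for x
    by simp
  moreover have "computable (\<lambda>x. (if P x then 1 else 0) * f x + (1 - (if P x then 1 else 0)) * g x)"
    using assms(1) unfolding decidable_def by (intro computable_plus computable_times computable_minus computable_const assms(2,3))
  ultimately show ?thesis by simp
qed

text \<open>\<open>Mini\<close> finds the least witness and its value under \<open>f\<close> is
  returned; as all witnesses have the same value, the choice is harmless. The claim is relative to
  inputs that have a witness, since the search diverges on the others.\<close>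

lemma computes_search:
  assumes "decidable P" and "computable f" 
  shows "\<exists>p. \<forall>x y. (\<exists>c. P (pairc c x)) \<longrightarrow> (\<forall>c. P (pairc c x) \<longrightarrow> f c = y) \<longrightarrow> computes p [x] y"
proof -
  have "computable (\<lambda>z. if P z then 0 else 1)"
    using computable_if[OF assms(1) computable_const[of 0] computable_const[of 1]] .
  moreover have "computable2 pairc" unfolding pairc_def prod_encode_def
    using computable2_comp2[OF computable2_plus computable2_comp1[OF computable_triangle computable2_plus] computable2_proj(1)] by simp
  ultimately have "computable2 (\<lambda>c x. if P (pairc c x) then 0 else 1)"
    using computable2_comp1 by blast
  then obtain q where q: "\<And>c x. computes q [c, x] (if P (pairc c x) then 0 else 1)"
    unfolding computable2_def by blast
  obtain r where r: "\<And>x. computes r [x] (f x)" using assms(2) unfolding computable_def by blast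
  have "computes (Comp r [Mini q]) [x] y"
    if ex: "\<exists>c. P (pairc c x)" and un: "\<forall>c. P (pairc c x) \<longrightarrow> f c = y" for x y
  proof -
    define c where "c = (LEAST c. P (pairc c x))"
    have c: "P (pairc c x)" unfolding c_def using ex by (rule LeastI_ex)
    have least: "\<not> P (pairc i x)" if "i < c" for i using not_less_Least that unfolding c_def by blast
    have 1: "computes q (c # [x]) 0" using q[of c x] c by simp
    have "computes q [i, x] (Suc 0)" if "i < c" for i
      using q[of i x] least[OF that] by simp
    then have 2: "\<forall>i<c. \<exists>y. computes q (i # [x]) (Suc y)" by blast
    have "computes (Mini q) [x] c" by (rule computes.mini[OF 1 2])
    then show ?thesis using r[of c] un c by (auto intro: computes_Comp1)
  qed
  then show ?thesis by blast
qed

section \<open>Lists as numbers\<close>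

definition hdc :: "nat \<Rightarrow> nat" where "hdc c = fstc (c - 1)"
definition tlc :: "nat \<Rightarrow> nat" where "tlc c = sndc (c - 1)"
definition consc :: "nat \<Rightarrow> nat \<Rightarrow> nat" where "consc a c = Suc (pairc a c)"
definition nthc :: "nat \<Rightarrow> nat \<Rightarrow> nat" where "nthc c i = hdc ((tlc ^^ i) c)"

lemma computable_hdc: "computable f \<Longrightarrow> computable (\<lambda>x. hdc (f x))" and computable_tlc: "computable f \<Longrightarrow> computable (\<lambda>x. tlc (f x))"
  unfolding hdc_def tlc_def by (intro computable_fstc computable_sndc computable_minus computable_const; assumption)+

lemma computable_consc: "computable f \<Longrightarrow> computable g \<Longrightarrow> computable (\<lambda>x. consc (f x) (g x))"
  unfolding consc_def by (intro computable_Suc computable_pairc)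

lemma computable_nthc: "computable f \<Longrightarrow> computable g \<Longrightarrow> computable (\<lambda>x. nthc (f x) (g x))"
  unfolding nthc_def by (intro computable_hdc computable_funpow computable_tlc[OF computable_ident])

lemma consc_list: "consc x (list_encode xs) = list_encode (x # xs)"
  by (simp add: consc_def pairc_def)

lemma hdc_consc [simp]: "hdc (consc a c) = a" and tlc_consc [simp]: "tlc (consc a c) = c"
  by (simp_all add: hdc_def tlc_def consc_def)

lemma zero_pairc: "0 = pairc 0 0" by (simp add: pairc_def prod_encode_def)

text \<open>Zero codes the empty list and is also the pair of two zeros, so head and tail map it to
  0. Hence reading beyond the end of a list yields 0, the value that later also marks a deleted
  hypothesis.\<close>

lemma hdc_0 [simp]: "hdc 0 = 0" and tlc_0 [simp]: "tlc 0 = 0"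
  unfolding hdc_def tlc_def by (metis zero_pairc diff_0_eq_0 fstc_pairc sndc_pairc)+

lemma list_encode_Cons': "list_encode (x # xs) = consc x (list_encode xs)"
  by (simp add: consc_list)

lemma tlc_funpow: "(tlc ^^ i) (list_encode xs) = list_encode (drop i xs)"
proof (induction i arbitrary: xs)
  case (Suc i)
  show ?case
  proof (cases xs)
    case Nil
    then show ?thesis using Suc[of "[]"] by (simp add: funpow_swap1)
  next
    case (Cons a ys)
    then show ?thesis using Suc[of ys]
      by (simp add: funpow_swap1 list_encode_Cons' del: list_encode.simps)
  qed
qed simp

lemma nthc_list: "nthc (list_encode xs) i = (if i < length xs then xs ! i else 0)"
proof (cases "i < length xs")
  case True
  then have "drop i xs = xs ! i # drop (Suc i) xs" by (simp add: Cons_nth_drop_Suc)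
  then show ?thesis using True
    by (simp add: nthc_def tlc_funpow list_encode_Cons' del: list_encode.simps)
qed (simp add: nthc_def tlc_funpow)

text \<open>A zipper: move along the list, replace the head, and move back.\<close>

definition fwd :: "nat \<Rightarrow> nat" where "fwd z = pairc (consc (hdc (sndc z)) (fstc z)) (tlc (sndc z))"
definition bwd :: "nat \<Rightarrow> nat" where "bwd z = pairc (tlc (fstc z)) (consc (hdc (fstc z)) (sndc z))"
definition delc :: "nat \<Rightarrow> nat \<Rightarrow> nat" where
  "delc c i = (let z = (fwd ^^ i) (pairc 0 c) in sndc ((bwd ^^ i) (pairc (fstc z) (consc 0 (tlc (sndc z))))))"

lemma computable_delc: "computable f \<Longrightarrow> computable g \<Longrightarrow> computable (\<lambda>x. delc (f x) (g x))"
  unfolding delc_def Let_def fwd_def bwd_def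
  by (intro computable_sndc computable_funpow computable_pairc computable_fstc computable_consc computable_tlc computable_hdc computable_const computable_ident)

lemma fwd_list:
  "i \<le> length xs \<Longrightarrow>
    (fwd ^^ i) (pairc c (list_encode xs)) = pairc (list_encode (rev (take i xs) @ list_decode c)) (list_encode (drop i xs))"
proof (induction i arbitrary: xs c)
  case (Suc i)
  then obtain a ys where xs: "xs = a # ys" by (cases xs) auto
  have "(fwd ^^ Suc i) (pairc c (list_encode xs)) = (fwd ^^ i) (fwd (pairc c (list_encode xs)))"
    by (simp add: funpow_swap1)
  also have "fwd (pairc c (list_encode xs)) = pairc (list_encode (a # list_decode c)) (list_encode ys)"
    by (simp add: fwd_def xs list_encode_Cons' del: list_encode.simps)
  finally show ?case using Suc xs by (simp del: list_encode.simps)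
qed simp

lemma bwd_list:
  "(bwd ^^ length xs) (pairc (list_encode xs) (list_encode ys)) = pairc 0 (list_encode (rev xs @ ys))"
proof (induction xs arbitrary: ys)
  case (Cons a xs)
  have "(bwd ^^ length (a # xs)) (pairc (list_encode (a # xs)) (list_encode ys)) =
    (bwd ^^ length xs) (bwd (pairc (list_encode (a # xs)) (list_encode ys)))"
    by (simp add: funpow_swap1)
  also have "bwd (pairc (list_encode (a # xs)) (list_encode ys)) = pairc (list_encode xs) (list_encode (a # ys))"
    by (simp add: bwd_def list_encode_Cons' del: list_encode.simps)
  finally show ?case using Cons by (simp del: list_encode.simps)
qed simp

lemma delc_list:
  assumes "i < length xs"
  shows "delc (list_encode xs) i = list_encode (xs[i := 0])"
proof -
  have "(fwd ^^ i) (pairc 0 (list_encode xs)) = pairc (list_encode (rev (take i xs))) (list_encode (drop i xs))"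
    using fwd_list[of i xs 0] assms by simp
  moreover have "drop i xs = xs ! i # drop (Suc i) xs" using assms by (simp add: Cons_nth_drop_Suc)
  ultimately have "delc (list_encode xs) i =
      sndc ((bwd ^^ i) (pairc (list_encode (rev (take i xs))) (list_encode (0 # drop (Suc i) xs))))"
    by (simp add: delc_def list_encode_Cons' del: list_encode.simps)
  also have "\<dots> = sndc ((bwd ^^ length (rev (take i xs))) (pairc (list_encode (rev (take i xs))) (list_encode (0 # drop (Suc i) xs))))"
    using assms by simp
  also have "\<dots> = list_encode (xs[i := 0])"
    unfolding bwd_list using assms by (simp add: upd_conv_take_nth_drop del: list_encode.simps)
  finally show ?thesis .
qed

section \<open>Evaluation of recursive sums and products\<close>

text \<open>Expressions are numbers tagged as constant, sum, product or call, and \<open>ex\<close>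
  unfolds a call into another expression. As an inductive relation, evaluation can be defined before
  any termination argument; that is supplied together with the counts, for the calls that
  occur.\<close>

inductive Ev :: "(nat \<Rightarrow> nat) \<Rightarrow> nat \<Rightarrow> nat \<Rightarrow> bool" for ex :: "nat \<Rightarrow> nat" where
  Ev_const: "Ev ex (pairc 0 n) n"
| Ev_sum: "Ev ex a m \<Longrightarrow> Ev ex b n \<Longrightarrow> Ev ex (pairc 1 (pairc a b)) (m + n)"
| Ev_prod: "Ev ex a m \<Longrightarrow> Ev ex b n \<Longrightarrow> Ev ex (pairc 2 (pairc a b)) (m * n)"
| Ev_call: "Ev ex (ex x) n \<Longrightarrow> Ev ex (pairc 3 x) n"

lemma Ev_deterministic: "Ev ex x m \<Longrightarrow> Ev ex x n \<Longrightarrow> m = n"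
proof (induction arbitrary: n rule: Ev.induct)
  case Ev_const
  then show ?case by (auto elim: Ev.cases)
next
  case (Ev_sum a m b k)
  from Ev_sum.prems show ?case by (cases rule: Ev.cases) (auto dest: Ev_sum.IH)
next
  case (Ev_prod a m b k)
  from Ev_prod.prems show ?case by (cases rule: Ev.cases) (auto dest: Ev_prod.IH)
next
  case (Ev_call x k)
  from Ev_call.prems show ?case by (cases rule: Ev.cases) (auto dest: Ev_call.IH)
qed

section \<open>Tables as certificates of evaluation\<close>

definition justified :: "(nat \<Rightarrow> nat) \<Rightarrow> nat set \<Rightarrow> nat \<Rightarrow> bool" where
  "justified ex S a \<longleftrightarrow> fstc (fstc a) = 0 \<and> sndc a = sndc (fstc a)
    \<or> (\<exists>c\<in>S. \<exists>d\<in>S. fstc c = fstc (sndc (fstc a)) \<and> fstc d = sndc (sndc (fstc a)) \<and>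
        (fstc (fstc a) = 1 \<and> sndc a = sndc c + sndc d \<or> fstc (fstc a) = 2 \<and> sndc a = sndc c * sndc d))
    \<or> (\<exists>c\<in>S. fstc (fstc a) = 3 \<and> fstc c = ex (sndc (fstc a)) \<and> sndc a = sndc c)"

lemma justified_mono: "justified ex S a \<Longrightarrow> S \<subseteq> T \<Longrightarrow> justified ex T a"
  unfolding justified_def by blast

lemma justified_Ev:
  assumes "justified ex S a" and "\<And>c. c \<in> S \<Longrightarrow> Ev ex (fstc c) (sndc c)"
  shows "Ev ex (fstc a) (sndc a)"
proof -
  have a: "pairc (fstc (fstc a)) (sndc (fstc a)) = fstc a" and b: "pairc (fstc (sndc (fstc a))) (sndc (sndc (fstc a))) = sndc (fstc a)"
    by simp_all
  from assms(1) show ?thesis unfolding justified_def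
  proof (elim disjE conjE bexE)
    assume "fstc (fstc a) = 0" "sndc a = sndc (fstc a)"
    then show ?thesis using a Ev_const[of ex "sndc (fstc a)"] by (simp del: pairc_fstc_sndc)
  next
    fix c d assume *: "c \<in> S" "d \<in> S" "fstc c = fstc (sndc (fstc a))" "fstc d = sndc (sndc (fstc a))"
      "fstc (fstc a) = 1" "sndc a = sndc c + sndc d"
    show ?thesis using Ev_sum[OF assms(2)[OF *(1)] assms(2)[OF *(2)]] a unfolding *(3-6) b by simp
  next
    fix c d assume *: "c \<in> S" "d \<in> S" "fstc c = fstc (sndc (fstc a))" "fstc d = sndc (sndc (fstc a))"
      "fstc (fstc a) = 2" "sndc a = sndc c * sndc d"
    show ?thesis using Ev_prod[OF assms(2)[OF *(1)] assms(2)[OF *(2)]] a unfolding *(3-6) b by simp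
  next
    fix c assume *: "c \<in> S" "fstc (fstc a) = 3" "fstc c = ex (sndc (fstc a))" "sndc a = sndc c"
    show ?thesis using Ev_call[of ex "sndc (fstc a)" "sndc c"] assms(2)[OF *(1)] a unfolding *(2-4) by simp
  qed
qed

text \<open>An entry pairs an expression with its claimed value. Letting it rest on strictly earlier
  entries rules out circular justifications of calls that do not terminate.\<close>

definition evidence :: "(nat \<Rightarrow> nat) \<Rightarrow> nat list \<Rightarrow> bool" where
  "evidence ex xs \<longleftrightarrow> (\<forall>i < length xs. justified ex (set (take i xs)) (xs ! i))"

lemma evidence_Ev:
  assumes "evidence ex xs" and "i < length xs"
  shows "Ev ex (fstc (xs ! i)) (sndc (xs ! i))"
  using assms(2)
proof (induction i rule: less_induct)
  case (less i)
  then have "justified ex (set (take i xs)) (xs ! i)" using assms(1) by (simp add: evidence_def)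
  then show ?case
  proof (rule justified_Ev)
    fix c assume "c \<in> set (take i xs)"
    then obtain j where "j < i" "j < length xs" "c = xs ! j" by (auto simp: in_set_conv_nth)
    then show "Ev ex (fstc c) (sndc c)" using less.IH by simp
  qed
qed

lemma evidence_append:
  assumes "evidence ex xs" and "evidence ex ys"
  shows "evidence ex (xs @ ys)"
  unfolding evidence_def
proof (intro allI HOL.impI)
  fix i assume i: "i < length (xs @ ys)"
  show "justified ex (set (take i (xs @ ys))) ((xs @ ys) ! i)"
  proof (cases "i < length xs")
    case True
    then show ?thesis using assms(1) by (simp add: evidence_def nth_append)
  next
    case False
    then have "justified ex (set (take (i - length xs) ys)) (ys ! (i - length xs))"
      using assms(2) i by (simp add: evidence_def)
    then show ?thesis using False by (auto simp: nth_append intro: justified_mono)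
  qed
qed

lemma evidence_snoc:
  assumes "evidence ex xs" and "justified ex (set xs) a"
  shows "evidence ex (xs @ [a])"
  using assms by (simp add: evidence_def nth_append less_Suc_eq)

lemma Ev_evidence: "Ev ex x n \<Longrightarrow> \<exists>xs. evidence ex xs \<and> pairc x n \<in> set xs"
proof (induction rule: Ev.induct)
  case (Ev_const n)
  have "evidence ex [pairc (pairc 0 n) n]" by (simp add: evidence_def justified_def)
  then show ?case by (intro exI[of _ "[pairc (pairc 0 n) n]"]) simp
next
  case (Ev_sum a m b n)
  then obtain xs ys where "evidence ex xs" "pairc a m \<in> set xs" "evidence ex ys" "pairc b n \<in> set ys" by blast
  moreover from this have "justified ex (set (xs @ ys)) (pairc (pairc 1 (pairc a b)) (m + n))"
    unfolding justified_def
    by (intro disjI2 disjI1 bexI[of _ "pairc a m"] bexI[of _ "pairc b n"]) auto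
  ultimately have "evidence ex ((xs @ ys) @ [pairc (pairc 1 (pairc a b)) (m + n)])"
    by (intro evidence_snoc evidence_append)
  then show ?case by (intro exI[of _ "(xs @ ys) @ [pairc (pairc 1 (pairc a b)) (m + n)]"]) simp
next
  case (Ev_prod a m b n)
  then obtain xs ys where "evidence ex xs" "pairc a m \<in> set xs" "evidence ex ys" "pairc b n \<in> set ys" by blast
  moreover from this have "justified ex (set (xs @ ys)) (pairc (pairc 2 (pairc a b)) (m * n))"
    unfolding justified_def
    by (intro disjI2 disjI1 bexI[of _ "pairc a m"] bexI[of _ "pairc b n"]) auto
  ultimately have "evidence ex ((xs @ ys) @ [pairc (pairc 2 (pairc a b)) (m * n)])"
    by (intro evidence_snoc evidence_append)
  then show ?case by (intro exI[of _ "(xs @ ys) @ [pairc (pairc 2 (pairc a b)) (m * n)]"]) simp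
next
  case (Ev_call x n)
  then obtain xs where "evidence ex xs" "pairc (ex x) n \<in> set xs" by blast
  moreover from this have "justified ex (set xs) (pairc (pairc 3 x) n)"
    unfolding justified_def by (intro disjI2 bexI[of _ "pairc (ex x) n"]) auto
  ultimately have "evidence ex (xs @ [pairc (pairc 3 x) n])" by (intro evidence_snoc)
  then show ?case by (intro exI[of _ "xs @ [pairc (pairc 3 x) n]"]) simp
qed

text \<open>This is \<open>evidence\<close> with the earlier entries addressed by positions below i:
  all quantifiers are now bounded by numbers, as the closure lemmas for decidability
  require.\<close>

definition evc :: "(nat \<Rightarrow> nat) \<Rightarrow> nat \<Rightarrow> nat \<Rightarrow> bool" where
  "evc ex n l \<longleftrightarrow> (\<forall>i < n. 
      (fstc (fstc (nthc l i)) = 0 \<and> sndc (nthc l i) = sndc (fstc (nthc l i))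
    \<or> (\<exists>j < i. \<exists>k < i. fstc (nthc l j) = fstc (sndc (fstc (nthc l i))) \<and> fstc (nthc l k) = sndc (sndc (fstc (nthc l i))) \<and>
        (fstc (fstc (nthc l i)) = 1 \<and> sndc (nthc l i) = sndc (nthc l j) + sndc (nthc l k) \<or>
         fstc (fstc (nthc l i)) = 2 \<and> sndc (nthc l i) = sndc (nthc l j) * sndc (nthc l k)))
    \<or> (\<exists>j < i. fstc (fstc (nthc l i)) = 3 \<and> fstc (nthc l j) = ex (sndc (fstc (nthc l i))) \<and>
         sndc (nthc l i) = sndc (nthc l j))))"

lemma evc_evidence: "evc ex n l \<longleftrightarrow> evidence ex (map (nthc l) [0..<n])"
proof -
  have *: "set (take i (map (nthc l) [0..<n])) = nthc l ` {..<i}" if "i < n" for i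
    using that by (simp add: take_map lessThan_atLeast0)
  show ?thesis unfolding evc_def evidence_def
    by (simp only: length_map length_upt diff_zero, intro all_cong) (simp add: * justified_def, blast)
qed

lemma decidable_evc:
  assumes "computable ex" and "computable f" and "computable g"
  shows "decidable (\<lambda>x. evc ex (f x) (g x))"
  unfolding evc_def
  by (intro decidable_all decidable_disj decidable_conj decidable_ex decidable_eq computable_fstc computable_sndc computable_nthc computable_const computable_plus computable_times computable_ident
      computable_comp[OF assms(1)] computable_comp[OF assms(2)] computable_comp[OF assms(3)])

theorem Ev_computable:
  assumes "computable ex"
  shows "\<exists>p. \<forall>x y. Ev ex x y \<longrightarrow> computes p [x] y"
proof -
  \<comment> \<open>In \<open>z = pairc c x\<close> the candidate \<open>c\<close> consists of a
    value, a length and a list code; it is accepted if the list is a valid table in which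
    \<open>x\<close> has that value. Determinism of \<open>Ev\<close> makes the value the same for
    all accepted candidates.\<close>
  define P where "P z \<longleftrightarrow> evc ex (fstc (sndc (fstc z))) (sndc (sndc (fstc z))) \<and>
    (\<exists>i < fstc (sndc (fstc z)). nthc (sndc (sndc (fstc z))) i = pairc (sndc z) (fstc (fstc z)))" for z
  have "decidable P" unfolding P_def
    by (intro decidable_conj decidable_evc assms decidable_ex decidable_eq computable_nthc computable_pairc computable_fstc computable_sndc computable_ident)
  from computes_search[OF this computable_fstc[OF computable_ident]] obtain p where p:
    "\<And>x y. \<exists>c. P (pairc c x) \<Longrightarrow> \<forall>c. P (pairc c x) \<longrightarrow> fstc c = y \<Longrightarrow> computes p [x] y"
    by blast
  have "computes p [x] y" if y: "Ev ex x y" for x y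
  proof -
    obtain xs where xs: "evidence ex xs" "pairc x y \<in> set xs" using Ev_evidence[OF y] by blast
    have "map (nthc (list_encode xs)) [0..<length xs] = xs"
      by (rule nth_equalityI) (auto simp: nthc_list)
    then have "P (pairc (pairc y (pairc (length xs) (list_encode xs))) x)"
      using xs by (auto simp: P_def evc_evidence in_set_conv_nth nthc_list)
    then have 1: "\<exists>c. P (pairc c x)" by blast
    have "fstc c = y" if c: "P (pairc c x)" for c
    proof -
      obtain i where i: "i < fstc (sndc c)" "nthc (sndc (sndc c)) i = pairc x (fstc c)"
        using c by (auto simp: P_def)
      have "evidence ex (map (nthc (sndc (sndc c))) [0..<fstc (sndc c)])"
        using c by (simp add: P_def evc_evidence)
      from evidence_Ev[OF this, of i] have "Ev ex x (fstc c)" using i by simp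
      then show ?thesis using y by (rule Ev_deterministic)
    qed
    then have 2: "\<forall>c. P (pairc c x) \<longrightarrow> fstc c = y" by blast
    show ?thesis by (rule p[OF 1 2])
  qed
  then show ?thesis by blast
qed

section \<open>Normal fair terms by level\<close>

text \<open>
  In \<open>nf h \<Gamma> \<Delta> t A\<close> a hypothesis deleted by a case distinction is \<open>None\<close>, so that indices do not shift.
  The level \<open>h\<close> is the same for a case distinction and its branches; this is what makes existence at
  level \<open>h\<close> insensitive to skipping case distinctions.
\<close>

inductive nf :: "nat \<Rightarrow> 'a fm option list \<Rightarrow> 'a fm list \<Rightarrow> trm \<Rightarrow> 'a fm \<Rightarrow> bool"
  and spine :: "nat \<Rightarrow> 'a fm option list \<Rightarrow> 'a fm list \<Rightarrow> nat \<Rightarrow> 'a fm \<Rightarrow> elim list \<Rightarrow> 'a fm \<Rightarrow> bool"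
where
  nf_Lam: "nf h (Some A # \<Gamma>) \<Delta> M B \<Longrightarrow> nf (Suc h) \<Gamma> \<Delta> (Lam M) (Imp A B)"
| nf_MkPair: "nf h \<Gamma> \<Delta> M A \<Longrightarrow> nf h \<Gamma> \<Delta> N B \<Longrightarrow> nf (Suc h) \<Gamma> \<Delta> (MkPair M N) (And A B)"
| nf_Inj1: "nf h \<Gamma> \<Delta> M A \<Longrightarrow> nf (Suc h) \<Gamma> \<Delta> (Inj1 M) (Or A B)"
| nf_Inj2: "nf h \<Gamma> \<Delta> M B \<Longrightarrow> nf (Suc h) \<Gamma> \<Delta> (Inj2 M) (Or A B)"
| nf_Mu: "nf h \<Gamma> (A # \<Delta>) M Bot \<Longrightarrow> fair_contradiction \<Delta> A \<Longrightarrow> nf (Suc h) \<Gamma> \<Delta> (Mu M) A"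
| nf_Named: "a < length \<Delta> \<Longrightarrow> nf h \<Gamma> \<Delta> M (\<Delta> ! a) \<Longrightarrow> nf (Suc h) \<Gamma> \<Delta> (Named a M) Bot"
| nf_Var: "x < length \<Gamma> \<Longrightarrow> \<Gamma> ! x = Some S \<Longrightarrow> spine h \<Gamma> \<Delta> x S es A \<Longrightarrow>
    nf (Suc h) \<Gamma> \<Delta> (foldl App (Var x) es) A"
| spine_Nil: "spine h \<Gamma> \<Delta> x A [] A"
| spine_Arg: "nf h \<Gamma> \<Delta> N B \<Longrightarrow> spine h \<Gamma> \<Delta> x C es A \<Longrightarrow> spine h \<Gamma> \<Delta> x (Imp B C) (Arg N # es) A"
| spine_Proj1: "spine h \<Gamma> \<Delta> x B es A \<Longrightarrow> spine h \<Gamma> \<Delta> x (And B C) (Proj1 # es) A"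
| spine_Proj2: "spine h \<Gamma> \<Delta> x C es A \<Longrightarrow> spine h \<Gamma> \<Delta> x (And B C) (Proj2 # es) A"
| spine_Case: "nf (Suc h) (Some B # \<Gamma>[x := None]) \<Delta> N1 A \<Longrightarrow>
    nf (Suc h) (Some C # \<Gamma>[x := None]) \<Delta> N2 A \<Longrightarrow>
    spine h \<Gamma> \<Delta> x (Or B C) [Case N1 N2] A"

lemma nf_spine_Suc:
  "nf h \<Gamma> \<Delta> t A \<Longrightarrow> nf (Suc h) \<Gamma> \<Delta> t A"
  "spine h \<Gamma> \<Delta> x S es A \<Longrightarrow> spine (Suc h) \<Gamma> \<Delta> x S es A"
  by (induction rule: nf_spine.inducts) (auto intro: nf_spine.intros)

lemma nf_mono: "nf h \<Gamma> \<Delta> t A \<Longrightarrow> h \<le> k \<Longrightarrow> nf k \<Gamma> \<Delta> t A"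
  by (rotate_tac, induction rule: dec_induct) (auto intro: nf_spine_Suc)

section \<open>Normal terms, neutral terms and local forms of the fairness conditions\<close>

fun neutral :: "trm \<Rightarrow> bool" where
  "neutral (Var x) \<longleftrightarrow> True"
| "neutral (App M (Case N1 N2)) \<longleftrightarrow> False"
| "neutral (App M E) \<longleftrightarrow> neutral M"
| "neutral t \<longleftrightarrow> False"

text \<open>Neutral terms are variables followed by arguments and projections only. Every
  contraction needs an introduction, a \<mu>-abstraction or a case distinction in function position,
  and none of these is neutral.\<close>

lemma redex_App: "redex t \<Longrightarrow> \<exists>M E. t = App M E \<and> \<not> neutral M"
  unfolding redex_def by (erule exE, erule contracts.cases) auto

lemma normal_simps [simp]:
  "normal (Var x)"
  "normal (Lam M) \<longleftrightarrow> normal M"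
  "normal (MkPair M N) \<longleftrightarrow> normal M \<and> normal N"
  "normal (Inj1 M) \<longleftrightarrow> normal M"
  "normal (Inj2 M) \<longleftrightarrow> normal M"
  "normal (Mu M) \<longleftrightarrow> normal M"
  "normal (Named a M) \<longleftrightarrow> normal M"
  using redex_App by (fastforce simp: normal_def)+

lemma normal_App:
  "normal (App M (Arg N)) \<longleftrightarrow> \<not> redex (App M (Arg N)) \<and> normal M \<and> normal N"
  "normal (App M Proj1) \<longleftrightarrow> \<not> redex (App M Proj1) \<and> normal M"
  "normal (App M Proj2) \<longleftrightarrow> \<not> redex (App M Proj2) \<and> normal M"
  "normal (App M (Case N1 N2)) \<longleftrightarrow> \<not> redex (App M (Case N1 N2)) \<and> normal M \<and> normal N1 \<and> normal N2"
  by (auto simp: normal_def)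

lemma redex_neutral: "neutral M \<Longrightarrow> \<not> redex (App M E)"
  using redex_App by blast

definition fair_case :: "trm \<Rightarrow> bool" where
  "fair_case t \<longleftrightarrow> (\<forall>M N1 N2 x. t = App M (Case N1 N2) \<longrightarrow> head_var M = Some x \<longrightarrow>
     \<not> occurs (Suc x) N1 \<and> \<not> occurs (Suc x) N2)"

lemma fair_cases_alt: "fair_cases t \<longleftrightarrow> (\<forall>s \<in> subterms t. fair_case s)"
  unfolding fair_cases_def fair_case_def by blast

lemma fair_case_simps [simp]:
  "fair_case (Var x)" "fair_case (Lam M)" "fair_case (MkPair M N)" "fair_case (Inj1 M)" "fair_case (Inj2 M)"
  "fair_case (Mu M)" "fair_case (Named a M)" "fair_case (App M (Arg N))"
  "fair_case (App M Proj1)" "fair_case (App M Proj2)"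
  "fair_case (App M (Case N1 N2)) \<longleftrightarrow>
    (\<forall>x. head_var M = Some x \<longrightarrow> \<not> occurs (Suc x) N1 \<and> \<not> occurs (Suc x) N2)"
  by (simp_all add: fair_case_def)

lemma fair_cases_simps [simp]:
  "fair_cases (Var x)"
  "fair_cases (Lam M) \<longleftrightarrow> fair_cases M"
  "fair_cases (MkPair M N) \<longleftrightarrow> fair_cases M \<and> fair_cases N"
  "fair_cases (Inj1 M) \<longleftrightarrow> fair_cases M"
  "fair_cases (Inj2 M) \<longleftrightarrow> fair_cases M"
  "fair_cases (Mu M) \<longleftrightarrow> fair_cases M"
  "fair_cases (Named a M) \<longleftrightarrow> fair_cases M"
  "fair_cases (App M (Arg N)) \<longleftrightarrow> fair_cases M \<and> fair_cases N"
  "fair_cases (App M Proj1) \<longleftrightarrow> fair_cases M"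
  "fair_cases (App M Proj2) \<longleftrightarrow> fair_cases M"
  "fair_cases (App M (Case N1 N2)) \<longleftrightarrow> fair_cases M \<and> fair_cases N1 \<and> fair_cases N2 \<and>
    (\<forall>x. head_var M = Some x \<longrightarrow> \<not> occurs (Suc x) N1 \<and> \<not> occurs (Suc x) N2)"
  by (auto simp: fair_cases_alt)

section \<open>Condition (a) expressed by deletion of hypotheses\<close>

definition matches :: "'a fm option list \<Rightarrow> 'a fm list \<Rightarrow> bool" where
  "matches \<Gamma> \<Gamma>' \<longleftrightarrow> list_all2 (\<lambda>o' S. o' = None \<or> o' = Some S) \<Gamma> \<Gamma>'"

definition avoids :: "'a fm option list \<Rightarrow> trm \<Rightarrow> bool" where
  "avoids \<Gamma> t \<longleftrightarrow> (\<forall>i < length \<Gamma>. \<Gamma> ! i = None \<longrightarrow> \<not> occurs i t)"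

lemma matches_Cons [simp]: "matches (Some A # \<Gamma>) (A # \<Gamma>') \<longleftrightarrow> matches \<Gamma> \<Gamma>'"
  by (simp add: matches_def)

lemma matches_delete: "matches \<Gamma> \<Gamma>' \<Longrightarrow> matches (\<Gamma>[x := None]) \<Gamma>'"
  unfolding matches_def list_all2_conv_all_nth
  by (metis length_list_update nth_list_update_eq nth_list_update_neq)

lemma matches_nth: "matches \<Gamma> \<Gamma>' \<Longrightarrow> x < length \<Gamma> \<Longrightarrow> \<Gamma> ! x = Some S \<Longrightarrow> x < length \<Gamma>' \<and> \<Gamma>' ! x = S"
  by (auto simp: matches_def list_all2_conv_all_nth)

lemma avoids_simps [simp]:
  "avoids \<Gamma> (Var x) \<longleftrightarrow> (x < length \<Gamma> \<longrightarrow> \<Gamma> ! x \<noteq> None)"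
  "avoids \<Gamma> (MkPair M N) \<longleftrightarrow> avoids \<Gamma> M \<and> avoids \<Gamma> N"
  "avoids \<Gamma> (Inj1 M) \<longleftrightarrow> avoids \<Gamma> M"
  "avoids \<Gamma> (Inj2 M) \<longleftrightarrow> avoids \<Gamma> M"
  "avoids \<Gamma> (Mu M) \<longleftrightarrow> avoids \<Gamma> M"
  "avoids \<Gamma> (Named a M) \<longleftrightarrow> avoids \<Gamma> M"
  "avoids \<Gamma> (App M (Arg N)) \<longleftrightarrow> avoids \<Gamma> M \<and> avoids \<Gamma> N"
  "avoids \<Gamma> (App M Proj1) \<longleftrightarrow> avoids \<Gamma> M"
  "avoids \<Gamma> (App M Proj2) \<longleftrightarrow> avoids \<Gamma> M"
  by (auto simp: avoids_def nth_Cons split: nat.splits)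

lemma avoids_Lam: "avoids \<Gamma> (Lam M) \<longleftrightarrow> avoids (Some A # \<Gamma>) M"
  by (auto simp: avoids_def nth_Cons split: nat.splits)

lemma avoids_Case:
  "avoids \<Gamma> (App M (Case N1 N2)) \<longleftrightarrow>
    avoids \<Gamma> M \<and> avoids (Some A # \<Gamma>) N1 \<and> avoids (Some B # \<Gamma>) N2"
  by (auto simp: avoids_def nth_Cons split: nat.splits)

text \<open>This turns condition (a) for one case distinction into the deletion of its head variable
  from the contexts of the branches; \<open>Suc x\<close> accounts for the binder of a
  branch.\<close>

lemma avoids_delete:
  "x < length \<Gamma> \<Longrightarrow> avoids (Some A # \<Gamma>[x := None]) N \<longleftrightarrow> avoids (Some A # \<Gamma>) N \<and> \<not> occurs (Suc x) N"
  by (auto simp: avoids_def nth_Cons nth_list_update split: nat.splits)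

definition correct :: "'a fm option list \<Rightarrow> 'a fm list \<Rightarrow> 'a fm list \<Rightarrow> trm \<Rightarrow> 'a fm \<Rightarrow> bool" where
  "correct \<Gamma> \<Gamma>' \<Delta> t A \<longleftrightarrow>
    derivable fair_contradiction \<Gamma>' \<Delta> t A \<and> normal t \<and> fair_cases t \<and> avoids \<Gamma> t"

text \<open>For a spine, \<open>M\<close> is the part of the application built so far. Its
  neutrality ensures that the next elimination creates no redex, and its head variable is the one
  that a final \<open>Case\<close> deletes.\<close>

lemma nf_spine_correct:
  "nf h \<Gamma> \<Delta> t A \<Longrightarrow> matches \<Gamma> \<Gamma>' \<Longrightarrow> correct \<Gamma> \<Gamma>' \<Delta> t A"
  "spine h \<Gamma> \<Delta> x S es A \<Longrightarrow> matches \<Gamma> \<Gamma>' \<Longrightarrow> x < length \<Gamma> \<Longrightarrow> correct \<Gamma> \<Gamma>' \<Delta> M S \<Longrightarrow> neutral M \<Longrightarrow>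
    head_var M = Some x \<Longrightarrow> correct \<Gamma> \<Gamma>' \<Delta> (foldl App M es) A"
proof (induction arbitrary: \<Gamma>' and \<Gamma>' M rule: nf_spine.inducts)
  case (nf_Lam h A \<Gamma> \<Delta> M B)
  then have "correct (Some A # \<Gamma>) (A # \<Gamma>') \<Delta> M B" by simp
  then show ?case by (auto simp: correct_def avoids_Lam[of _ _ A] intro: derivable.intros)
next
  case (nf_Var x \<Gamma> S h \<Delta> es A)
  have "correct \<Gamma> \<Gamma>' \<Delta> (Var x) S"
    using nf_Var matches_nth by (fastforce simp: correct_def intro: derivable.ax)
  then show ?case using nf_Var by simp
next
  case (spine_Arg h \<Gamma> \<Delta> N B x C es A)
  have "correct \<Gamma> \<Gamma>' \<Delta> (App M (Arg N)) C"
    using spine_Arg.IH(1)[OF spine_Arg.prems(1)] spine_Arg.prems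
    by (auto simp: correct_def normal_App redex_neutral intro: derivable.intros)
  then show ?case using spine_Arg by simp
next
  case (spine_Proj1 h \<Gamma> \<Delta> x B es A C)
  have "correct \<Gamma> \<Gamma>' \<Delta> (App M Proj1) B"
    using spine_Proj1.prems by (auto simp: correct_def normal_App redex_neutral intro: derivable.intros)
  then show ?case using spine_Proj1 by simp
next
  case (spine_Proj2 h \<Gamma> \<Delta> x C es A B)
  have "correct \<Gamma> \<Gamma>' \<Delta> (App M Proj2) C"
    using spine_Proj2.prems by (auto simp: correct_def normal_App redex_neutral intro: derivable.intros)
  then show ?case using spine_Proj2 by simp
next
  case (spine_Case h B \<Gamma> x \<Delta> N1 A C N2)
  have "correct (Some B # \<Gamma>[x := None]) (B # \<Gamma>') \<Delta> N1 A"
    "correct (Some C # \<Gamma>[x := None]) (C # \<Gamma>') \<Delta> N2 A"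
    using spine_Case.IH spine_Case.prems(1) by (simp_all add: matches_delete)
  then show ?case using spine_Case.prems
    by (auto simp: correct_def normal_App redex_neutral avoids_delete avoids_Case[of \<Gamma> M N1 N2 B C]
        intro: derivable.intros)
qed (auto simp: correct_def intro: derivable.intros)

text \<open>The purpose is to see that in a normal term only neutral terms are eliminated: a case
  distinction would commute with the elimination, a \<mu>-abstraction would absorb it, and an
  introduction would contract. Listing introductions by type excludes those of another
  connective.\<close>

lemma derivable_shape:
  "derivable R \<Gamma> \<Delta> t A \<Longrightarrow> normal t \<Longrightarrow>
    neutral t \<or> (\<exists>M N1 N2. t = App M (Case N1 N2) \<and> neutral M) \<or>
    (\<exists>M. t = Mu M) \<or> (case A of Imp B C \<Rightarrow> \<exists>M. t = Lam M | And B C \<Rightarrow> \<exists>M N. t = MkPair M N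
      | Or B C \<Rightarrow> \<exists>M. t = Inj1 M \<or> t = Inj2 M | Bot \<Rightarrow> \<exists>a M. t = Named a M | Atom a \<Rightarrow> False)"
proof (induction rule: derivable.induct)
  case (impE \<Gamma> \<Delta> M A B N)
  then show ?case by (auto simp: normal_App redex_def intro: contracts.intros)
next
  case (andE1 \<Gamma> \<Delta> M A1 A2)
  then show ?case by (auto simp: normal_App redex_def intro: contracts.intros)
next
  case (andE2 \<Gamma> \<Delta> M A1 A2)
  then show ?case by (auto simp: normal_App redex_def intro: contracts.intros)
next
  case (orE \<Gamma> \<Delta> M A1 A2 N1 C N2)
  then show ?case by (auto simp: normal_App redex_def intro: contracts.intros)
qed auto

text \<open>Typing derivations add eliminations at the outer end of an application, whereas
  \<open>spine\<close> reads them from the head. So the way from the head to \<open>B\<close> is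
  described by how it extends spines starting at \<open>B\<close>, and only from some level on,
  because the arguments already present have levels of their own.\<close>

definition spinal :: "'a fm option list \<Rightarrow> 'a fm list \<Rightarrow> trm \<Rightarrow> 'a fm \<Rightarrow> bool" where
  "spinal \<Gamma> \<Delta> t B \<longleftrightarrow> (\<exists>x S es h. x < length \<Gamma> \<and> \<Gamma> ! x = Some S \<and> head_var t = Some x \<and> t = foldl App (Var x) es \<and>
    (\<forall>k \<ge> h. \<forall>es' A. spine k \<Gamma> \<Delta> x B es' A \<longrightarrow> spine k \<Gamma> \<Delta> x S (es @ es') A))"

lemma spinal_nf: "spinal \<Gamma> \<Delta> t A \<Longrightarrow> \<exists>h. nf h \<Gamma> \<Delta> t A"
  unfolding spinal_def using spine_Nil nf_Var by (metis append_Nil2 order_refl)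

lemma spinal_App:
  assumes "spinal \<Gamma> \<Delta> M B"
    and "\<And>k x es' A. k \<ge> h \<Longrightarrow> spine k \<Gamma> \<Delta> x C es' A \<Longrightarrow> spine k \<Gamma> \<Delta> x B (E # es') A"
  shows "spinal \<Gamma> \<Delta> (App M E) C"
proof -
  obtain x S es h' where *: "x < length \<Gamma>" "\<Gamma> ! x = Some S" "head_var M = Some x" "M = foldl App (Var x) es"
    "\<And>k es' A. k \<ge> h' \<Longrightarrow> spine k \<Gamma> \<Delta> x B es' A \<Longrightarrow> spine k \<Gamma> \<Delta> x S (es @ es') A"
    using assms(1) unfolding spinal_def by blast
  have "spine k \<Gamma> \<Delta> x S ((es @ [E]) @ es') A" if "k \<ge> max h h'" "spine k \<Gamma> \<Delta> x C es' A" for k es' A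
    using *(5)[of k "E # es'"] assms(2) that by simp
  then show ?thesis unfolding spinal_def using *
    by (intro exI[of _ x] exI[of _ S] exI[of _ "es @ [E]"] exI[of _ "max h h'"]) auto
qed

text \<open>A neutral term may receive further eliminations, and having some level says nothing
  about how its spine continues; hence the second conjunct, which makes the induction go
  through.\<close>

lemma derivable_nf:
  "derivable fair_contradiction \<Gamma>' \<Delta> t A \<Longrightarrow> matches \<Gamma> \<Gamma>' \<Longrightarrow> normal t \<Longrightarrow> fair_cases t \<Longrightarrow> avoids \<Gamma> t \<Longrightarrow>
    (\<exists>h. nf h \<Gamma> \<Delta> t A) \<and> (neutral t \<longrightarrow> spinal \<Gamma> \<Delta> t A)"
proof (induction arbitrary: \<Gamma> rule: derivable.induct)
  case (ax x \<Gamma>' \<Delta>)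
  then have "x < length \<Gamma>" "\<Gamma> ! x = Some (\<Gamma>' ! x)" 
    by (auto simp: matches_def list_all2_conv_all_nth)
  then have "spinal \<Gamma> \<Delta> (Var x) (\<Gamma>' ! x)"
    unfolding spinal_def by (intro exI[of _ x] exI[of _ "\<Gamma>' ! x"] exI[of _ "[]"]) auto
  then show ?case using spinal_nf by blast
next
  case (impI A \<Gamma>' \<Delta> M B)
  then have "\<exists>h. nf h (Some A # \<Gamma>) \<Delta> M B" by (simp add: avoids_Lam[of _ _ A])
  then show ?case by (auto dest: nf_Lam)
next
  case (impE \<Gamma>' \<Delta> M A B N)
  have M: "neutral M" using derivable_shape[OF impE.hyps(1)] impE.prems
    by (auto simp: normal_App redex_def intro: contracts.intros)
  then have sM: "spinal \<Gamma> \<Delta> M (Imp A B)" and "\<exists>h. nf h \<Gamma> \<Delta> N A"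
    using impE by (simp_all add: normal_App)
  then obtain h where h: "nf h \<Gamma> \<Delta> N A" by blast
  have "spinal \<Gamma> \<Delta> (App M (Arg N)) B"
    by (rule spinal_App[OF sM, of h]) (use h in \<open>auto intro: spine_Arg nf_mono\<close>)
  then show ?case using spinal_nf by blast
next
  case (botI a \<Delta> \<Gamma>' M)
  then obtain h where "nf h \<Gamma> \<Delta> M (\<Delta> ! a)" by auto
  from nf_Named[OF botI.hyps(1) this] show ?case by auto
next
  case (botE \<Gamma>' A \<Delta> M)
  then obtain h where "nf h \<Gamma> (A # \<Delta>) M Bot" by auto
  from nf_Mu[OF this botE.hyps(2)] show ?case by auto
next
  case (andI \<Gamma>' \<Delta> M A1 N A2)
  then have "\<exists>h. nf h \<Gamma> \<Delta> M A1" "\<exists>h. nf h \<Gamma> \<Delta> N A2" by simp_all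
  then obtain h k where "nf h \<Gamma> \<Delta> M A1" "nf k \<Gamma> \<Delta> N A2" by blast
  then have "nf (max h k) \<Gamma> \<Delta> M A1" "nf (max h k) \<Gamma> \<Delta> N A2" by (auto intro: nf_mono)
  from nf_MkPair[OF this] show ?case by auto
next
  case (andE1 \<Gamma>' \<Delta> M A1 A2)
  have M: "neutral M" using derivable_shape[OF andE1.hyps(1)] andE1.prems
    by (auto simp: normal_App redex_def intro: contracts.intros)
  then have sM: "spinal \<Gamma> \<Delta> M (And A1 A2)"
    using andE1 by (simp_all add: normal_App)
  have "spinal \<Gamma> \<Delta> (App M Proj1) A1"
    by (rule spinal_App[OF sM]) (auto intro: spine_Proj1)
  then show ?case using spinal_nf by blast
next
  case (andE2 \<Gamma>' \<Delta> M A1 A2)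
  have M: "neutral M" using derivable_shape[OF andE2.hyps(1)] andE2.prems
    by (auto simp: normal_App redex_def intro: contracts.intros)
  then have sM: "spinal \<Gamma> \<Delta> M (And A1 A2)"
    using andE2 by (simp_all add: normal_App)
  have "spinal \<Gamma> \<Delta> (App M Proj2) A2"
    by (rule spinal_App[OF sM]) (auto intro: spine_Proj2)
  then show ?case using spinal_nf by blast
next
  case (orI1 \<Gamma>' \<Delta> M A1 A2)
  then obtain h where "nf h \<Gamma> \<Delta> M A1" by auto
  from nf_Inj1[OF this] show ?case by auto
next
  case (orI2 \<Gamma>' \<Delta> M A2 A1)
  then obtain h where "nf h \<Gamma> \<Delta> M A2" by auto
  from nf_Inj2[OF this] show ?case by auto
next
  case (orE \<Gamma>' \<Delta> M A1 A2 N1 C N2)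
  have M: "neutral M" using derivable_shape[OF orE.hyps(1)] orE.prems
    by (auto simp: normal_App redex_def intro: contracts.intros)
  have av: "avoids \<Gamma> M" "avoids (Some A1 # \<Gamma>) N1" "avoids (Some A2 # \<Gamma>) N2"
    using orE.prems(4) by (simp_all add: avoids_Case[of \<Gamma> M N1 N2 A1 A2])
  then have "spinal \<Gamma> \<Delta> M (Or A1 A2)"
    using orE M by (simp add: normal_App)
  then obtain x S es h' where *: "x < length \<Gamma>" "\<Gamma> ! x = Some S" "head_var M = Some x" "M = foldl App (Var x) es"
    "\<And>k es' A. k \<ge> h' \<Longrightarrow> spine k \<Gamma> \<Delta> x (Or A1 A2) es' A \<Longrightarrow> spine k \<Gamma> \<Delta> x S (es @ es') A"
    unfolding spinal_def by blast
  have "\<exists>h. nf h (Some A1 # \<Gamma>[x := None]) \<Delta> N1 C" "\<exists>h. nf h (Some A2 # \<Gamma>[x := None]) \<Delta> N2 C"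
    using orE av * by (simp_all add: normal_App matches_delete avoids_delete)
  then obtain h1 h2 where "nf h1 (Some A1 # \<Gamma>[x := None]) \<Delta> N1 C" "nf h2 (Some A2 # \<Gamma>[x := None]) \<Delta> N2 C"
    by blast
  then have "spine (max h' (max h1 h2)) \<Gamma> \<Delta> x (Or A1 A2) [Case N1 N2] C"
    by (auto intro!: spine_Case elim!: nf_mono)
  from nf_Var[OF *(1,2) *(5)[OF _ this]]
  have "nf (Suc (max h' (max h1 h2))) \<Gamma> \<Delta> (foldl App (Var x) (es @ [Case N1 N2])) C"
    by simp
  then show ?case using *(4) by auto
qed

lemma derivable_weaken_rule:
  "derivable R \<Gamma> \<Delta> t A \<Longrightarrow> derivable (\<lambda>_ _. True) \<Gamma> \<Delta> t A"
  by (induction rule: derivable.induct) (auto intro: derivable.intros)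

theorem fair_proofs_nf: "fair_proofs F = {t. \<exists>h. nf h [] [] t F}"
proof -
  have "matches [] []" by (simp add: matches_def)
  moreover have "avoids [] t" for t by (simp add: avoids_def)
  ultimately show ?thesis
    unfolding fair_proofs_def fair_def proof_of_def
    using derivable_nf[of "[]" "[]" _ F "[]"] nf_spine_correct(1)[of _ "[]" "[]" _ F "[]"] derivable_weaken_rule
    unfolding correct_def by blast
qed

section \<open>Provability from multiplicities of hypotheses\<close>

text \<open>
  \<open>budget \<Gamma> S\<close> bounds how many copies of \<open>S\<close> can still be consumed along a branch by case distinctions
  that cannot be skipped, when a residue \<open>A\<close> counts as plentiful from \<open>2 * capacity A\<close> copies on.
\<close>

primrec capacity :: "'a fm \<Rightarrow> nat" where
  "capacity (Atom a) = 1"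
| "capacity Bot = 1"
| "capacity (Imp A B) = capacity B"
| "capacity (And A B) = capacity A + capacity B"
| "capacity (Or A B) = 3 * (capacity A + capacity B)"

primrec budget :: "('a fm \<Rightarrow> nat) \<Rightarrow> 'a fm \<Rightarrow> nat" where
  "budget \<Gamma> (Atom a) = 0"
| "budget \<Gamma> Bot = 0"
| "budget \<Gamma> (Imp A B) = budget \<Gamma> B"
| "budget \<Gamma> (And A B) = budget \<Gamma> A + budget \<Gamma> B"
| "budget \<Gamma> (Or A B) = (2 * capacity A - \<Gamma> A) + budget \<Gamma> A + (2 * capacity B - \<Gamma> B) + budget \<Gamma> B"

text \<open>The factor 3 in \<open>capacity\<close> of a disjunction is made for this: each side
  contributes to \<open>budget\<close> at most \<open>2 * capacity\<close> missing copies plus its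
  own budget, which stays below one more \<open>capacity\<close>.\<close>

lemma budget_less_capacity: "budget \<Gamma> A < capacity A"
  by (induction A) auto

text \<open>The type-level content of a neutral spine: \<open>R\<close> is reached from the
  hypothesis \<open>S\<close> by arguments and projections, and \<open>as\<close> lists the
  arguments that have to be proved.\<close>

inductive target :: "'a fm \<Rightarrow> 'a fm list \<Rightarrow> 'a fm \<Rightarrow> bool" where
  target_refl: "target S [] S"
| target_Imp: "target B as R \<Longrightarrow> target (Imp A B) (A # as) R"
| target_And1: "target A as R \<Longrightarrow> target (And A B) as R"
| target_And2: "target B as R \<Longrightarrow> target (And A B) as R"

definition add_hyp :: "'a fm \<Rightarrow> ('a fm \<Rightarrow> nat) \<Rightarrow> ('a fm \<Rightarrow> nat)" where
  "add_hyp A \<Gamma> = \<Gamma>(A := Suc (\<Gamma> A))"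

definition consume :: "'a fm \<Rightarrow> 'a fm \<Rightarrow> ('a fm \<Rightarrow> nat) \<Rightarrow> ('a fm \<Rightarrow> nat)" where
  "consume S A \<Gamma> = add_hyp A (\<Gamma>(S := \<Gamma> S - 1))"

lemma target_size: "target S as R \<Longrightarrow> size R \<le> size S"
  by (induction rule: target.induct) auto

text \<open>\<open>budget\<close> consults the multiplicities of proper subformulae only, in
  truncated differences that shrink as hypotheses are added. In particular the copies of
  \<open>A\<close> itself do not enter its own budget.\<close>

lemma budget_antimono:
  "(\<And>B. size B < size A \<Longrightarrow> \<Gamma> B \<le> \<Gamma>' B) \<Longrightarrow> budget \<Gamma>' A \<le> budget \<Gamma> A"
proof (induction A)
  case (Imp A B)
  then show ?case by simp
next
  case (And A B)
  have "budget \<Gamma>' A \<le> budget \<Gamma> A" "budget \<Gamma>' B \<le> budget \<Gamma> B"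
    by (intro And.IH And.prems; simp)+
  then show ?case by simp
next
  case (Or A B)
  have "budget \<Gamma>' A \<le> budget \<Gamma> A" "budget \<Gamma>' B \<le> budget \<Gamma> B"
    by (intro Or.IH Or.prems; simp)+
  moreover have "2 * capacity A - \<Gamma>' A \<le> 2 * capacity A - \<Gamma> A" "2 * capacity B - \<Gamma>' B \<le> 2 * capacity B - \<Gamma> B"
    by (intro diff_le_mono2 Or.prems; simp)+
  ultimately show ?case by simp
qed simp_all

lemma budget_add_hyp: "budget (add_hyp A \<Gamma>) B \<le> budget \<Gamma> B"
  by (rule budget_antimono) (simp add: add_hyp_def)

text \<open>The disjunction is a part of \<open>S\<close>, so the budget of \<open>S\<close> counts
  the missing copies of the residue, and below the threshold a further copy lowers this number
  strictly. A general \<Gamma>' is used because the induction descends into \<open>S\<close>, while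
  the formula consumed is the whole of the original \<open>S\<close>.\<close>

lemma budget_consume_target:
  assumes "target S as (Or B C)" and "A = B \<or> A = C" and "\<Gamma> A < 2 * capacity A"
    and "\<And>D. size D < size S \<Longrightarrow> \<Gamma> D \<le> \<Gamma>' D" and "\<Gamma> A < \<Gamma>' A"
  shows "budget \<Gamma>' S < budget \<Gamma> S"
  using assms
proof (induction S as "Or B C" rule: target.induct)
  case target_refl
  have "budget \<Gamma>' B \<le> budget \<Gamma> B" "budget \<Gamma>' C \<le> budget \<Gamma> C"
    by (intro budget_antimono target_refl; simp)+
  moreover have "2 * capacity B - \<Gamma>' B \<le> 2 * capacity B - \<Gamma> B" "2 * capacity C - \<Gamma>' C \<le> 2 * capacity C - \<Gamma> C"
    by (intro diff_le_mono2 target_refl; simp)+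
  moreover have "2 * capacity A - \<Gamma>' A < 2 * capacity A - \<Gamma> A" using target_refl by linarith
  ultimately show ?case using target_refl(1) by auto
next
  case (target_Imp S as A')
  then show ?case by simp
next
  case (target_And1 S as T)
  have "budget \<Gamma>' S < budget \<Gamma> S" by (rule target_And1.hyps) (use target_And1.prems in auto)
  moreover have "budget \<Gamma>' T \<le> budget \<Gamma> T" by (intro budget_antimono target_And1.prems; simp)
  ultimately show ?case by simp
next
  case (target_And2 S as T)
  have "budget \<Gamma>' S < budget \<Gamma> S" by (rule target_And2.hyps) (use target_And2.prems in auto)
  moreover have "budget \<Gamma>' T \<le> budget \<Gamma> T" by (intro budget_antimono target_And2.prems; simp)
  ultimately show ?case by simp
qed

lemma budget_consume_self:
  assumes "target S as (Or B C)" and "A = B \<or> A = C" and "\<Gamma> A < 2 * capacity A"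
  shows "budget (consume S A \<Gamma>) S < budget \<Gamma> S"
proof (rule budget_consume_target[where \<Gamma> = \<Gamma> and A = A, OF assms])
  have "size A < size S" using target_size[OF assms(1)] assms(2) by auto
  then have "A \<noteq> S" by auto
  then show "\<Gamma> A < consume S A \<Gamma> A" by (simp add: consume_def add_hyp_def)
  show "\<Gamma> D \<le> consume S A \<Gamma> D" if "size D < size S" for D
    using that by (auto simp: consume_def add_hyp_def)
qed

text \<open>The lost copy of \<open>S\<close> may raise by one the number of missing copies of
  \<open>S\<close> counted in \<open>T\<close>. But wherever \<open>T\<close> counts copies of
  \<open>S\<close> it also adds the budget of \<open>S\<close>, which drops strictly. All other
  multiplicities are at least what they were.\<close>

lemma budget_consume:
  assumes "target S as (Or B C)" and "A = B \<or> A = C" and "\<Gamma> A < 2 * capacity A"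
  shows "budget (consume S A \<Gamma>) T \<le> budget \<Gamma> T"
proof (induction T)
  case (Or D E)
  have *: "(2 * capacity D - consume S A \<Gamma> D) + budget (consume S A \<Gamma>) D \<le> (2 * capacity D - \<Gamma> D) + budget \<Gamma> D"
    if "budget (consume S A \<Gamma>) D \<le> budget \<Gamma> D" for D
  proof (cases "D = S")
    case True
    have "consume S A \<Gamma> S \<ge> \<Gamma> S - 1" by (simp add: consume_def add_hyp_def)
    then show ?thesis using budget_consume_self[where \<Gamma> = \<Gamma> and A = A, OF assms] True by simp
  next
    case False
    then have "consume S A \<Gamma> D \<ge> \<Gamma> D" by (simp add: consume_def add_hyp_def)
    then show ?thesis using that by simp
  qed
  show ?case using *[OF Or.IH(1)] *[OF Or.IH(2)] by simp
qed simp_all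

text \<open>A multiplicity may be smaller in \<Gamma>' as long as it exceeds what can still be
  consumed, so that it never runs out along a branch. The parameter \<open>j\<close> is 0 for
  transferring \<open>proves\<close> and 1 for transferring \<open>tall\<close>.\<close>

definition le_upto :: "nat \<Rightarrow> ('a fm \<Rightarrow> nat) \<Rightarrow> ('a fm \<Rightarrow> nat) \<Rightarrow> bool" where
  "le_upto j \<Gamma> \<Gamma>' \<longleftrightarrow> (\<forall>A. \<Gamma> A \<le> \<Gamma>' A \<or> budget \<Gamma>' A + j * capacity A < \<Gamma>' A)"

lemma le_upto_pos: "le_upto j \<Gamma> \<Gamma>' \<Longrightarrow> 0 < \<Gamma> A \<Longrightarrow> 0 < \<Gamma>' A"
  unfolding le_upto_def by (metis gr_zeroI leD less_zeroE)

lemma le_upto_add_hyp: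
  assumes "le_upto j \<Gamma> \<Gamma>'"
  shows "le_upto j (add_hyp A \<Gamma>) (add_hyp A \<Gamma>')"
  unfolding le_upto_def
proof
  fix B
  have "\<Gamma> B \<le> \<Gamma>' B \<or> budget \<Gamma>' B + j * capacity B < \<Gamma>' B" using assms by (simp add: le_upto_def)
  moreover have "budget (add_hyp A \<Gamma>') B \<le> budget \<Gamma>' B" by (rule budget_add_hyp)
  ultimately show "add_hyp A \<Gamma> B \<le> add_hyp A \<Gamma>' B \<or> budget (add_hyp A \<Gamma>') B + j * capacity B < add_hyp A \<Gamma>' B"
    by (auto simp: add_hyp_def)
qed

lemma le_upto_0: "le_upto j \<Gamma> \<Gamma>' \<Longrightarrow> le_upto 0 \<Gamma> \<Gamma>'"
  unfolding le_upto_def by (metis add_lessD1 mult_0 add_0_right)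

text \<open>
  If the case distinction on \<open>S\<close> with residue \<open>A\<close> cannot be skipped (last assumption), the budget of
  \<open>S\<close> drops together with its multiplicity.
\<close>

lemma le_upto_consume:
  assumes "le_upto j \<Gamma> \<Gamma>'" and "j \<le> 1" and "target S as (Or B C)" and "A = B \<or> A = C"
    and "\<not> le_upto j (consume S A \<Gamma>) \<Gamma>'"
  shows "\<Gamma>' A < 2 * capacity A" and "le_upto j (consume S A \<Gamma>) (consume S A \<Gamma>')"
proof -
  have AS: "A \<noteq> S" using target_size[OF assms(3)] assms(4) by auto
  obtain T where T: "\<Gamma>' T < consume S A \<Gamma> T" "\<Gamma>' T \<le> budget \<Gamma>' T + j * capacity T"
    using assms(5) by (auto simp: le_upto_def not_le not_less)
  \<comment> \<open>Only the residue has gained a copy, so a violation at any other formula would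
    already be one before the consumption.\<close>
  have TA: "T = A"
  proof (rule ccontr)
    assume "T \<noteq> A"
    then have "consume S A \<Gamma> T \<le> \<Gamma> T" by (simp add: consume_def add_hyp_def)
    then show False using assms(1) T unfolding le_upto_def by (meson leD le_trans)
  qed
  \<comment> \<open>This is where the threshold \<open>2 * capacity\<close> comes from: one
    \<open>capacity\<close> bounds the budget, the other one the slack given by
    \<open>j\<close>.\<close>
  have "j * capacity A \<le> capacity A" using assms(2) by (cases j) auto
  then show *: "\<Gamma>' A < 2 * capacity A" using T(2) budget_less_capacity[of \<Gamma>' A] unfolding TA by linarith
  show "le_upto j (consume S A \<Gamma>) (consume S A \<Gamma>')"
    unfolding le_upto_def
  proof
    fix D
    consider "\<Gamma> D \<le> \<Gamma>' D" | "budget \<Gamma>' D + j * capacity D < \<Gamma>' D" using assms(1) by (auto simp: le_upto_def)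
    then show "consume S A \<Gamma> D \<le> consume S A \<Gamma>' D \<or>
        budget (consume S A \<Gamma>') D + j * capacity D < consume S A \<Gamma>' D"
    proof cases
      case 1
      then show ?thesis by (auto simp: consume_def add_hyp_def)
    next
      case 2
      have eq: "consume S A \<Gamma>' S = \<Gamma>' S - 1" using AS by (simp add: consume_def add_hyp_def)
      show ?thesis
      proof (cases "D = S")
        case True
        then show ?thesis using budget_consume_self[where \<Gamma> = \<Gamma>' and A = A, OF assms(3,4) *] 2 eq
          unfolding True by linarith
      next
        case False
        then show ?thesis using budget_consume[where \<Gamma> = \<Gamma>' and A = A and T = D, OF assms(3,4) *] 2
          by (auto simp: consume_def add_hyp_def)
      qed
    qed
  qed
qed

text \<open>
  In \<open>tall\<close> only one branch is followed, and its case distinctions are skipped without regard to the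
  residue in the other branch. The slack of one \<open>capacity\<close> in \<open>le_upto 1\<close> pays for leaving the
  followed branch.
\<close>

lemma le_upto_consume_side:
  assumes "le_upto 1 \<Gamma> \<Gamma>'"
  shows "le_upto 0 (consume S A \<Gamma>) (consume S A \<Gamma>')"
  unfolding le_upto_def
proof
  fix D
  consider "\<Gamma> D \<le> \<Gamma>' D" | "budget \<Gamma>' D + capacity D < \<Gamma>' D" using assms by (auto simp: le_upto_def)
  then show "consume S A \<Gamma> D \<le> consume S A \<Gamma>' D \<or> budget (consume S A \<Gamma>') D + 0 * capacity D < consume S A \<Gamma>' D"
  proof cases
    case 1
    then show ?thesis by (auto simp: consume_def add_hyp_def)
  next
    case 2
    moreover have "\<Gamma>' D - 1 \<le> consume S A \<Gamma>' D" by (auto simp: consume_def add_hyp_def)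
    ultimately show ?thesis using budget_less_capacity[of "consume S A \<Gamma>'" D] by linarith
  qed
qed

text \<open>A premise is given by the hypothesis that it adds, its \<open>\<mu>\<close>-context and its conclusion.\<close>

fun add_opt :: "'a fm option \<Rightarrow> ('a fm \<Rightarrow> nat) \<Rightarrow> ('a fm \<Rightarrow> nat)" where
  "add_opt None \<Gamma> = \<Gamma>"
| "add_opt (Some A) \<Gamma> = add_hyp A \<Gamma>"

inductive infers :: "'a fm set \<Rightarrow> 'a fm set \<Rightarrow> 'a fm \<Rightarrow> ('a fm option \<times> 'a fm set \<times> 'a fm) set \<Rightarrow> bool" where
  infers_Lam: "infers X \<Delta> (Imp A B) {(Some A, \<Delta>, B)}"
| infers_MkPair: "infers X \<Delta> (And A B) {(None, \<Delta>, A), (None, \<Delta>, B)}"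
| infers_Inj1: "infers X \<Delta> (Or A B) {(None, \<Delta>, A)}"
| infers_Inj2: "infers X \<Delta> (Or A B) {(None, \<Delta>, B)}"
| infers_Mu: "A \<noteq> Bot \<Longrightarrow> \<forall>C. A \<noteq> Neg C \<Longrightarrow> A \<notin> \<Delta> \<Longrightarrow> infers X \<Delta> A {(None, insert A \<Delta>, Bot)}"
| infers_Named: "A \<in> \<Delta> \<Longrightarrow> infers X \<Delta> Bot {(None, \<Delta>, A)}"
| infers_target: "S \<in> X \<Longrightarrow> target S as A \<Longrightarrow> infers X \<Delta> A ((\<lambda>B. (None, \<Delta>, B)) ` set as)"

definition supp :: "('a fm \<Rightarrow> nat) \<Rightarrow> 'a fm set" where "supp \<Gamma> = {A. 0 < \<Gamma> A}"

lemma infers_mono: "infers X \<Delta> A ps \<Longrightarrow> X \<subseteq> Y \<Longrightarrow> infers Y \<Delta> A ps"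
  by (induction rule: infers.induct) (auto intro: infers.intros)

text \<open>\<open>nf\<close> without terms, with hypotheses reduced to multiplicities and the
  \<mu>-context to a set. Case distinctions stand apart from \<open>infers\<close>: they alone
  remove a hypothesis, and their branches keep the level.\<close>

inductive proves :: "nat \<Rightarrow> ('a fm \<Rightarrow> nat) \<Rightarrow> 'a fm set \<Rightarrow> 'a fm \<Rightarrow> bool" where
  proves_rule: "infers (supp \<Gamma>) \<Delta> A ps \<Longrightarrow> (\<And>i \<Delta>' B. (i, \<Delta>', B) \<in> ps \<Longrightarrow> proves h (add_opt i \<Gamma>) \<Delta>' B) \<Longrightarrow>
    proves (Suc h) \<Gamma> \<Delta> A"
| proves_case: "S \<in> supp \<Gamma> \<Longrightarrow> target S as (Or B C) \<Longrightarrow> (\<And>P. P \<in> set as \<Longrightarrow> proves h \<Gamma> \<Delta> P) \<Longrightarrow>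
    proves (Suc h) (consume S B \<Gamma>) \<Delta> A \<Longrightarrow> proves (Suc h) (consume S C \<Gamma>) \<Delta> A \<Longrightarrow> proves (Suc h) \<Gamma> \<Delta> A"

abbreviation provable :: "('a fm \<Rightarrow> nat) \<Rightarrow> 'a fm set \<Rightarrow> 'a fm \<Rightarrow> bool" where
  "provable \<Gamma> \<Delta> A \<equiv> \<exists>h. proves h \<Gamma> \<Delta> A"

text \<open>\<open>tall n\<close>: there is a proof that does not have level \<open>n\<close>.\<close>

inductive tall :: "nat \<Rightarrow> ('a fm \<Rightarrow> nat) \<Rightarrow> 'a fm set \<Rightarrow> 'a fm \<Rightarrow> bool" where
  tall_0: "provable \<Gamma> \<Delta> A \<Longrightarrow> tall 0 \<Gamma> \<Delta> A"
| tall_rule: "infers (supp \<Gamma>) \<Delta> A ps \<Longrightarrow> \<forall>(i, \<Delta>', B) \<in> ps. provable (add_opt i \<Gamma>) \<Delta>' B \<Longrightarrow>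
    (i, \<Delta>', B) \<in> ps \<Longrightarrow> tall n (add_opt i \<Gamma>) \<Delta>' B \<Longrightarrow> tall (Suc n) \<Gamma> \<Delta> A"
| tall_arg: "S \<in> supp \<Gamma> \<Longrightarrow> target S as (Or B C) \<Longrightarrow> \<forall>P \<in> set as. provable \<Gamma> \<Delta> P \<Longrightarrow>
    provable (consume S B \<Gamma>) \<Delta> A \<Longrightarrow> provable (consume S C \<Gamma>) \<Delta> A \<Longrightarrow> P \<in> set as \<Longrightarrow> tall n \<Gamma> \<Delta> P \<Longrightarrow> tall (Suc n) \<Gamma> \<Delta> A"
| tall_case: "S \<in> supp \<Gamma> \<Longrightarrow> target S as (Or B C) \<Longrightarrow> \<forall>P \<in> set as. provable \<Gamma> \<Delta> P \<Longrightarrow>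
    provable (consume S B \<Gamma>) \<Delta> A \<Longrightarrow> provable (consume S C \<Gamma>) \<Delta> A \<Longrightarrow> R = B \<or> R = C \<Longrightarrow>
    tall n (consume S R \<Gamma>) \<Delta> A \<Longrightarrow> tall n \<Gamma> \<Delta> A"

lemma supp_le_upto: "le_upto j \<Gamma> \<Gamma>' \<Longrightarrow> supp \<Gamma> \<subseteq> supp \<Gamma>'"
  using le_upto_pos by (auto simp: supp_def)

lemma le_upto_add_opt: "le_upto j \<Gamma> \<Gamma>' \<Longrightarrow> le_upto j (add_opt i \<Gamma>) (add_opt i \<Gamma>')"
  by (cases i) (auto intro: le_upto_add_hyp)

text \<open>If one residue is already plentiful in \<Gamma>', the corresponding branch alone proves
  the goal, at the same level. Otherwise the case distinction is repeated in \<Gamma>', where the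
  drop in budget pays for the consumed copy.\<close>

lemma proves_mono: "proves h \<Gamma> \<Delta> A \<Longrightarrow> le_upto 0 \<Gamma> \<Gamma>' \<Longrightarrow> proves h \<Gamma>' \<Delta> A"
proof (induction arbitrary: \<Gamma>' rule: proves.induct)
  case (proves_rule \<Gamma> \<Delta> A ps h)
  show ?case
    by (rule proves.proves_rule[OF infers_mono[OF proves_rule.hyps(1) supp_le_upto[OF proves_rule.prems]]])
       (erule proves_rule.IH, rule le_upto_add_opt[OF proves_rule.prems])
next
  case (proves_case S \<Gamma> as B C h \<Delta> A)
  show ?case
  proof (cases "le_upto 0 (consume S B \<Gamma>) \<Gamma>' \<or> le_upto 0 (consume S C \<Gamma>) \<Gamma>'")
    case True
    then show ?thesis using proves_case.IH by blast
  next
    case False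
    then have B: "le_upto 0 (consume S B \<Gamma>) (consume S B \<Gamma>')"
      and C: "le_upto 0 (consume S C \<Gamma>) (consume S C \<Gamma>')"
      using le_upto_consume(2)[OF proves_case.prems _ proves_case.hyps(2), of B]
        le_upto_consume(2)[OF proves_case.prems _ proves_case.hyps(2), of C] by simp_all
    have "S \<in> supp \<Gamma>'" using proves_case.hyps(1) supp_le_upto[OF proves_case.prems] by blast
    then show ?thesis
      by (rule proves.proves_case[OF _ proves_case.hyps(2) proves_case.IH(1)[OF _ proves_case.prems] proves_case.IH(2)[OF B] proves_case.IH(3)[OF C]])
  qed
qed

lemma provable_mono: "provable \<Gamma> \<Delta> A \<Longrightarrow> le_upto j \<Gamma> \<Gamma>' \<Longrightarrow> provable \<Gamma>' \<Delta> A"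
  using proves_mono le_upto_0 by blast

text \<open>Here a case distinction may be skipped only in favour of the branch that is followed,
  since the tallness lies there. If the tallness lies in an argument, the case distinction is kept,
  and its branches are transferred by provability alone.\<close>

lemma tall_mono: "tall n \<Gamma> \<Delta> A \<Longrightarrow> le_upto 1 \<Gamma> \<Gamma>' \<Longrightarrow> tall n \<Gamma>' \<Delta> A"
proof (induction arbitrary: \<Gamma>' rule: tall.induct)
  case (tall_0 \<Gamma> \<Delta> A)
  then show ?case using provable_mono tall.tall_0 by blast
next
  case (tall_rule \<Gamma> \<Delta> A ps i \<Delta>' B n)
  have "\<forall>(i, \<Delta>', B) \<in> ps. provable (add_opt i \<Gamma>') \<Delta>' B"
    using tall_rule.hyps(2) provable_mono le_upto_add_opt[OF tall_rule.prems] by fastforce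
  then show ?case
    by (rule tall.tall_rule[OF infers_mono[OF tall_rule.hyps(1) supp_le_upto[OF tall_rule.prems]] _ tall_rule.hyps(3)])
       (rule tall_rule.IH[OF le_upto_add_opt[OF tall_rule.prems]])
next
  case (tall_arg S \<Gamma> as B C \<Delta> A P n)
  show ?case
  proof (rule tall.tall_arg[OF _ tall_arg.hyps(2)])
    show "S \<in> supp \<Gamma>'" using tall_arg.hyps(1) supp_le_upto[OF tall_arg.prems] by blast
    show "\<forall>P \<in> set as. provable \<Gamma>' \<Delta> P" using tall_arg.hyps(3) provable_mono[OF _ tall_arg.prems] by blast
    show "provable (consume S B \<Gamma>') \<Delta> A" "provable (consume S C \<Gamma>') \<Delta> A"
      using tall_arg.hyps(4,5) provable_mono[OF _ le_upto_consume_side[OF tall_arg.prems]] by blast+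
    show "P \<in> set as" by (rule tall_arg.hyps)
    show "tall n \<Gamma>' \<Delta> P" using tall_arg.IH tall_arg.prems by blast
  qed
next
  case (tall_case S \<Gamma> as B C \<Delta> A R n)
  show ?case
  proof (cases "le_upto 1 (consume S R \<Gamma>) \<Gamma>'")
    case True
    then show ?thesis using tall_case.IH by blast
  next
    case False
    show ?thesis
    proof (rule tall.tall_case[OF _ tall_case.hyps(2)])
      show "S \<in> supp \<Gamma>'" using tall_case.hyps(1) supp_le_upto[OF tall_case.prems] by blast
      show "\<forall>P \<in> set as. provable \<Gamma>' \<Delta> P" using tall_case.hyps(3) provable_mono[OF _ tall_case.prems] by blast
      show "provable (consume S B \<Gamma>') \<Delta> A" "provable (consume S C \<Gamma>') \<Delta> A"
        using tall_case.hyps(4,5) provable_mono[OF _ le_upto_consume_side[OF tall_case.prems]] by blast+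
      show "R = B \<or> R = C" by (rule tall_case.hyps)
      show "tall n (consume S R \<Gamma>') \<Delta> A"
        by (rule tall_case.IH, rule le_upto_consume(2)[OF tall_case.prems _ tall_case.hyps(2,6) False]) simp
    qed
  qed
qed

lemma proves_Suc: "proves h \<Gamma> \<Delta> A \<Longrightarrow> proves (Suc h) \<Gamma> \<Delta> A"
proof (induction rule: proves.induct)
  case (proves_rule \<Gamma> \<Delta> A ps h)
  show ?case by (rule proves.proves_rule[OF proves_rule.hyps(1)]) (rule proves_rule.IH)
next
  case (proves_case S \<Gamma> as B C h \<Delta> A)
  show ?case by (rule proves.proves_case[OF proves_case.hyps(1,2) proves_case.IH])
qed

lemma proves_le: "proves h \<Gamma> \<Delta> A \<Longrightarrow> h \<le> k \<Longrightarrow> proves k \<Gamma> \<Delta> A"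
  by (rotate_tac, induction rule: dec_induct) (auto intro: proves_Suc)

lemma infers_finite: "infers X \<Delta> A ps \<Longrightarrow> finite ps"
  by (induction rule: infers.induct) auto

lemma proves_bound:
  assumes "finite P" and "\<forall>p \<in> P. \<exists>h. proves h (f p) (g p) (k p)"
  shows "\<exists>h. \<forall>p \<in> P. proves h (f p) (g p) (k p)"
  using assms
proof (induction P rule: finite_induct)
  case (insert p P)
  then obtain h h' where "\<forall>p \<in> P. proves h (f p) (g p) (k p)" "proves h' (f p) (g p) (k p)" by blast
  then have "\<forall>q \<in> insert p P. proves (max h h') (f q) (g q) (k q)"
    using proves_le[of h _ _ _ "max h h'"] proves_le[of h' _ _ _ "max h h'"] by auto
  then show ?case by blast
qed simp

lemma provable_rule:
  assumes "infers (supp \<Gamma>) \<Delta> A ps" and "\<forall>(i, \<Delta>', B) \<in> ps. provable (add_opt i \<Gamma>) \<Delta>' B"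
  shows "provable \<Gamma> \<Delta> A"
proof -
  have "\<exists>h. \<forall>p \<in> ps. proves h (add_opt (fst p) \<Gamma>) (fst (snd p)) (snd (snd p))"
    using assms(2) by (intro proves_bound infers_finite[OF assms(1)]) auto
  then obtain h where "\<forall>p \<in> ps. proves h (add_opt (fst p) \<Gamma>) (fst (snd p)) (snd (snd p))" by blast
  then have "proves (Suc h) \<Gamma> \<Delta> A" by (intro proves_rule[OF assms(1)]) force
  then show ?thesis by blast
qed

lemma provable_case:
  assumes "S \<in> supp \<Gamma>" "target S as (Or B C)" "\<forall>P \<in> set as. provable \<Gamma> \<Delta> P"
    "provable (consume S B \<Gamma>) \<Delta> A" "provable (consume S C \<Gamma>) \<Delta> A"
  shows "provable \<Gamma> \<Delta> A"
proof -
  have "\<exists>h. \<forall>P \<in> set as. proves h \<Gamma> \<Delta> P" using assms(3) by (intro proves_bound) auto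
  then obtain h where h: "\<And>P. P \<in> set as \<Longrightarrow> proves h \<Gamma> \<Delta> P" by blast
  obtain k l where kl: "proves k (consume S B \<Gamma>) \<Delta> A" "proves l (consume S C \<Gamma>) \<Delta> A" using assms(4,5) by blast
  define m where "m = max h (max k l)"
  have "proves (Suc m) \<Gamma> \<Delta> A"
  proof (rule proves_case[OF assms(1,2)])
    show "proves m \<Gamma> \<Delta> P" if "P \<in> set as" for P by (rule proves_le[OF h[OF that]]) (simp add: m_def)
    show "proves (Suc m) (consume S B \<Gamma>) \<Delta> A" "proves (Suc m) (consume S C \<Gamma>) \<Delta> A"
      by (rule proves_le[OF kl(1)] proves_le[OF kl(2)]; simp add: m_def)+
  qed
  then show ?thesis by blast
qed

text \<open>Shortening the path by one step keeps a proof: at its end \<open>tall 0\<close> asks for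
  provability only, which the rules of \<open>tall\<close> record for all premises.\<close>

lemma tall_SucD: "tall (Suc n) \<Gamma> \<Delta> A \<Longrightarrow> tall n \<Gamma> \<Delta> A"
proof (induction "Suc n" \<Gamma> \<Delta> A arbitrary: n rule: tall.induct)
  case (tall_rule \<Gamma> \<Delta> A ps i \<Delta>' B n)
  show ?case
  proof (cases n)
    case 0
    then show ?thesis using provable_rule[OF tall_rule.hyps(1,2)] tall_0 by blast
  next
    case (Suc m)
    then show ?thesis using tall_rule tall.tall_rule by blast
  qed
next
  case (tall_arg S \<Gamma> as B C \<Delta> A P n)
  show ?case
  proof (cases n)
    case 0
    then show ?thesis using provable_case[OF tall_arg.hyps(1-5)] tall_0 by blast
  next
    case (Suc m)
    then show ?thesis using tall_arg tall.tall_arg by blast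
  qed
next
  case (tall_case S \<Gamma> as B C \<Delta> A R)
  then show ?case using tall.tall_case by blast
qed

section \<open>Stabilisation\<close>

definition closed_fms :: "'a fm set \<Rightarrow> bool" where
  "closed_fms X \<longleftrightarrow> Bot \<in> X \<and> (\<forall>A B. Imp A B \<in> X \<or> And A B \<in> X \<or> Or A B \<in> X \<longrightarrow> A \<in> X \<and> B \<in> X)"

definition inside :: "'a fm set \<Rightarrow> ('a fm \<Rightarrow> nat) \<Rightarrow> 'a fm set \<Rightarrow> 'a fm \<Rightarrow> bool" where
  "inside X \<Gamma> \<Delta> A \<longleftrightarrow> supp \<Gamma> \<subseteq> X \<and> \<Delta> \<subseteq> X \<and> A \<in> X"

lemma closed_fmsD:
  assumes "closed_fms X"
  shows "Bot \<in> X" and "Imp A B \<in> X \<Longrightarrow> A \<in> X \<and> B \<in> X" and "And A B \<in> X \<Longrightarrow> A \<in> X \<and> B \<in> X"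
    and "Or A B \<in> X \<Longrightarrow> A \<in> X \<and> B \<in> X"
  using assms unfolding closed_fms_def by blast+

lemma target_closed: "target S as R \<Longrightarrow> closed_fms X \<Longrightarrow> S \<in> X \<Longrightarrow> set as \<subseteq> X \<and> R \<in> X"
  by (induction rule: target.induct) (auto dest: closed_fmsD)

lemma supp_add_hyp: "supp (add_hyp A \<Gamma>) = insert A (supp \<Gamma>)"
  by (auto simp: supp_def add_hyp_def)

lemma inside_infers:
  assumes "infers (supp \<Gamma>) \<Delta> A qs" and "closed_fms X" and "inside X \<Gamma> \<Delta> A" and "(i, \<Delta>', B) \<in> qs"
  shows "inside X (add_opt i \<Gamma>) \<Delta>' B"
  using assms(1)
proof cases
  case (infers_target S as)
  then show ?thesis using target_closed[OF infers_target(3) assms(2)] assms by (auto simp: inside_def)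
qed (use assms(2-4) in \<open>auto simp: inside_def supp_add_hyp dest: closed_fmsD\<close>)

lemma inside_consume:
  assumes "S \<in> supp \<Gamma>" "target S as (Or B C)" "closed_fms X" "inside X \<Gamma> \<Delta> A" "R = B \<or> R = C"
  shows "inside X (consume S R \<Gamma>) \<Delta> A"
proof -
  have "Or B C \<in> X" using target_closed[OF assms(2,3)] assms(1,4) by (auto simp: inside_def)
  then have "R \<in> X" using closed_fmsD(4)[OF assms(3)] assms(5) by blast
  moreover have "supp (consume S R \<Gamma>) \<subseteq> insert R (supp \<Gamma>)"
    by (auto simp: supp_def consume_def add_hyp_def split: if_splits)
  ultimately show ?thesis using assms(4) by (auto simp: inside_def)
qed

lemma inside_arg:
  assumes "S \<in> supp \<Gamma>" "target S as R" "closed_fms X" "inside X \<Gamma> \<Delta> A" "P \<in> set as"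
  shows "inside X \<Gamma> \<Delta> P"
  using target_closed[OF assms(2,3)] assms(1,4,5) by (auto simp: inside_def)

section \<open>Truncated multiplicities and the finite set of goals\<close>

definition truncate :: "nat \<Rightarrow> ('a fm \<Rightarrow> nat) \<Rightarrow> ('a fm \<Rightarrow> nat)" where
  "truncate M \<Gamma> = (\<lambda>A. min (\<Gamma> A) M)"

definition goals :: "'a fm set \<Rightarrow> nat \<Rightarrow> (('a fm \<Rightarrow> nat) \<times> 'a fm set \<times> 'a fm) set" where
  "goals X M = {(\<Gamma>, \<Delta>, A). inside X \<Gamma> \<Delta> A \<and> (\<forall>B. \<Gamma> B \<le> M)}"

text \<open>A multiplicity cut down to M is still above budget plus capacity, because the budget is
  below the capacity and M is at least twice the capacity. The slack 1 makes the comparison usable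
  for \<open>tall\<close> as well as for \<open>proves\<close>.\<close>

lemma le_upto_truncate:
  assumes "\<forall>A \<in> X. 2 * capacity A \<le> M" and "inside X \<Gamma> \<Delta> A"
  shows "le_upto 1 \<Gamma> (truncate M \<Gamma>)" and "le_upto 1 (truncate M \<Gamma>) \<Gamma>"
proof -
  show "le_upto 1 \<Gamma> (truncate M \<Gamma>)"
    unfolding le_upto_def
  proof
    fix B
    show "\<Gamma> B \<le> truncate M \<Gamma> B \<or> budget (truncate M \<Gamma>) B + 1 * capacity B < truncate M \<Gamma> B"
    proof (cases "\<Gamma> B \<le> M")
      case False
      then have "B \<in> X" using assms(2) by (auto simp: inside_def supp_def)
      then have "2 * capacity B \<le> M" using assms(1) by blast
      moreover have "truncate M \<Gamma> B = M" using False by (simp add: truncate_def)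
      ultimately show ?thesis using budget_less_capacity[of "truncate M \<Gamma>" B] by linarith
    qed (simp add: truncate_def)
  qed
  show "le_upto 1 (truncate M \<Gamma>) \<Gamma>" by (simp add: le_upto_def truncate_def)
qed

lemma truncate_goals:
  assumes "inside X \<Gamma> \<Delta> A" and "0 < M"
  shows "(truncate M \<Gamma>, \<Delta>, A) \<in> goals X M"
  using assms by (auto simp: goals_def inside_def truncate_def supp_def)

lemma finite_goals:
  assumes "finite X"
  shows "finite (goals X M)" and "card (goals X M) \<le> Suc M ^ card X * (2 ^ card X * card X)"
proof -
  let ?f = "\<lambda>(\<Gamma>, \<Delta>, A). (restrict \<Gamma> X, \<Delta>, A)"
  let ?T = "(X \<rightarrow>\<^sub>E {..M}) \<times> (Pow X \<times> X)"
  have inj: "inj_on ?f (goals X M)"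
  proof (rule inj_onI, clarsimp)
    fix \<Gamma> \<Delta> A \<Gamma>'
    assume *: "(\<Gamma>, \<Delta>, A) \<in> goals X M" "(\<Gamma>', \<Delta>, A) \<in> goals X M" "restrict \<Gamma> X = restrict \<Gamma>' X"
    show "\<Gamma> = \<Gamma>'"
    proof
      fix B
      show "\<Gamma> B = \<Gamma>' B"
      proof (cases "B \<in> X")
        case True
        then show ?thesis using *(3) by (metis restrict_apply')
      next
        case False
        then have "B \<notin> supp \<Gamma>" "B \<notin> supp \<Gamma>'" using *(1,2) by (auto simp: goals_def inside_def)
        then show ?thesis by (simp add: supp_def)
      qed
    qed
  qed
  have img: "?f ` goals X M \<subseteq> ?T" by (auto simp: goals_def inside_def)
  have fin: "finite ?T" using assms by (intro finite_cartesian_product finite_PiE) auto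
  show "finite (goals X M)" using inj_on_finite[OF inj img fin] .
  have "card (goals X M) \<le> card ?T" by (rule card_inj_on_le[OF inj img fin])
  also have "\<dots> = Suc M ^ card X * (2 ^ card X * card X)"
    using assms by (simp add: card_cartesian_product card_funcsetE card_Pow)
  finally show "card (goals X M) \<le> Suc M ^ card X * (2 ^ card X * card X)" .
qed

text \<open>A chain growing strictly at each of the steps up to N would outgrow \<open>U\<close>. So
  it repeats at some m \<le> N, and \<open>step\<close> makes the repetition permanent.\<close>

lemma increasing_stable:
  fixes f :: "nat \<Rightarrow> 'x set"
  assumes "\<And>h. f h \<subseteq> f (Suc h)" and "\<And>h. f h \<subseteq> U" and "finite U" and "card U \<le> N"
    and step: "\<And>h. f (Suc h) = f h \<Longrightarrow> f (Suc (Suc h)) = f (Suc h)"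
  shows "f h \<subseteq> f N"
proof -
  have mono: "f m \<subseteq> f n" if "m \<le> n" for m n by (rule lift_Suc_mono_le[of f, OF assms(1) that])
  have "\<exists>m \<le> N. f (Suc m) = f m"
  proof (rule ccontr)
    assume "\<not> ?thesis"
    then have neq: "f m \<subset> f (Suc m)" if "m \<le> N" for m using assms(1)[of m] that by blast
    have "m \<le> card (f m)" if "m \<le> Suc N" for m
      using that
    proof (induction m)
      case (Suc m)
      have "card (f m) < card (f (Suc m))"
        by (rule psubset_card_mono[OF finite_subset[OF assms(2,3)] neq]) (use Suc in simp)
      then show ?case using Suc by simp
    qed simp
    then have "Suc N \<le> card (f (Suc N))" by simp
    moreover have "card (f (Suc N)) \<le> card U" by (rule card_mono[OF assms(3,2)])
    ultimately show False using assms(4) by simp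
  qed
  then obtain m where m: "m \<le> N" "f (Suc m) = f m" by blast
  have *: "f (Suc (m + k)) = f (m + k)" for k
    by (induction k) (use m step in auto)
  have "f (m + k) = f m" for k by (induction k) (use * in auto)
  then have "f h \<subseteq> f m" using mono[of h "m + h"] by auto
  then show ?thesis using mono[OF m(1)] by blast
qed

text \<open>M and N are constrained by inequalities, so that they can be given later by arithmetic
  expressions in the code of the formula.\<close>

locale finite_universe =
  fixes X :: "'a fm set" and M N :: nat
  assumes finite: "finite X" and closed: "closed_fms X"
    and capacity: "\<forall>A \<in> X. 2 * capacity A \<le> M" and card_goals: "card (goals X M) \<le> N"
begin

lemma M_pos: "0 < M"
  using capacity closed_fmsD(1)[OF closed] by fastforce

lemma proves_truncate:
  assumes "inside X \<Gamma> \<Delta> A"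
  shows "proves h (truncate M \<Gamma>) \<Delta> A \<longleftrightarrow> proves h \<Gamma> \<Delta> A"
  using le_upto_truncate[OF capacity assms] le_upto_0 proves_mono by blast

lemma tall_truncate:
  assumes "inside X \<Gamma> \<Delta> A"
  shows "tall n (truncate M \<Gamma>) \<Delta> A \<longleftrightarrow> tall n \<Gamma> \<Delta> A"
  using le_upto_truncate[OF capacity assms] tall_mono by blast

text \<open>Premises of rules and arguments of case distinctions sit one level lower, where the
  assumption applies; branches stay at the same level and are covered by the induction
  hypothesis.\<close>

lemma proves_step:
  assumes "\<And>\<Gamma> \<Delta> A. inside X \<Gamma> \<Delta> A \<Longrightarrow> proves (Suc h) \<Gamma> \<Delta> A \<Longrightarrow> proves h \<Gamma> \<Delta> A"
  shows "proves (Suc (Suc h)) \<Gamma> \<Delta> A \<Longrightarrow> inside X \<Gamma> \<Delta> A \<Longrightarrow> proves (Suc h) \<Gamma> \<Delta> A"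
proof (induction "Suc (Suc h)" \<Gamma> \<Delta> A rule: proves.induct)
  case (proves_rule \<Gamma> \<Delta> A qs)
  show ?case
  proof (rule proves.proves_rule[OF proves_rule.hyps(1)])
    fix i \<Delta>' B assume "(i, \<Delta>', B) \<in> qs"
    then show "proves h (add_opt i \<Gamma>) \<Delta>' B"
      using proves_rule.hyps(2) inside_infers[OF proves_rule.hyps(1) closed proves_rule.prems] assms by blast
  qed
next
  case (proves_case S \<Gamma> as B C \<Delta> A)
  show ?case
  proof (rule proves.proves_case[OF proves_case.hyps(1,2)])
    fix P assume "P \<in> set as"
    then show "proves h \<Gamma> \<Delta> P"
      using proves_case.hyps(3) inside_arg[OF proves_case.hyps(1,2) closed proves_case.prems] assms by blast
  qed (use proves_case inside_consume[OF proves_case.hyps(1,2) closed proves_case.prems] in blast)+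
qed

lemma proves_stable:
  assumes "inside X \<Gamma> \<Delta> A" and "proves h \<Gamma> \<Delta> A"
  shows "proves N \<Gamma> \<Delta> A"
proof -
  define f where "f h = {(\<Gamma>, \<Delta>, A) \<in> goals X M. proves h \<Gamma> \<Delta> A}" for h
  have "f h \<subseteq> f N"
  proof (rule increasing_stable[OF _ _ finite_goals(1)[OF finite] card_goals])
    show "f h \<subseteq> f (Suc h)" for h by (auto simp: f_def intro: proves_Suc)
    show "f h \<subseteq> goals X M" for h by (auto simp: f_def)
    fix h assume eq: "f (Suc h) = f h"
    \<comment> \<open>The equation compares truncated goals; invariance under truncation extends it
      to all goals inside X, which is the form that \<open>proves_step\<close> asks for.\<close>
    have *: "proves h \<Gamma> \<Delta> A" if "inside X \<Gamma> \<Delta> A" "proves (Suc h) \<Gamma> \<Delta> A" for \<Gamma> \<Delta> A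
    proof -
      have "(truncate M \<Gamma>, \<Delta>, A) \<in> f (Suc h)"
        using that truncate_goals[OF that(1) M_pos] by (simp add: f_def proves_truncate)
      then have "(truncate M \<Gamma>, \<Delta>, A) \<in> f h" by (simp add: eq)
      then show ?thesis using that(1) by (simp add: f_def proves_truncate)
    qed
    show "f (Suc (Suc h)) = f (Suc h)"
    proof
      show "f (Suc (Suc h)) \<subseteq> f (Suc h)" using proves_step[OF *] by (auto simp: f_def goals_def)
      show "f (Suc h) \<subseteq> f (Suc (Suc h))" by (auto simp: f_def intro: proves_Suc)
    qed
  qed
  moreover have "(truncate M \<Gamma>, \<Delta>, A) \<in> f h"
    using assms truncate_goals[OF assms(1) M_pos] by (simp add: f_def proves_truncate)
  ultimately have "(truncate M \<Gamma>, \<Delta>, A) \<in> f N" by blast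
  then show ?thesis using assms(1) by (simp add: f_def proves_truncate)
qed

lemma tall_step:
  assumes "\<And>\<Gamma> \<Delta> A. inside X \<Gamma> \<Delta> A \<Longrightarrow> tall n \<Gamma> \<Delta> A \<Longrightarrow> tall (Suc n) \<Gamma> \<Delta> A"
  shows "tall (Suc n) \<Gamma> \<Delta> A \<Longrightarrow> inside X \<Gamma> \<Delta> A \<Longrightarrow> tall (Suc (Suc n)) \<Gamma> \<Delta> A"
proof (induction "Suc n" \<Gamma> \<Delta> A rule: tall.induct)
  case (tall_rule \<Gamma> \<Delta> A qs i \<Delta>' B)
  have "tall (Suc n) (add_opt i \<Gamma>) \<Delta>' B"
    using assms tall_rule.hyps(4) inside_infers[OF tall_rule.hyps(1) closed tall_rule.prems tall_rule.hyps(3)]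
    by blast
  then show ?case by (rule tall.tall_rule[OF tall_rule.hyps(1-3)])
next
  case (tall_arg S \<Gamma> as B C \<Delta> A P)
  have "tall (Suc n) \<Gamma> \<Delta> P"
    using assms tall_arg.hyps(7) inside_arg[OF tall_arg.hyps(1,2) closed tall_arg.prems tall_arg.hyps(6)]
    by blast
  then show ?case by (rule tall.tall_arg[OF tall_arg.hyps(1-6)])
next
  case (tall_case S \<Gamma> as B C \<Delta> A R)
  have "tall (Suc (Suc n)) (consume S R \<Gamma>) \<Delta> A"
    using tall_case.hyps(8) inside_consume[OF tall_case.hyps(1,2) closed tall_case.prems tall_case.hyps(6)]
    by blast
  then show ?case by (rule tall.tall_case[OF tall_case.hyps(1-6)])
qed

lemma tall_stable:
  assumes "inside X \<Gamma> \<Delta> A" and "tall N \<Gamma> \<Delta> A"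
  shows "tall n \<Gamma> \<Delta> A"
proof (rule ccontr)
  assume "\<not> tall n \<Gamma> \<Delta> A"
  \<comment> \<open>The tall goals decrease with n, so their complements are taken in order to apply
    \<open>increasing_stable\<close>.\<close>
  define f where "f n = {(\<Gamma>, \<Delta>, A) \<in> goals X M. \<not> tall n \<Gamma> \<Delta> A}" for n
  have "f n \<subseteq> f N"
  proof (rule increasing_stable[OF _ _ finite_goals(1)[OF finite] card_goals])
    show "f n \<subseteq> f (Suc n)" for n by (auto simp: f_def dest: tall_SucD)
    show "f n \<subseteq> goals X M" for n by (auto simp: f_def)
    fix n assume eq: "f (Suc n) = f n"
    have *: "tall (Suc n) \<Gamma> \<Delta> A" if "inside X \<Gamma> \<Delta> A" "tall n \<Gamma> \<Delta> A" for \<Gamma> \<Delta> A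
    proof -
      have "(truncate M \<Gamma>, \<Delta>, A) \<notin> f n"
        using that by (simp add: f_def tall_truncate)
      then have "(truncate M \<Gamma>, \<Delta>, A) \<notin> f (Suc n)" by (simp add: eq)
      then show ?thesis using that(1) truncate_goals[OF that(1) M_pos] by (simp add: f_def tall_truncate)
    qed
    show "f (Suc (Suc n)) = f (Suc n)"
    proof
      show "f (Suc (Suc n)) \<subseteq> f (Suc n)" using tall_step[OF *] by (auto simp: f_def goals_def)
      show "f (Suc n) \<subseteq> f (Suc (Suc n))" by (auto simp: f_def dest: tall_SucD)
    qed
  qed
  moreover have "(truncate M \<Gamma>, \<Delta>, A) \<in> f n"
    using assms(1) \<open>\<not> tall n \<Gamma> \<Delta> A\<close> truncate_goals[OF assms(1) M_pos] by (simp add: f_def tall_truncate)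
  ultimately have "(truncate M \<Gamma>, \<Delta>, A) \<in> f N" by blast
  then show False using assms by (simp add: f_def tall_truncate)
qed

end

section \<open>Terms and provability\<close>

definition hyps :: "'a fm option list \<Rightarrow> 'a fm \<Rightarrow> nat" where
  "hyps \<Gamma> A = count (mset \<Gamma>) (Some A)"

lemma hyps_Cons: "hyps (Some A # \<Gamma>) = add_hyp A (hyps \<Gamma>)"
  by (auto simp: hyps_def add_hyp_def)

lemma hyps_delete:
  "x < length \<Gamma> \<Longrightarrow> \<Gamma> ! x = Some S \<Longrightarrow> hyps (Some A # \<Gamma>[x := None]) = consume S A (hyps \<Gamma>)"
  by (auto simp: hyps_def consume_def add_hyp_def mset_update fun_eq_iff)

lemma supp_hyps: "S \<in> supp (hyps \<Gamma>) \<longleftrightarrow> Some S \<in> set \<Gamma>"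
  by (simp add: supp_def hyps_def)

lemma hyps_Nil: "hyps [] = (\<lambda>_. 0)"
  by (simp add: hyps_def fun_eq_iff)

section \<open>From terms to provability and tallness\<close>

lemma nf_spine_proves:
  "nf h \<Gamma> \<Delta> t A \<Longrightarrow> proves h (hyps \<Gamma>) (set \<Delta>) A"
  "spine h \<Gamma> \<Delta> x T es A \<Longrightarrow> x < length \<Gamma> \<Longrightarrow> \<Gamma> ! x = Some S \<Longrightarrow>
    \<exists>as R. target T as R \<and> (\<forall>P \<in> set as. proves h (hyps \<Gamma>) (set \<Delta>) P) \<and>
      (R = A \<or> (\<exists>B C. R = Or B C \<and> proves (Suc h) (consume S B (hyps \<Gamma>)) (set \<Delta>) A \<and>
        proves (Suc h) (consume S C (hyps \<Gamma>)) (set \<Delta>) A))"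
proof (induction arbitrary: and S rule: nf_spine.inducts)
  case (nf_Lam h A \<Gamma> \<Delta> M B)
  then show ?case by (intro proves_rule[OF infers_Lam]) (auto simp: hyps_Cons)
next
  case (nf_MkPair h \<Gamma> \<Delta> M A N B)
  then show ?case by (intro proves_rule[OF infers_MkPair]) auto
next
  case (nf_Inj1 h \<Gamma> \<Delta> M A B)
  then show ?case by (intro proves_rule[OF infers_Inj1]) auto
next
  case (nf_Inj2 h \<Gamma> \<Delta> M B A)
  then show ?case by (intro proves_rule[OF infers_Inj2]) auto
next
  case (nf_Mu h \<Gamma> A \<Delta> M)
  then show ?case by (intro proves_rule[OF infers_Mu]) (auto simp: fair_contradiction_def)
next
  case (nf_Named a \<Delta> h \<Gamma> M)
  then show ?case by (intro proves_rule[OF infers_Named[of "\<Delta> ! a"]]) auto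
next
  case (nf_Var x \<Gamma> S h \<Delta> es A)
  have S: "S \<in> supp (hyps \<Gamma>)" using nf_Var.hyps by (metis supp_hyps nth_mem)
  from nf_Var.IH[OF nf_Var.hyps(1,2)] obtain as R where *: "target S as R"
    "\<And>P. P \<in> set as \<Longrightarrow> proves h (hyps \<Gamma>) (set \<Delta>) P"
    "R = A \<or> (\<exists>B C. R = Or B C \<and> proves (Suc h) (consume S B (hyps \<Gamma>)) (set \<Delta>) A \<and>
        proves (Suc h) (consume S C (hyps \<Gamma>)) (set \<Delta>) A)" by blast
  from *(3) show ?case
  proof (elim disjE exE conjE)
    assume "R = A"
    then show ?thesis using * by (intro proves_rule[OF infers_target[OF S]]) auto
  next
    fix B C assume "R = Or B C" "proves (Suc h) (consume S B (hyps \<Gamma>)) (set \<Delta>) A"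
      "proves (Suc h) (consume S C (hyps \<Gamma>)) (set \<Delta>) A"
    then show ?thesis using * by (intro proves_case[OF S, of as B C]) auto
  qed
next
  case (spine_Nil h \<Gamma> \<Delta> x A)
  show ?case by (rule exI[of _ "[]"]) (auto intro: target_refl)
next
  case (spine_Arg h \<Gamma> \<Delta> N B x C es A)
  then obtain as R where *: "target C as R" "\<forall>P \<in> set as. proves h (hyps \<Gamma>) (set \<Delta>) P"
      "R = A \<or> (\<exists>B C. R = Or B C \<and> proves (Suc h) (consume S B (hyps \<Gamma>)) (set \<Delta>) A \<and>
        proves (Suc h) (consume S C (hyps \<Gamma>)) (set \<Delta>) A)" by blast
  show ?case using target_Imp[OF *(1), of B] *(2,3) spine_Arg.IH(1)
    by (intro exI[of _ "B # as"] exI[of _ R]) auto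
next
  case (spine_Proj1 h \<Gamma> \<Delta> x B es A C)
  then show ?case using target_And1 by metis
next
  case (spine_Proj2 h \<Gamma> \<Delta> x C es A B)
  then show ?case using target_And2 by metis
next
  case (spine_Case h B \<Gamma> x \<Delta> N1 A C N2)
  then show ?case
    by (intro exI[of _ "[]"] exI[of _ "Or B C"]) (auto intro: target_refl simp: hyps_delete)
qed

text \<open>A term that is not of level n has a premise that is not of level n - 1, or a branch that
  is not of level n; \<open>tall\<close> follows this path, and the other premises contribute their
  provability. For n = 0 provability suffices, since no term has level 0.\<close>

lemma nf_spine_tall:
  "nf k \<Gamma> \<Delta> t A \<Longrightarrow> \<not> nf n \<Gamma> \<Delta> t A \<Longrightarrow> tall n (hyps \<Gamma>) (set \<Delta>) A"
  "spine k \<Gamma> \<Delta> x T es A \<Longrightarrow> x < length \<Gamma> \<Longrightarrow> \<Gamma> ! x = Some S \<Longrightarrow> \<not> spine n \<Gamma> \<Delta> x T es A \<Longrightarrow>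
    \<exists>as R. target T as R \<and> (\<forall>P \<in> set as. provable (hyps \<Gamma>) (set \<Delta>) P) \<and>
      (R = A \<and> (\<exists>P \<in> set as. tall n (hyps \<Gamma>) (set \<Delta>) P) \<or>
       (\<exists>B C. R = Or B C \<and> provable (consume S B (hyps \<Gamma>)) (set \<Delta>) A \<and>
        provable (consume S C (hyps \<Gamma>)) (set \<Delta>) A \<and>
        ((\<exists>P \<in> set as. tall n (hyps \<Gamma>) (set \<Delta>) P) \<or>
         tall (Suc n) (consume S B (hyps \<Gamma>)) (set \<Delta>) A \<or> tall (Suc n) (consume S C (hyps \<Gamma>)) (set \<Delta>) A)))"
proof (induction arbitrary: n and n S rule: nf_spine.inducts)
  case (nf_Lam h A \<Gamma> \<Delta> M B)
  have pr: "proves h (hyps (Some A # \<Gamma>)) (set \<Delta>) B" using nf_spine_proves(1)[OF nf_Lam.hyps] .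
  have pr': "proves (Suc h) (hyps \<Gamma>) (set \<Delta>) (Imp A B)"
    using nf_spine_proves(1)[OF nf_spine.nf_Lam[OF nf_Lam.hyps]] .
  show ?case
  proof (cases n)
    case 0
    then show ?thesis using pr' tall_0 by blast
  next
    case (Suc m)
    then have "tall m (hyps (Some A # \<Gamma>)) (set \<Delta>) B" using nf_Lam nf_spine.nf_Lam by blast
    then show ?thesis unfolding Suc using pr
      by (intro tall_rule[OF infers_Lam]) (auto simp: hyps_Cons)
  qed
next
  case (nf_MkPair h \<Gamma> \<Delta> M A N B)
  have pr: "proves h (hyps \<Gamma>) (set \<Delta>) A" "proves h (hyps \<Gamma>) (set \<Delta>) B"
    using nf_spine_proves(1) nf_MkPair.hyps by blast+
  have pr': "proves (Suc h) (hyps \<Gamma>) (set \<Delta>) (And A B)"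
    using nf_spine_proves(1)[OF nf_spine.nf_MkPair[OF nf_MkPair.hyps]] .
  show ?case
  proof (cases n)
    case 0
    then show ?thesis using pr' tall_0 by blast
  next
    case (Suc m)
    then have "tall m (hyps \<Gamma>) (set \<Delta>) A \<or> tall m (hyps \<Gamma>) (set \<Delta>) B"
      using nf_MkPair nf_spine.nf_MkPair by blast
    then show ?thesis unfolding Suc
    proof
      assume "tall m (hyps \<Gamma>) (set \<Delta>) A"
      then show "tall (Suc m) (hyps \<Gamma>) (set \<Delta>) (And A B)" using pr
        by (intro tall_rule[OF infers_MkPair _, of _ _ _ _ None "set \<Delta>" A]) auto
    next
      assume "tall m (hyps \<Gamma>) (set \<Delta>) B"
      then show "tall (Suc m) (hyps \<Gamma>) (set \<Delta>) (And A B)" using pr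
        by (intro tall_rule[OF infers_MkPair _, of _ _ _ _ None "set \<Delta>" B]) auto
    qed
  qed
next
  case (nf_Inj1 h \<Gamma> \<Delta> M A B)
  have pr: "proves h (hyps \<Gamma>) (set \<Delta>) A" using nf_spine_proves(1)[OF nf_Inj1.hyps] .
  have pr': "proves (Suc h) (hyps \<Gamma>) (set \<Delta>) (Or A B)"
    using nf_spine_proves(1)[OF nf_spine.nf_Inj1[OF nf_Inj1.hyps]] .
  show ?case
  proof (cases n)
    case 0
    then show ?thesis using pr' tall_0 by blast
  next
    case (Suc m)
    then have "tall m (hyps \<Gamma>) (set \<Delta>) A" using nf_Inj1 nf_spine.nf_Inj1 by blast
    then show ?thesis unfolding Suc using pr
      by (intro tall_rule[OF infers_Inj1]) auto
  qed
next
  case (nf_Inj2 h \<Gamma> \<Delta> M B A)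
  have pr: "proves h (hyps \<Gamma>) (set \<Delta>) B" using nf_spine_proves(1)[OF nf_Inj2.hyps] .
  have pr': "proves (Suc h) (hyps \<Gamma>) (set \<Delta>) (Or A B)"
    using nf_spine_proves(1)[OF nf_spine.nf_Inj2[OF nf_Inj2.hyps]] .
  show ?case
  proof (cases n)
    case 0
    then show ?thesis using pr' tall_0 by blast
  next
    case (Suc m)
    then have "tall m (hyps \<Gamma>) (set \<Delta>) B" using nf_Inj2 nf_spine.nf_Inj2 by blast
    then show ?thesis unfolding Suc using pr
      by (intro tall_rule[OF infers_Inj2]) auto
  qed
next
  case (nf_Mu h \<Gamma> A \<Delta> M)
  have pr: "proves h (hyps \<Gamma>) (set (A # \<Delta>)) Bot" using nf_spine_proves(1)[OF nf_Mu.hyps(1)] .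
  have pr': "proves (Suc h) (hyps \<Gamma>) (set \<Delta>) A"
    using nf_spine_proves(1)[OF nf_spine.nf_Mu[OF nf_Mu.hyps]] .
  show ?case
  proof (cases n)
    case 0
    then show ?thesis using pr' tall_0 by blast
  next
    case (Suc m)
    then have "tall m (hyps \<Gamma>) (set (A # \<Delta>)) Bot" using nf_Mu nf_spine.nf_Mu by blast
    then show ?thesis unfolding Suc using pr nf_Mu.hyps(2)
      by (intro tall_rule[OF infers_Mu]) (auto simp: fair_contradiction_def)
  qed
next
  case (nf_Named a \<Delta> h \<Gamma> M)
  have pr: "proves h (hyps \<Gamma>) (set \<Delta>) (\<Delta> ! a)" using nf_spine_proves(1)[OF nf_Named.hyps(2)] .
  have pr': "proves (Suc h) (hyps \<Gamma>) (set \<Delta>) Bot"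
    using nf_spine_proves(1)[OF nf_spine.nf_Named[OF nf_Named.hyps]] .
  show ?case
  proof (cases n)
    case 0
    then show ?thesis using pr' tall_0 by blast
  next
    case (Suc m)
    then have "tall m (hyps \<Gamma>) (set \<Delta>) (\<Delta> ! a)" using nf_Named nf_spine.nf_Named by blast
    then show ?thesis unfolding Suc using pr nf_Named.hyps(1)
      by (intro tall_rule[OF infers_Named[of "\<Delta> ! a"]]) auto
  qed
next
  case (nf_Var x \<Gamma> S h \<Delta> es A)
  have S: "S \<in> supp (hyps \<Gamma>)" using nf_Var.hyps by (metis supp_hyps nth_mem)
  have pr': "proves (Suc h) (hyps \<Gamma>) (set \<Delta>) A"
    using nf_spine_proves(1)[OF nf_spine.nf_Var[OF nf_Var.hyps]] .
  show ?case
  proof (cases n)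
    case 0
    then show ?thesis using pr' tall_0 by blast
  next
    case (Suc m)
    then have "\<not> spine m \<Gamma> \<Delta> x S es A" using nf_Var nf_spine.nf_Var by blast
    from nf_Var.IH[OF nf_Var.hyps(1,2) this] obtain as R where *: "target S as R"
      "\<forall>P \<in> set as. provable (hyps \<Gamma>) (set \<Delta>) P"
      "(R = A \<and> (\<exists>P \<in> set as. tall m (hyps \<Gamma>) (set \<Delta>) P) \<or>
       (\<exists>B C. R = Or B C \<and> provable (consume S B (hyps \<Gamma>)) (set \<Delta>) A \<and>
        provable (consume S C (hyps \<Gamma>)) (set \<Delta>) A \<and>
        ((\<exists>P \<in> set as. tall m (hyps \<Gamma>) (set \<Delta>) P) \<or>
         tall (Suc m) (consume S B (hyps \<Gamma>)) (set \<Delta>) A \<or> tall (Suc m) (consume S C (hyps \<Gamma>)) (set \<Delta>) A)))"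
      by blast
    from *(3) show ?thesis
    proof (rule disjE)
      assume "R = A \<and> (\<exists>P \<in> set as. tall m (hyps \<Gamma>) (set \<Delta>) P)"
      then obtain P where R: "R = A" and P: "P \<in> set as" "tall m (hyps \<Gamma>) (set \<Delta>) P" by auto
      have "\<forall>(i, \<Delta>', B) \<in> (\<lambda>B. (None, set \<Delta>, B)) ` set as. provable (add_opt i (hyps \<Gamma>)) \<Delta>' B"
        using *(2) by auto
      then show ?thesis unfolding Suc
        by (rule tall_rule[OF infers_target[OF S *(1)[unfolded R]], of _ None "set \<Delta>" P]) (use P in auto)
    next
      assume "\<exists>B C. R = Or B C \<and> provable (consume S B (hyps \<Gamma>)) (set \<Delta>) A \<and>
        provable (consume S C (hyps \<Gamma>)) (set \<Delta>) A \<and>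
        ((\<exists>P \<in> set as. tall m (hyps \<Gamma>) (set \<Delta>) P) \<or>
         tall (Suc m) (consume S B (hyps \<Gamma>)) (set \<Delta>) A \<or> tall (Suc m) (consume S C (hyps \<Gamma>)) (set \<Delta>) A)"
      then obtain B C where R: "R = Or B C" and B: "provable (consume S B (hyps \<Gamma>)) (set \<Delta>) A"
        and C: "provable (consume S C (hyps \<Gamma>)) (set \<Delta>) A"
        and t: "(\<exists>P \<in> set as. tall m (hyps \<Gamma>) (set \<Delta>) P) \<or>
         tall (Suc m) (consume S B (hyps \<Gamma>)) (set \<Delta>) A \<or> tall (Suc m) (consume S C (hyps \<Gamma>)) (set \<Delta>) A"
        by (elim exE conjE) (rule that, assumption, rule exI, assumption, rule exI, assumption, assumption)
      from t show ?thesis unfolding Suc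
      proof (elim disjE bexE)
        fix P assume "P \<in> set as" "tall m (hyps \<Gamma>) (set \<Delta>) P"
        then show "tall (Suc m) (hyps \<Gamma>) (set \<Delta>) A"
          by (rule tall_arg[OF S *(1)[unfolded R] *(2) B C])
      next
        assume "tall (Suc m) (consume S B (hyps \<Gamma>)) (set \<Delta>) A"
        then show "tall (Suc m) (hyps \<Gamma>) (set \<Delta>) A"
          by (rule tall_case[OF S *(1)[unfolded R] *(2) B C disjI1[OF refl]])
      next
        assume "tall (Suc m) (consume S C (hyps \<Gamma>)) (set \<Delta>) A"
        then show "tall (Suc m) (hyps \<Gamma>) (set \<Delta>) A"
          by (rule tall_case[OF S *(1)[unfolded R] *(2) B C disjI2[OF refl]])
      qed
    qed
  qed
next
  case (spine_Nil h \<Gamma> \<Delta> x A)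
  then show ?case by (simp add: nf_spine.spine_Nil)
next
  case (spine_Arg h \<Gamma> \<Delta> N B x C es A)
  have B: "provable (hyps \<Gamma>) (set \<Delta>) B" using nf_spine_proves(1)[OF spine_Arg.hyps(1)] by blast
  show ?case
  proof (cases "spine n \<Gamma> \<Delta> x C es A")
    \<comment> \<open>The rest of the spine has level n, so the failure lies in the argument; what
      the rest reaches is then taken from \<open>nf_spine_proves\<close>.\<close>
    case True
    then have "\<not> nf n \<Gamma> \<Delta> N B" using spine_Arg.prems(3) nf_spine.spine_Arg by blast
    then have "tall n (hyps \<Gamma>) (set \<Delta>) B" by (rule spine_Arg.IH(1))
    moreover from nf_spine_proves(2)[OF spine_Arg.hyps(2) spine_Arg.prems(1,2)] obtain as R where
      "target C as R" "\<forall>P \<in> set as. proves h (hyps \<Gamma>) (set \<Delta>) P"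
      "R = A \<or> (\<exists>B C. R = Or B C \<and> proves (Suc h) (consume S B (hyps \<Gamma>)) (set \<Delta>) A \<and>
        proves (Suc h) (consume S C (hyps \<Gamma>)) (set \<Delta>) A)" by blast
    ultimately show ?thesis using target_Imp[of C as R B] B
      by (intro exI[of _ "B # as"] exI[of _ R]) auto
  next
    case False
    from spine_Arg.IH(2)[OF spine_Arg.prems(1,2) this] obtain as R where
      "target C as R" "\<forall>P \<in> set as. provable (hyps \<Gamma>) (set \<Delta>) P"
      "(R = A \<and> (\<exists>P \<in> set as. tall n (hyps \<Gamma>) (set \<Delta>) P) \<or>
       (\<exists>B C. R = Or B C \<and> provable (consume S B (hyps \<Gamma>)) (set \<Delta>) A \<and>
        provable (consume S C (hyps \<Gamma>)) (set \<Delta>) A \<and>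
        ((\<exists>P \<in> set as. tall n (hyps \<Gamma>) (set \<Delta>) P) \<or>
         tall (Suc n) (consume S B (hyps \<Gamma>)) (set \<Delta>) A \<or> tall (Suc n) (consume S C (hyps \<Gamma>)) (set \<Delta>) A)))"
      by blast
    then show ?thesis using target_Imp[of C as R B] B
      by (intro exI[of _ "B # as"] exI[of _ R]) auto
  qed
next
  case (spine_Proj1 h \<Gamma> \<Delta> x B es A C)
  then have "\<not> spine n \<Gamma> \<Delta> x B es A" using nf_spine.spine_Proj1 by blast
  from spine_Proj1.IH[OF spine_Proj1.prems(1,2) this] show ?case using target_And1 by fast
next
  case (spine_Proj2 h \<Gamma> \<Delta> x C es A B)
  then have "\<not> spine n \<Gamma> \<Delta> x C es A" using nf_spine.spine_Proj2 by blast
  from spine_Proj2.IH[OF spine_Proj2.prems(1,2) this] show ?case using target_And2 by fast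
next
  case (spine_Case h B \<Gamma> x \<Delta> N1 A C N2)
  have pr: "provable (consume S B (hyps \<Gamma>)) (set \<Delta>) A" "provable (consume S C (hyps \<Gamma>)) (set \<Delta>) A"
    using nf_spine_proves(1)[OF spine_Case.hyps(1)] nf_spine_proves(1)[OF spine_Case.hyps(2)]
      spine_Case.prems(1,2) by (auto simp: hyps_delete)
  have "\<not> nf (Suc n) (Some B # \<Gamma>[x := None]) \<Delta> N1 A \<or> \<not> nf (Suc n) (Some C # \<Gamma>[x := None]) \<Delta> N2 A"
    using spine_Case.prems nf_spine.spine_Case by blast
  then have "tall (Suc n) (consume S B (hyps \<Gamma>)) (set \<Delta>) A \<or> tall (Suc n) (consume S C (hyps \<Gamma>)) (set \<Delta>) A"
    using spine_Case.IH spine_Case.prems(1,2) by (auto simp: hyps_delete)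
  then show ?case using pr
    by (intro exI[of _ "[]"] exI[of _ "Or B C"]) (auto intro: target_refl)
qed

section \<open>Inversion of levelled typing, and terms realising provable goals\<close>

lemma foldl_App_neq [simp]:
  "foldl App (Var x) es \<noteq> Lam M" "foldl App (Var x) es \<noteq> MkPair M N" "foldl App (Var x) es \<noteq> Inj1 M"
  "foldl App (Var x) es \<noteq> Inj2 M" "foldl App (Var x) es \<noteq> Mu M" "foldl App (Var x) es \<noteq> Named a M"
  by (cases es rule: rev_cases; simp)+

lemmas foldl_App_neq' [simp] = foldl_App_neq[symmetric]

lemma foldl_App_inject [simp]:
  "foldl App (Var x) es = foldl App (Var y) fs \<longleftrightarrow> x = y \<and> es = fs"
proof (induction es arbitrary: fs rule: rev_induct)
  case Nil
  then show ?case by (cases fs rule: rev_cases) auto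
next
  case (snoc e es)
  then show ?case by (cases fs rule: rev_cases) auto
qed

lemma nf_iffs:
  "nf h \<Gamma> \<Delta> (Lam M) C \<longleftrightarrow> (\<exists>k A B. h = Suc k \<and> C = Imp A B \<and> nf k (Some A # \<Gamma>) \<Delta> M B)"
  "nf h \<Gamma> \<Delta> (MkPair M N) C \<longleftrightarrow> (\<exists>k A B. h = Suc k \<and> C = And A B \<and> nf k \<Gamma> \<Delta> M A \<and> nf k \<Gamma> \<Delta> N B)"
  "nf h \<Gamma> \<Delta> (Inj1 M) C \<longleftrightarrow> (\<exists>k A B. h = Suc k \<and> C = Or A B \<and> nf k \<Gamma> \<Delta> M A)"
  "nf h \<Gamma> \<Delta> (Inj2 M) C \<longleftrightarrow> (\<exists>k A B. h = Suc k \<and> C = Or A B \<and> nf k \<Gamma> \<Delta> M B)"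
  "nf h \<Gamma> \<Delta> (Mu M) C \<longleftrightarrow> (\<exists>k. h = Suc k \<and> fair_contradiction \<Delta> C \<and> nf k \<Gamma> (C # \<Delta>) M Bot)"
  "nf h \<Gamma> \<Delta> (Named a M) C \<longleftrightarrow> (\<exists>k. h = Suc k \<and> C = Bot \<and> a < length \<Delta> \<and> nf k \<Gamma> \<Delta> M (\<Delta> ! a))"
  "nf h \<Gamma> \<Delta> (foldl App (Var x) es) C \<longleftrightarrow>
    (\<exists>k S. h = Suc k \<and> x < length \<Gamma> \<and> \<Gamma> ! x = Some S \<and> spine k \<Gamma> \<Delta> x S es C)"
  by (subst nf.simps, simp; blast?)+

lemma nf_0 [simp]: "\<not> nf 0 \<Gamma> \<Delta> t A"
  by (subst nf.simps) simp

lemma spine_iffs: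
  "spine h \<Gamma> \<Delta> x T [] A \<longleftrightarrow> T = A"
  "spine h \<Gamma> \<Delta> x T (Arg N # es) A \<longleftrightarrow> (\<exists>B C. T = Imp B C \<and> nf h \<Gamma> \<Delta> N B \<and> spine h \<Gamma> \<Delta> x C es A)"
  "spine h \<Gamma> \<Delta> x T (Proj1 # es) A \<longleftrightarrow> (\<exists>B C. T = And B C \<and> spine h \<Gamma> \<Delta> x B es A)"
  "spine h \<Gamma> \<Delta> x T (Proj2 # es) A \<longleftrightarrow> (\<exists>B C. T = And B C \<and> spine h \<Gamma> \<Delta> x C es A)"
  "spine h \<Gamma> \<Delta> x T (Case N1 N2 # es) A \<longleftrightarrow> (\<exists>B C. T = Or B C \<and> es = [] \<and>
    nf (Suc h) (Some B # \<Gamma>[x := None]) \<Delta> N1 A \<and> nf (Suc h) (Some C # \<Gamma>[x := None]) \<Delta> N2 A)"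
  by (subst spine.simps, simp; blast?)+

text \<open>The first part builds a spine with prefix \<open>es0\<close> at level k. The other two
  invert it at every level n, so that a lower bound on the level of an argument passes to the whole
  spine. The function \<open>f\<close> fixes one term per argument formula.\<close>

definition spine_prefix ::
  "nat \<Rightarrow> 'a fm option list \<Rightarrow> 'a fm list \<Rightarrow> nat \<Rightarrow> ('a fm \<Rightarrow> trm) \<Rightarrow> 'a fm \<Rightarrow> 'a fm list \<Rightarrow> 'a fm \<Rightarrow> elim list \<Rightarrow> bool"
where
  "spine_prefix k \<Gamma> \<Delta> x f T as R es0 \<longleftrightarrow>
    (\<forall>es A. spine k \<Gamma> \<Delta> x R es A \<longrightarrow> spine k \<Gamma> \<Delta> x T (es0 @ es) A) \<and>
    (\<forall>n es A. spine n \<Gamma> \<Delta> x T (es0 @ es) A \<longrightarrow> spine n \<Gamma> \<Delta> x R es A) \<and>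
    (\<forall>n es A. spine n \<Gamma> \<Delta> x T (es0 @ es) A \<longrightarrow> (\<forall>P \<in> set as. nf n \<Gamma> \<Delta> (f P) P))"

lemma spine_prefixI:
  assumes "\<And>es A. spine k \<Gamma> \<Delta> x R es A \<Longrightarrow> spine k \<Gamma> \<Delta> x T (es0 @ es) A"
    and "\<And>n es A. spine n \<Gamma> \<Delta> x T (es0 @ es) A \<Longrightarrow> spine n \<Gamma> \<Delta> x R es A"
    and "\<And>n es A. spine n \<Gamma> \<Delta> x T (es0 @ es) A \<Longrightarrow> \<forall>P \<in> set as. nf n \<Gamma> \<Delta> (f P) P"
  shows "spine_prefix k \<Gamma> \<Delta> x f T as R es0"
  unfolding spine_prefix_def
  by (intro conjI allI HOL.impI) (erule assms)+

lemma spine_prefixD: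
  assumes "spine_prefix k \<Gamma> \<Delta> x f T as R es0"
  shows "spine k \<Gamma> \<Delta> x R es A \<Longrightarrow> spine k \<Gamma> \<Delta> x T (es0 @ es) A"
    and "spine n \<Gamma> \<Delta> x T (es0 @ es) A \<Longrightarrow> spine n \<Gamma> \<Delta> x R es A"
    and "spine n \<Gamma> \<Delta> x T (es0 @ es) A \<Longrightarrow> \<forall>P \<in> set as. nf n \<Gamma> \<Delta> (f P) P"
  by (erule assms[unfolded spine_prefix_def, THEN conjunct1, THEN spec, THEN spec, THEN mp],
      erule assms[unfolded spine_prefix_def, THEN conjunct2, THEN conjunct1, THEN spec, THEN spec, THEN spec, THEN mp],
      erule assms[unfolded spine_prefix_def, THEN conjunct2, THEN conjunct2, THEN spec, THEN spec, THEN spec, THEN mp])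

lemma target_spine:
  "target T as R \<Longrightarrow> \<forall>P \<in> set as. nf k \<Gamma> \<Delta> (f P) P \<Longrightarrow> \<exists>es0. spine_prefix k \<Gamma> \<Delta> x f T as R es0"
proof (induction rule: target.induct)
  case (target_refl S)
  show ?case by (rule exI[of _ "[]"], rule spine_prefixI) simp_all
next
  case (target_Imp B as R A)
  then obtain es0 where es0: "spine_prefix k \<Gamma> \<Delta> x f B as R es0" by auto
  have "spine_prefix k \<Gamma> \<Delta> x f (Imp A B) (A # as) R (Arg (f A) # es0)"
    by (rule spine_prefixI) (use target_Imp.prems in \<open>auto simp: spine_iffs dest: spine_prefixD[OF es0]\<close>)
  then show ?case by blast
next
  case (target_And1 A as R B)
  then obtain es0 where es0: "spine_prefix k \<Gamma> \<Delta> x f A as R es0" by auto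
  have "spine_prefix k \<Gamma> \<Delta> x f (And A B) as R (Proj1 # es0)"
    by (rule spine_prefixI) (auto simp: spine_iffs dest: spine_prefixD[OF es0])
  then show ?case by blast
next
  case (target_And2 B as R A)
  then obtain es0 where es0: "spine_prefix k \<Gamma> \<Delta> x f B as R es0" by auto
  have "spine_prefix k \<Gamma> \<Delta> x f (And A B) as R (Proj2 # es0)"
    by (rule spine_prefixI) (auto simp: spine_iffs dest: spine_prefixD[OF es0])
  then show ?case by blast
qed

text \<open>All contexts with the given multiplicities and set are quantified over, because
  \<open>proves\<close> and \<open>tall\<close> forget the order of hypotheses and repetitions of
  \<mu>-hypotheses, whereas terms refer to them by index.\<close>

definition term_between :: "nat \<Rightarrow> nat \<Rightarrow> ('a fm \<Rightarrow> nat) \<Rightarrow> 'a fm set \<Rightarrow> 'a fm \<Rightarrow> bool" where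
  "term_between n k G D A \<longleftrightarrow>
    (\<forall>\<Gamma> \<Delta>. hyps \<Gamma> = G \<longrightarrow> set \<Delta> = D \<longrightarrow> (\<exists>t. nf k \<Gamma> \<Delta> t A \<and> \<not> nf n \<Gamma> \<Delta> t A))"

lemma term_betweenD:
  "term_between n k (hyps \<Gamma>) (set \<Delta>) A \<Longrightarrow> \<exists>t. nf k \<Gamma> \<Delta> t A \<and> \<not> nf n \<Gamma> \<Delta> t A"
  by (simp add: term_between_def)

text \<open>Each premise carries its own lower bound \<open>m\<close>, and all of them pass to the
  term. In the applications \<open>m\<close> is 0, which is no restriction, except for the one
  premise on the path of \<open>tall\<close>.\<close>

lemma infers_term:
  assumes "infers (supp (hyps \<Gamma>)) (set \<Delta>) A qs"
    and "\<And>i D B. (i, D, B) \<in> qs \<Longrightarrow> term_between (m (i, D, B)) k (add_opt i (hyps \<Gamma>)) D B"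
  shows "\<exists>t. nf (Suc k) \<Gamma> \<Delta> t A \<and> (\<forall>q \<in> qs. \<not> nf (Suc (m q)) \<Gamma> \<Delta> t A)"
  using assms(1)
proof cases
  case (infers_Lam B C)
  then have "term_between (m (Some B, set \<Delta>, C)) k (hyps (Some B # \<Gamma>)) (set \<Delta>) C"
    using assms(2)[of "Some B"] by (simp add: hyps_Cons)
  from term_betweenD[OF this] obtain t where "nf k (Some B # \<Gamma>) \<Delta> t C"
    "\<not> nf (m (Some B, set \<Delta>, C)) (Some B # \<Gamma>) \<Delta> t C" by blast
  then show ?thesis using infers_Lam by (intro exI[of _ "Lam t"]) (simp add: nf_iffs)
next
  case (infers_MkPair B C)
  then have "term_between (m (None, set \<Delta>, B)) k (hyps \<Gamma>) (set \<Delta>) B"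
    "term_between (m (None, set \<Delta>, C)) k (hyps \<Gamma>) (set \<Delta>) C"
    using assms(2)[of None] by simp_all
  from this[THEN term_betweenD] obtain t u where "nf k \<Gamma> \<Delta> t B" "nf k \<Gamma> \<Delta> u C"
    "\<not> nf (m (None, set \<Delta>, B)) \<Gamma> \<Delta> t B" "\<not> nf (m (None, set \<Delta>, C)) \<Gamma> \<Delta> u C" by blast
  then show ?thesis using infers_MkPair by (intro exI[of _ "MkPair t u"]) (simp add: nf_iffs)
next
  case (infers_Inj1 B C)
  then have "term_between (m (None, set \<Delta>, B)) k (hyps \<Gamma>) (set \<Delta>) B" using assms(2)[of None] by simp
  from term_betweenD[OF this] obtain t where "nf k \<Gamma> \<Delta> t B" "\<not> nf (m (None, set \<Delta>, B)) \<Gamma> \<Delta> t B" by blast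
  then show ?thesis using infers_Inj1 by (intro exI[of _ "Inj1 t"]) (simp add: nf_iffs)
next
  case (infers_Inj2 B C)
  then have "term_between (m (None, set \<Delta>, C)) k (hyps \<Gamma>) (set \<Delta>) C" using assms(2)[of None] by simp
  from term_betweenD[OF this] obtain t where "nf k \<Gamma> \<Delta> t C" "\<not> nf (m (None, set \<Delta>, C)) \<Gamma> \<Delta> t C" by blast
  then show ?thesis using infers_Inj2 by (intro exI[of _ "Inj2 t"]) (simp add: nf_iffs)
next
  case infers_Mu
  then have "term_between (m (None, set (A # \<Delta>), Bot)) k (hyps \<Gamma>) (set (A # \<Delta>)) Bot"
    using assms(2)[of None] by simp
  from term_betweenD[OF this] obtain t where "nf k \<Gamma> (A # \<Delta>) t Bot"
    "\<not> nf (m (None, set (A # \<Delta>), Bot)) \<Gamma> (A # \<Delta>) t Bot" by blast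
  then show ?thesis using infers_Mu
    by (intro exI[of _ "Mu t"]) (simp add: nf_iffs fair_contradiction_def)
next
  case (infers_Named B)
  then obtain a where a: "a < length \<Delta>" "B = \<Delta> ! a" by (auto simp: in_set_conv_nth)
  have "term_between (m (None, set \<Delta>, B)) k (hyps \<Gamma>) (set \<Delta>) B"
    using assms(2)[of None] infers_Named by simp
  from term_betweenD[OF this] obtain t where "nf k \<Gamma> \<Delta> t B" "\<not> nf (m (None, set \<Delta>, B)) \<Gamma> \<Delta> t B" by blast
  then show ?thesis using infers_Named a by (intro exI[of _ "Named a t"]) (simp add: nf_iffs)
next
  case (infers_target S as)
  then obtain x where x: "x < length \<Gamma>" "\<Gamma> ! x = Some S" by (auto simp: supp_hyps in_set_conv_nth)
  have "\<exists>t. nf k \<Gamma> \<Delta> t P \<and> \<not> nf (m (None, set \<Delta>, P)) \<Gamma> \<Delta> t P" if "P \<in> set as" for P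
    by (rule term_betweenD) (use assms(2)[of None] infers_target(1) that in auto)
  then obtain f where f: "\<And>P. P \<in> set as \<Longrightarrow> nf k \<Gamma> \<Delta> (f P) P"
    "\<And>P. P \<in> set as \<Longrightarrow> \<not> nf (m (None, set \<Delta>, P)) \<Gamma> \<Delta> (f P) P" by metis
  obtain es0 where "spine_prefix k \<Gamma> \<Delta> x f S as A es0"
    using target_spine[of S as A k \<Gamma> \<Delta> f x] infers_target(3) f(1) by blast
  note es0 = spine_prefixD[OF this]
  have "nf (Suc k) \<Gamma> \<Delta> (foldl App (Var x) es0) A"
    using es0(1)[of "[]" A] x by (simp add: nf_iffs spine_iffs)
  moreover have "\<not> nf (Suc (m (None, set \<Delta>, P))) \<Gamma> \<Delta> (foldl App (Var x) es0) A" if "P \<in> set as" for P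
  proof
    assume "nf (Suc (m (None, set \<Delta>, P))) \<Gamma> \<Delta> (foldl App (Var x) es0) A"
    then have "spine (m (None, set \<Delta>, P)) \<Gamma> \<Delta> x S (es0 @ []) A" using x by (simp add: nf_iffs)
    from es0(3)[OF this] show False using f(2) that by blast
  qed
  ultimately show ?thesis using infers_target(1) by auto
qed

text \<open>The bounds \<open>l1\<close> and \<open>l2\<close> of the branches pass to the term
  unchanged, while those of the arguments rise by one: case distinctions do not count for the
  level.\<close>

lemma case_term:
  assumes "S \<in> supp (hyps \<Gamma>)" and "target S as (Or B C)"
    and "\<And>P. P \<in> set as \<Longrightarrow> term_between (m P) k (hyps \<Gamma>) (set \<Delta>) P"
    and "term_between l1 (Suc k) (consume S B (hyps \<Gamma>)) (set \<Delta>) A"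
    and "term_between l2 (Suc k) (consume S C (hyps \<Gamma>)) (set \<Delta>) A"
  shows "\<exists>t. nf (Suc k) \<Gamma> \<Delta> t A \<and> (\<forall>P \<in> set as. \<not> nf (Suc (m P)) \<Gamma> \<Delta> t A) \<and>
    \<not> nf l1 \<Gamma> \<Delta> t A \<and> \<not> nf l2 \<Gamma> \<Delta> t A"
proof -
  obtain x where x: "x < length \<Gamma>" "\<Gamma> ! x = Some S" using assms(1) by (auto simp: supp_hyps in_set_conv_nth)
  from assms(3)[THEN term_betweenD] obtain f where f: "\<And>P. P \<in> set as \<Longrightarrow> nf k \<Gamma> \<Delta> (f P) P"
    "\<And>P. P \<in> set as \<Longrightarrow> \<not> nf (m P) \<Gamma> \<Delta> (f P) P" by metis
  obtain es0 where "spine_prefix k \<Gamma> \<Delta> x f S as (Or B C) es0"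
    using target_spine[of S as "Or B C" k \<Gamma> \<Delta> f x] assms(2) f(1) by blast
  note es0 = spine_prefixD[OF this]
  from assms(4) obtain t1 where t1: "nf (Suc k) (Some B # \<Gamma>[x := None]) \<Delta> t1 A" "\<not> nf l1 (Some B # \<Gamma>[x := None]) \<Delta> t1 A"
    using term_betweenD[of l1 "Suc k" "Some B # \<Gamma>[x := None]" \<Delta> A] by (auto simp: hyps_delete[OF x])
  from assms(5) obtain t2 where t2: "nf (Suc k) (Some C # \<Gamma>[x := None]) \<Delta> t2 A" "\<not> nf l2 (Some C # \<Gamma>[x := None]) \<Delta> t2 A"
    using term_betweenD[of l2 "Suc k" "Some C # \<Gamma>[x := None]" \<Delta> A] by (auto simp: hyps_delete[OF x])
  define t where "t = foldl App (Var x) (es0 @ [Case t1 t2])"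
  have inv: "\<exists>n'. n = Suc n' \<and> spine n' \<Gamma> \<Delta> x (Or B C) [Case t1 t2] A \<and> (\<forall>P \<in> set as. nf n' \<Gamma> \<Delta> (f P) P)"
    if n: "nf n \<Gamma> \<Delta> t A" for n
  proof -
    obtain n' where n': "n = Suc n'" "spine n' \<Gamma> \<Delta> x S (es0 @ [Case t1 t2]) A"
      using n x unfolding t_def nf_iffs(7) by auto
    show ?thesis using n'(1) es0(2)[OF n'(2)] es0(3)[OF n'(2)] by blast
  qed
  have "nf (Suc k) \<Gamma> \<Delta> t A"
    unfolding t_def nf_iffs(7) using es0(1)[of "[Case t1 t2]" A] t1(1) t2(1) x by (simp add: spine_iffs)
  moreover have "\<not> nf (Suc (m P)) \<Gamma> \<Delta> t A" if "P \<in> set as" for P using inv[of "Suc (m P)"] f(2) that by auto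
  moreover have "\<not> nf l1 \<Gamma> \<Delta> t A" "\<not> nf l2 \<Gamma> \<Delta> t A"
    using inv[of l1] inv[of l2] t1(2) t2(2) by (auto simp: spine_iffs)
  ultimately show ?thesis by blast
qed

lemma proves_term: "proves h G D A \<Longrightarrow> term_between 0 h G D A"
proof (induction rule: proves.induct)
  case (proves_rule G D A qs h)
  show ?case
    unfolding term_between_def
  proof (intro allI HOL.impI)
    fix \<Gamma> \<Delta> assume \<Gamma>: "hyps \<Gamma> = G" "set \<Delta> = D"
    from infers_term[where m = "\<lambda>_. 0", OF proves_rule.hyps(1)[folded \<Gamma>] proves_rule.IH[folded \<Gamma>(1)]]
    show "\<exists>t. nf (Suc h) \<Gamma> \<Delta> t A \<and> \<not> nf 0 \<Gamma> \<Delta> t A" by auto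
  qed
next
  case (proves_case S G as B C h D A)
  show ?case
    unfolding term_between_def
  proof (intro allI HOL.impI)
    fix \<Gamma> \<Delta> assume \<Gamma>: "hyps \<Gamma> = G" "set \<Delta> = D"
    from case_term[where m = "\<lambda>_. 0", OF proves_case.hyps(1)[folded \<Gamma>(1)] proves_case.hyps(2)
        proves_case.IH[folded \<Gamma>]]
    show "\<exists>t. nf (Suc h) \<Gamma> \<Delta> t A \<and> \<not> nf 0 \<Gamma> \<Delta> t A" by auto
  qed
qed

context finite_universe
begin

lemma provable_term:
  assumes "inside X G D A" and "provable G D A"
  shows "term_between 0 (k + N) G D A"
proof -
  have "proves N G D A" using assms proves_stable by blast
  then have "proves (k + N) G D A" by (rule proves_le) simp
  then show ?thesis by (rule proves_term)
qed

text \<open>The path recorded by \<open>tall\<close> forces the lower bound n. Every premise off the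
  path is provable and therefore, by stability, has a term of level at most N; so n + N levels are
  enough for the whole term.\<close>

lemma tall_term: "tall n G D A \<Longrightarrow> inside X G D A \<Longrightarrow> term_between n (n + N) G D A"
proof (induction rule: tall.induct)
  case (tall_0 G D A)
  then show ?case using provable_term[of G D A 0] by simp
next
  case (tall_rule G D A qs i D' B n)
  have ins: "inside X (add_opt i' G) D'' B'" if "(i', D'', B') \<in> qs" for i' D'' B'
    by (rule inside_infers[OF tall_rule.hyps(1) closed tall_rule.prems that])
  define m where "m q = (if q = (i, D', B) then n else 0)" for q
  have *: "term_between (m (i', D'', B')) (n + N) (add_opt i' G) D'' B'" if "(i', D'', B') \<in> qs" for i' D'' B'
  proof (cases "(i', D'', B') = (i, D', B)")
    case True
    then show ?thesis using tall_rule.IH ins[OF tall_rule.hyps(3)] by (simp add: m_def)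
  next
    case False
    have "provable (add_opt i' G) D'' B'" using tall_rule.hyps(2) that by fast
    then show ?thesis using provable_term[OF ins[OF that]] False unfolding m_def by (simp only: if_False)
  qed
  show ?case
    unfolding term_between_def
  proof (intro allI HOL.impI)
    fix \<Gamma> \<Delta> assume \<Gamma>: "hyps \<Gamma> = G" "set \<Delta> = D"
    obtain t where t: "nf (Suc (n + N)) \<Gamma> \<Delta> t A" "\<forall>q \<in> qs. \<not> nf (Suc (m q)) \<Gamma> \<Delta> t A"
      using infers_term[where m = m, OF tall_rule.hyps(1)[folded \<Gamma>] *[folded \<Gamma>(1)]] by blast
    have "\<not> nf (Suc (m (i, D', B))) \<Gamma> \<Delta> t A" using t(2) tall_rule.hyps(3) by blast
    then have "\<not> nf (Suc n) \<Gamma> \<Delta> t A" by (simp add: m_def)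
    with t(1) show "\<exists>t. nf (Suc n + N) \<Gamma> \<Delta> t A \<and> \<not> nf (Suc n) \<Gamma> \<Delta> t A" by auto
  qed
next
  case (tall_arg S G as B C D A P n)
  define m where "m Q = (if Q = P then n else 0)" for Q
  have args: "term_between (m Q) (n + N) G D Q" if "Q \<in> set as" for Q
    using tall_arg.IH inside_arg[OF tall_arg.hyps(1,2) closed tall_arg.prems that]
      provable_term[of G D Q n] tall_arg.hyps(3) that by (auto simp: m_def)
  have branch: "term_between 0 (Suc n + N) (consume S B G) D A" "term_between 0 (Suc n + N) (consume S C G) D A"
    using provable_term[OF inside_consume[OF tall_arg.hyps(1,2) closed tall_arg.prems], of B "Suc n"]
      provable_term[OF inside_consume[OF tall_arg.hyps(1,2) closed tall_arg.prems], of C "Suc n"]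
      tall_arg.hyps(4,5) by simp_all
  show ?case
    unfolding term_between_def
  proof (intro allI HOL.impI)
    fix \<Gamma> \<Delta> assume \<Gamma>: "hyps \<Gamma> = G" "set \<Delta> = D"
    have S: "S \<in> supp (hyps \<Gamma>)" using tall_arg.hyps(1) \<Gamma>(1) by simp
    obtain t where t: "nf (Suc (n + N)) \<Gamma> \<Delta> t A" "\<forall>Q \<in> set as. \<not> nf (Suc (m Q)) \<Gamma> \<Delta> t A"
      using case_term[where m = m, OF S tall_arg.hyps(2) args[folded \<Gamma>] branch[folded \<Gamma>, simplified]] by blast
    have "\<not> nf (Suc n) \<Gamma> \<Delta> t A" using t(2) tall_arg.hyps(6) by (auto simp: m_def)
    with t(1) show "\<exists>t. nf (Suc n + N) \<Gamma> \<Delta> t A \<and> \<not> nf (Suc n) \<Gamma> \<Delta> t A" by auto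
  qed
next
  case (tall_case S G as B C D A R n)
  have ins: "inside X (consume S R G) D A"
    by (rule inside_consume[OF tall_case.hyps(1,2) closed tall_case.prems tall_case.hyps(6)])
  show ?case
  proof (cases n)
    \<comment> \<open>With total level N the arguments would have to fit into level N - 1, which
      stability does not provide. But for n = 0 there is no path to preserve, and any term of the
      goal will do.\<close>
    case 0
    have "provable G D A" by (rule provable_case[OF tall_case.hyps(1-5)])
    then show ?thesis using provable_term[OF tall_case.prems, of 0] 0 by simp
  next
    case (Suc k)
    have args: "term_between 0 (k + N) G D Q" if "Q \<in> set as" for Q
      using provable_term[OF inside_arg[OF tall_case.hyps(1,2) closed tall_case.prems that]]
        tall_case.hyps(3) that by simp
    have side: "term_between 0 (Suc (k + N)) (consume S B G) D A" "term_between 0 (Suc (k + N)) (consume S C G) D A"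
      using provable_term[of "consume S B G" D A "Suc k"] provable_term[of "consume S C G" D A "Suc k"]
        inside_consume[OF tall_case.hyps(1,2) closed tall_case.prems] tall_case.hyps(4,5) by auto
    have main: "term_between n (Suc (k + N)) (consume S R G) D A"
      using tall_case.IH[OF ins] Suc by simp
    show ?thesis
      unfolding term_between_def
    proof (intro allI HOL.impI)
      fix \<Gamma> \<Delta> assume \<Gamma>: "hyps \<Gamma> = G" "set \<Delta> = D"
      have S: "S \<in> supp (hyps \<Gamma>)" using tall_case.hyps(1) \<Gamma>(1) by simp
      note args' = args[folded \<Gamma>] and side' = side[folded \<Gamma>] and main' = main[folded \<Gamma>]
      from tall_case.hyps(6) show "\<exists>t. nf (n + N) \<Gamma> \<Delta> t A \<and> \<not> nf n \<Gamma> \<Delta> t A"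
      proof
        assume R: "R = B"
        show ?thesis using case_term[where m = "\<lambda>_. 0", OF S tall_case.hyps(2) args' main'[unfolded R] side'(2)]
          Suc by auto
      next
        assume R: "R = C"
        show ?thesis using case_term[where m = "\<lambda>_. 0", OF S tall_case.hyps(2) args' side'(1) main'[unfolded R]]
          Suc by auto
      qed
    qed
  qed
qed

lemma inside_Nil: "F \<in> X \<Longrightarrow> inside X (hyps []) (set []) F"
  by (simp add: inside_def supp_def hyps_Nil)

lemma fair_proofs_infinite:
  assumes "F \<in> X" and "nf k [] [] t F" and "\<not> nf N [] [] t F"
  shows "infinite (fair_proofs F)"
proof
  assume "finite (fair_proofs F)"
  then have "\<exists>n. \<forall>t \<in> fair_proofs F. nf n [] [] t F"
  proof -
    have "\<forall>t \<in> fair_proofs F. \<exists>h. nf h [] [] t F" by (simp add: fair_proofs_nf)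
    then obtain g where g: "\<And>t. t \<in> fair_proofs F \<Longrightarrow> nf (g t) [] [] t F" by metis
    have "nf (Max (g ` fair_proofs F)) [] [] t F" if "t \<in> fair_proofs F" for t
      using g[OF that] by (rule nf_mono) (use that \<open>finite (fair_proofs F)\<close> in auto)
    then show ?thesis by blast
  qed
  then obtain n where n: "\<And>t. t \<in> fair_proofs F \<Longrightarrow> nf n [] [] t F" by blast
  have "tall N (hyps []) (set []) F" by (rule nf_spine_tall(1)[OF assms(2,3)])
  \<comment> \<open>Stability raises tallness from N to the common level n that finitely many proofs
    would have.\<close>
  then have "tall n (hyps []) (set []) F" by (rule tall_stable[OF inside_Nil[OF assms(1)]])
  from term_betweenD[OF tall_term[OF this inside_Nil[OF assms(1)]]] n show False
    by (auto simp: fair_proofs_nf)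
qed

lemma fair_proofs_bounded:
  assumes "F \<in> X" and "\<And>t. nf (2 * N) [] [] t F \<Longrightarrow> nf N [] [] t F"
  shows "fair_proofs F = {t. nf N [] [] t F}"
proof -
  have "nf N [] [] t F" if "nf k [] [] t F" for k t
  proof (rule ccontr)
    assume "\<not> nf N [] [] t F"
    then have "tall N (hyps []) (set []) F" by (rule nf_spine_tall(1)[OF that])
    \<comment> \<open>With n = N, \<open>tall_term\<close> gives a term of level at most N + N that
      is not of level N; this is why inspecting the levels up to 2 * N suffices.\<close>
    from term_betweenD[OF tall_term[OF this inside_Nil[OF assms(1)]]] assms(2) show False
      by (auto simp: mult_2)
  qed
  then show ?thesis by (auto simp: fair_proofs_nf)
qed

end

section \<open>Counting terms of bounded level\<close>

text \<open>
  Expressions for \<^const>\<open>Ev\<close>: a call \<open>pairc 3 _\<close> asks for the number of terms of a goal, of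
  its terms \<open>Named a M\<close> with \<open>a < i\<close>, of its terms with head variable below \<open>i\<close>, or of the spines
  from a formula \<open>T\<close>.
\<close>

definition constc :: "nat \<Rightarrow> nat" where "constc n = pairc 0 n"
definition sumc :: "nat \<Rightarrow> nat \<Rightarrow> nat" where "sumc a b = pairc 1 (pairc a b)"
definition prodc :: "nat \<Rightarrow> nat \<Rightarrow> nat" where "prodc a b = pairc 2 (pairc a b)"
definition envc :: "nat \<Rightarrow> nat \<Rightarrow> nat \<Rightarrow> nat \<Rightarrow> nat" where
  "envc h G D A = pairc h (pairc G (pairc D A))"
definition goalc :: "nat \<Rightarrow> nat \<Rightarrow> nat \<Rightarrow> nat \<Rightarrow> nat" where
  "goalc h G D A = pairc 3 (pairc 0 (envc h G D A))"
definition namedc :: "nat \<Rightarrow> nat \<Rightarrow> nat \<Rightarrow> nat \<Rightarrow> nat \<Rightarrow> nat" where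
  "namedc i h G D A = pairc 3 (pairc 1 (pairc i (envc h G D A)))"
definition varsc :: "nat \<Rightarrow> nat \<Rightarrow> nat \<Rightarrow> nat \<Rightarrow> nat \<Rightarrow> nat" where
  "varsc i h G D A = pairc 3 (pairc 2 (pairc i (envc h G D A)))"
definition spinec :: "nat \<Rightarrow> nat \<Rightarrow> nat \<Rightarrow> nat \<Rightarrow> nat \<Rightarrow> nat \<Rightarrow> nat" where
  "spinec x T h G D A = pairc 3 (pairc 3 (pairc (pairc x T) (envc h G D A)))"

definition botc :: nat where "botc = pairc 1 0"
definition leftc :: "nat \<Rightarrow> nat" where "leftc A = fstc (sndc A)"
definition rightc :: "nat \<Rightarrow> nat" where "rightc A = sndc (sndc A)"

definition expand_intro :: "nat \<Rightarrow> nat \<Rightarrow> nat \<Rightarrow> nat \<Rightarrow> nat" where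
  "expand_intro h G D A =
    (if fstc A = 2 then goalc h (consc (Suc (leftc A)) G) D (rightc A)
     else if fstc A = 3 then prodc (goalc h G D (leftc A)) (goalc h G D (rightc A))
     else if fstc A = 4 then sumc (goalc h G D (leftc A)) (goalc h G D (rightc A))
     else constc 0)"

text \<open>A list code is at least the length of the list, so \<open>D\<close> itself bounds the
  search through the \<mu>-context; a hypothesis that is present is coded by a successor.\<close>

definition expand_mu :: "nat \<Rightarrow> nat \<Rightarrow> nat \<Rightarrow> nat \<Rightarrow> nat" where
  "expand_mu h G D A =
    (if A = botc \<or> fstc A = 2 \<and> rightc A = botc \<or> (\<exists>i < D. nthc D i = Suc A) then constc 0
     else goalc h G (consc (Suc A) D) botc)"

text \<open>The last two calls run over all indices below the codes \<open>D\<close> and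
  \<open>G\<close> rather than below the lengths of the contexts; an index beyond the end reads 0
  and contributes nothing.\<close>

definition expand_goal :: "nat \<Rightarrow> nat \<Rightarrow> nat \<Rightarrow> nat \<Rightarrow> nat" where
  "expand_goal h G D A =
    (if h = 0 then constc 0
     else sumc (expand_intro (h - 1) G D A) (sumc (expand_mu (h - 1) G D A)
       (sumc (namedc D (h - 1) G D A) (varsc G (h - 1) G D A))))"

definition expand_named :: "nat \<Rightarrow> nat \<Rightarrow> nat \<Rightarrow> nat \<Rightarrow> nat \<Rightarrow> nat" where
  "expand_named i h G D A =
    (if i = 0 then constc 0
     else sumc (namedc (i - 1) h G D A)
       (if nthc D (i - 1) = 0 \<or> \<not> A = botc then constc 0 else goalc h G D (nthc D (i - 1) - 1)))"

definition expand_vars :: "nat \<Rightarrow> nat \<Rightarrow> nat \<Rightarrow> nat \<Rightarrow> nat \<Rightarrow> nat" where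
  "expand_vars i h G D A =
    (if i = 0 then constc 0
     else sumc (varsc (i - 1) h G D A)
       (if nthc G (i - 1) = 0 then constc 0 else spinec (i - 1) (nthc G (i - 1) - 1) h G D A))"

text \<open>If \<open>T = A\<close>, the spine may stop even though \<open>T\<close> could be
  eliminated further, so the empty spine is added to the others. Branches are called with
  \<open>Suc h\<close>, because \<open>h\<close> is the level of the spine, one below that of its
  term.\<close>

definition expand_spine :: "nat \<Rightarrow> nat \<Rightarrow> nat \<Rightarrow> nat \<Rightarrow> nat \<Rightarrow> nat \<Rightarrow> nat" where
  "expand_spine x T h G D A =
    sumc (if T = A then constc 1 else constc 0)
      (if fstc T = 2 then prodc (goalc h G D (leftc T)) (spinec x (rightc T) h G D A)
       else if fstc T = 3 then sumc (spinec x (leftc T) h G D A) (spinec x (rightc T) h G D A)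
       else if fstc T = 4 then prodc (goalc (Suc h) (consc (Suc (leftc T)) (delc G x)) D A)
         (goalc (Suc h) (consc (Suc (rightc T)) (delc G x)) D A)
       else constc 0)"

definition expand :: "nat \<Rightarrow> nat" where
  "expand z =
    (if fstc z = 0 then
       expand_goal (fstc (sndc z)) (fstc (sndc (sndc z))) (fstc (sndc (sndc (sndc z)))) (sndc (sndc (sndc (sndc z))))
     else if fstc z = 1 then
       expand_named (fstc (sndc z)) (fstc (sndc (sndc z))) (fstc (sndc (sndc (sndc z))))
         (fstc (sndc (sndc (sndc (sndc z))))) (sndc (sndc (sndc (sndc (sndc z)))))
     else if fstc z = 2 then
       expand_vars (fstc (sndc z)) (fstc (sndc (sndc z))) (fstc (sndc (sndc (sndc z))))
         (fstc (sndc (sndc (sndc (sndc z))))) (sndc (sndc (sndc (sndc (sndc z)))))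
     else
       expand_spine (fstc (fstc (sndc z))) (sndc (fstc (sndc z))) (fstc (sndc (sndc z))) (fstc (sndc (sndc (sndc z))))
         (fstc (sndc (sndc (sndc (sndc z))))) (sndc (sndc (sndc (sndc (sndc z))))))"

lemma computable_expand: "computable expand"
  unfolding expand_def expand_goal_def expand_intro_def expand_mu_def expand_named_def expand_vars_def
    expand_spine_def goalc_def namedc_def varsc_def spinec_def envc_def sumc_def prodc_def constc_def
    botc_def leftc_def rightc_def
  by (intro computable_if decidable_eq decidable_disj decidable_conj decidable_ex decidable_not computable_pairc computable_fstc computable_sndc computable_consc computable_nthc computable_delc
      computable_minus computable_Suc computable_const computable_ident)

text \<open>Besides finiteness and the value this includes termination, as \<open>Ev\<close> holds
  only for expressions whose evaluation ends.\<close>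

definition counts :: "nat \<Rightarrow> 'b set \<Rightarrow> bool" where
  "counts c S \<longleftrightarrow> finite S \<and> Ev expand c (card S)"

lemma counts_goalc: "counts (expand_goal h G D A) S \<Longrightarrow> counts (goalc h G D A) S"
  and counts_namedc: "counts (expand_named i h G D A) S \<Longrightarrow> counts (namedc i h G D A) S"
  and counts_varsc: "counts (expand_vars i h G D A) S \<Longrightarrow> counts (varsc i h G D A) S"
  and counts_spinec: "counts (expand_spine x T h G D A) S \<Longrightarrow> counts (spinec x T h G D A) S"
  unfolding counts_def goalc_def namedc_def varsc_def spinec_def
  by (erule conjE, rule conjI, assumption, rule Ev_call, simp add: expand_def envc_def)+

lemma counts_empty: "S = {} \<Longrightarrow> counts (constc 0) S"
  using Ev_const[of expand 0] by (simp add: counts_def constc_def)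

lemma counts_singleton: "counts (constc 1) {x}"
  using Ev_const[of expand 1] by (simp add: counts_def constc_def)

lemma counts_Un: "counts c S \<Longrightarrow> counts d T \<Longrightarrow> S \<inter> T = {} \<Longrightarrow> counts (sumc c d) (S \<union> T)"
  using Ev_sum[of expand c "card S" d "card T"] by (simp add: counts_def sumc_def card_Un_disjoint)

lemma counts_times: "counts c S \<Longrightarrow> counts d T \<Longrightarrow> counts (prodc c d) (S \<times> T)"
  using Ev_prod[of expand c "card S" d "card T"] by (simp add: counts_def prodc_def card_cartesian_product)

lemma counts_image: "counts c S \<Longrightarrow> inj_on f S \<Longrightarrow> counts c (f ` S)"
  by (simp add: counts_def card_image)

section \<open>Codes of contexts and correctness of the counting recursion\<close>

fun option_code :: "('a \<Rightarrow> nat) \<Rightarrow> 'a fm option \<Rightarrow> nat" where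
  "option_code e None = 0"
| "option_code e (Some A) = Suc (fm_code e A)"

definition ctx_code :: "('a \<Rightarrow> nat) \<Rightarrow> 'a fm option list \<Rightarrow> nat" where
  "ctx_code e \<Gamma> = list_encode (map (option_code e) \<Gamma>)"

abbreviation goal_code where
  "goal_code e h \<Gamma> \<Delta> A \<equiv> goalc h (ctx_code e \<Gamma>) (ctx_code e (map Some \<Delta>)) (fm_code e A)"

lemma ctx_code_Cons: "ctx_code e (Some A # \<Gamma>) = consc (Suc (fm_code e A)) (ctx_code e \<Gamma>)"
  by (simp add: ctx_code_def list_encode_Cons' del: list_encode.simps)

lemma ctx_code_nth: "nthc (ctx_code e \<Gamma>) i = (if i < length \<Gamma> then option_code e (\<Gamma> ! i) else 0)"
  by (simp add: ctx_code_def nthc_list)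

lemma ctx_code_delete: "x < length \<Gamma> \<Longrightarrow> delc (ctx_code e \<Gamma>) x = ctx_code e (\<Gamma>[x := None])"
  by (simp add: ctx_code_def delc_list map_update)

lemma length_le_list_encode: "length xs \<le> list_encode xs"
proof (induction xs)
  case (Cons x xs)
  have "list_encode xs \<le> prod_encode (x, list_encode xs)" by (rule le_prod_encode_2)
  then show ?case using Cons by simp
qed simp

lemma length_le_ctx_code: "length \<Gamma> \<le> ctx_code e \<Gamma>"
  using length_le_list_encode[of "map (option_code e) \<Gamma>"] by (simp add: ctx_code_def)

lemma fm_code_tags [simp]:
  "fstc (fm_code e (Atom a)) = 0" "fstc (fm_code e Bot) = 1" "fstc (fm_code e (Imp A B)) = 2"
  "fstc (fm_code e (And A B)) = 3" "fstc (fm_code e (Or A B)) = 4"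
  "leftc (fm_code e (Imp A B)) = fm_code e A" "rightc (fm_code e (Imp A B)) = fm_code e B"
  "leftc (fm_code e (And A B)) = fm_code e A" "rightc (fm_code e (And A B)) = fm_code e B"
  "leftc (fm_code e (Or A B)) = fm_code e A" "rightc (fm_code e (Or A B)) = fm_code e B"
  by (simp_all add: fstc_def sndc_def leftc_def rightc_def)

lemma fm_code_bot: "fm_code e A = botc \<longleftrightarrow> A = Bot"
  by (cases A) (auto simp: botc_def pairc_def)

lemma botc_eq: "botc = fm_code e Bot"
  by (simp add: botc_def pairc_def)

text \<open>A branch stays at the same level, but its context has lost a hypothesis and gained a
  strictly smaller one. This measure drops there, and together with the level it makes the counting
  recursion end.\<close>

definition weight :: "'a fm option list \<Rightarrow> nat" where
  "weight \<Gamma> = sum_list (map (\<lambda>i. case i of None \<Rightarrow> 0 | Some A \<Rightarrow> Suc (size A)) \<Gamma>)"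

lemma weight_Cons [simp]: "weight (Some A # \<Gamma>) = Suc (size A) + weight \<Gamma>"
  by (simp add: weight_def)

lemma weight_delete:
  "x < length \<Gamma> \<Longrightarrow> \<Gamma> ! x = Some S \<Longrightarrow> weight \<Gamma> = weight (\<Gamma>[x := None]) + Suc (size S)"
proof (induction \<Gamma> arbitrary: x)
  case (Cons i \<Gamma>)
  then show ?case by (cases x) (auto simp: weight_def)
qed simp

text \<open>The numbering is injective only on the atoms of the given formula. Comparing codes
  therefore decides equality just for formulae over these atoms, and the recursion never leaves
  them.\<close>

locale atom_numbering =
  fixes e :: "'a \<Rightarrow> nat" and U :: "'a set"
  assumes inj: "inj_on e U"
begin

definition admissible :: "'a fm option list \<Rightarrow> 'a fm list \<Rightarrow> bool" where
  "admissible \<Gamma> \<Delta> \<longleftrightarrow> (\<forall>A. Some A \<in> set \<Gamma> \<longrightarrow> atoms A \<subseteq> U) \<and> (\<forall>A \<in> set \<Delta>. atoms A \<subseteq> U)"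

lemma fm_code_eq_iff: "atoms A \<subseteq> U \<Longrightarrow> atoms B \<subseteq> U \<Longrightarrow> fm_code e A = fm_code e B \<longleftrightarrow> A = B"
  using fm_code_inject[of A B e] inj by (auto simp: inj_on_def subset_iff)

lemma admissible_Cons: "admissible (Some A # \<Gamma>) \<Delta> \<longleftrightarrow> atoms A \<subseteq> U \<and> admissible \<Gamma> \<Delta>"
  "admissible \<Gamma> (A # \<Delta>) \<longleftrightarrow> atoms A \<subseteq> U \<and> admissible \<Gamma> \<Delta>"
  by (auto simp: admissible_def)

lemma admissible_delete: "admissible \<Gamma> \<Delta> \<Longrightarrow> admissible (\<Gamma>[x := None]) \<Delta>"
  by (auto simp: admissible_def dest!: set_update_subset_insert[THEN subsetD])

text \<open>\<open>T\<close> runs through parts of the head formula \<open>S\<close>. Residues are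
  strictly smaller than \<open>S\<close>, which is what the caller needs to apply its inner
  induction to branches at level \<open>Suc h\<close>.\<close>

lemma counts_spine:
  assumes IH: "\<And>B. atoms B \<subseteq> U \<Longrightarrow> counts (goal_code e h \<Gamma> \<Delta> B) {t. nf h \<Gamma> \<Delta> t B}"
    and IH': "\<And>B C. atoms B \<subseteq> U \<Longrightarrow> size B < size S \<Longrightarrow>
      counts (goal_code e (Suc h) (Some B # \<Gamma>[x := None]) \<Delta> A) {t. nf (Suc h) (Some B # \<Gamma>[x := None]) \<Delta> t A}"
    and x: "x < length \<Gamma>" and A: "atoms A \<subseteq> U"
  shows "size T \<le> size S \<Longrightarrow> atoms T \<subseteq> U \<Longrightarrow>
    counts (spinec x (fm_code e T) h (ctx_code e \<Gamma>) (ctx_code e (map Some \<Delta>)) (fm_code e A))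
      {es. spine h \<Gamma> \<Delta> x T es A}"
proof (induction T)
  let ?G = "ctx_code e \<Gamma>" and ?D = "ctx_code e (map Some \<Delta>)" and ?A = "fm_code e A"
  \<comment> \<open>The empty spine is treated here once and for all; for each shape of
    \<open>T\<close> it remains to count the nonempty spines.\<close>
  have *: "counts (spinec x (fm_code e T) h ?G ?D ?A) {es. spine h \<Gamma> \<Delta> x T es A}"
    if T: "atoms T \<subseteq> U" and c: "counts c {es. es \<noteq> [] \<and> spine h \<Gamma> \<Delta> x T es A}"
      and eq: "expand_spine x (fm_code e T) h ?G ?D ?A = sumc (if fm_code e T = ?A then constc 1 else constc 0) c"
    for T c
  proof -
    have "counts (if fm_code e T = ?A then constc 1 else constc 0) {es. es = [] \<and> T = A}"
      using counts_empty[of "{}"] counts_singleton[of "[]"] fm_code_eq_iff[OF T A] by auto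
    then have "counts (expand_spine x (fm_code e T) h ?G ?D ?A)
        ({es. es = [] \<and> T = A} \<union> {es. es \<noteq> [] \<and> spine h \<Gamma> \<Delta> x T es A})"
      unfolding eq by (rule counts_Un[OF _ c]) auto
    moreover have "{es. es = [] \<and> T = A} \<union> {es. es \<noteq> [] \<and> spine h \<Gamma> \<Delta> x T es A} = {es. spine h \<Gamma> \<Delta> x T es A}"
      by (auto simp: spine_iffs)
    ultimately show ?thesis by (simp only:) (rule counts_spinec)
  qed
  {
    case (Atom a)
    have "{es. es \<noteq> [] \<and> spine h \<Gamma> \<Delta> x (Atom a) es A} = {}" by (auto simp: spine.simps[of _ _ _ _ "Atom a"])
    from counts_empty[OF this] show ?case
      using Atom.prems by (intro *) (simp_all add: expand_spine_def del: fm_code.simps)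
  next
    case Bot
    have "{es. es \<noteq> [] \<and> spine h \<Gamma> \<Delta> x Bot es A} = {}" by (auto simp: spine.simps[of _ _ _ _ Bot])
    from counts_empty[OF this] show ?case
      using Bot.prems by (intro *) (simp_all add: expand_spine_def del: fm_code.simps)
  next
    case (Imp B C)
    have B: "atoms B \<subseteq> U" and C: "atoms C \<subseteq> U" "size C \<le> size S" using Imp.prems by auto
    have "{es. es \<noteq> [] \<and> spine h \<Gamma> \<Delta> x (Imp B C) es A} =
        (\<lambda>(N, es). Arg N # es) ` ({N. nf h \<Gamma> \<Delta> N B} \<times> {es. spine h \<Gamma> \<Delta> x C es A})"
      by (auto simp: spine.simps[of _ _ _ _ "Imp B C"])
    moreover have "inj_on (\<lambda>(N, es). Arg N # es) ({N. nf h \<Gamma> \<Delta> N B} \<times> {es. spine h \<Gamma> \<Delta> x C es A})"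
      by (auto simp: inj_on_def)
    ultimately have "counts (prodc (goal_code e h \<Gamma> \<Delta> B) (spinec x (fm_code e C) h ?G ?D ?A))
        {es. es \<noteq> [] \<and> spine h \<Gamma> \<Delta> x (Imp B C) es A}"
      using counts_image[OF counts_times[OF IH[OF B] Imp.IH(2)[OF C(2,1)]]] by simp
    then show ?case using Imp.prems by (intro *) (simp_all add: expand_spine_def del: fm_code.simps)
  next
    case (And B C)
    have B: "size B \<le> size S" "atoms B \<subseteq> U" and C: "size C \<le> size S" "atoms C \<subseteq> U" using And.prems by auto
    have "{es. es \<noteq> [] \<and> spine h \<Gamma> \<Delta> x (And B C) es A} =
        (Cons Proj1) ` {es. spine h \<Gamma> \<Delta> x B es A} \<union> (Cons Proj2) ` {es. spine h \<Gamma> \<Delta> x C es A}"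
      by (auto simp: spine.simps[of _ _ _ _ "And B C"])
    moreover have "counts (sumc (spinec x (fm_code e B) h ?G ?D ?A) (spinec x (fm_code e C) h ?G ?D ?A))
        ((Cons Proj1) ` {es. spine h \<Gamma> \<Delta> x B es A} \<union> (Cons Proj2) ` {es. spine h \<Gamma> \<Delta> x C es A})"
      by (intro counts_Un counts_image And.IH B C) (auto simp: inj_on_def)
    ultimately show ?case using And.prems by (intro *) (simp_all add: expand_spine_def del: fm_code.simps)
  next
    case (Or B C)
    have B: "size B < size S" "atoms B \<subseteq> U" and C: "size C < size S" "atoms C \<subseteq> U" using Or.prems by auto
    let ?N1 = "{t. nf (Suc h) (Some B # \<Gamma>[x := None]) \<Delta> t A}" and ?N2 = "{t. nf (Suc h) (Some C # \<Gamma>[x := None]) \<Delta> t A}"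
    have "{es. es \<noteq> [] \<and> spine h \<Gamma> \<Delta> x (Or B C) es A} = (\<lambda>(N1, N2). [Case N1 N2]) ` (?N1 \<times> ?N2)"
      by (auto simp: spine.simps[of _ _ _ _ "Or B C"])
    moreover have "inj_on (\<lambda>(N1, N2). [Case N1 N2]) (?N1 \<times> ?N2)"
      by (auto simp: inj_on_def)
    ultimately have "counts (prodc (goal_code e (Suc h) (Some B # \<Gamma>[x := None]) \<Delta> A) (goal_code e (Suc h) (Some C # \<Gamma>[x := None]) \<Delta> A))
        {es. es \<noteq> [] \<and> spine h \<Gamma> \<Delta> x (Or B C) es A}"
      using counts_image[OF counts_times[OF IH'[OF B(2,1)] IH'[OF C(2,1)]]] by simp
    then show ?case using Or.prems
      by (intro *) (simp_all add: expand_spine_def ctx_code_Cons ctx_code_delete[OF x] del: fm_code.simps)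
  }
qed

lemma counts_vars:
  assumes "\<And>x S. x < length \<Gamma> \<Longrightarrow> \<Gamma> ! x = Some S \<Longrightarrow>
    counts (spinec x (fm_code e S) h (ctx_code e \<Gamma>) (ctx_code e (map Some \<Delta>)) (fm_code e A)) {es. spine h \<Gamma> \<Delta> x S es A}"
  shows "counts (varsc n h (ctx_code e \<Gamma>) (ctx_code e (map Some \<Delta>)) (fm_code e A))
    {t. \<exists>x < n. \<exists>es. t = foldl App (Var x) es \<and> nf (Suc h) \<Gamma> \<Delta> t A}"
proof (induction n)
  case 0
  show ?case by (rule counts_varsc) (simp add: expand_vars_def counts_empty)
next
  case (Suc n)
  let ?V = "\<lambda>n. {t. \<exists>x < n. \<exists>es. t = foldl App (Var x) es \<and> nf (Suc h) \<Gamma> \<Delta> t A}"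
  let ?W = "{t. \<exists>es. t = foldl App (Var n) es \<and> nf (Suc h) \<Gamma> \<Delta> t A}"
  let ?c = "if nthc (ctx_code e \<Gamma>) n = 0 then constc 0
    else spinec n (nthc (ctx_code e \<Gamma>) n - 1) h (ctx_code e \<Gamma>) (ctx_code e (map Some \<Delta>)) (fm_code e A)"
  have W: "counts ?c ?W"
  proof (cases "n < length \<Gamma> \<and> \<Gamma> ! n \<noteq> None")
    case True
    then obtain S where S: "n < length \<Gamma>" "\<Gamma> ! n = Some S" by auto
    have "?W = foldl App (Var n) ` {es. spine h \<Gamma> \<Delta> n S es A}" using S by (auto simp: nf_iffs(7))
    moreover have "inj_on (foldl App (Var n)) {es. spine h \<Gamma> \<Delta> n S es A}" by (simp add: inj_on_def)
    ultimately show ?thesis using counts_image[OF assms[OF S]] S by (simp add: ctx_code_nth)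
  next
    case False
    then have "?W = {}" by (auto simp: nf_iffs(7))
    then have "counts (constc 0) ?W" by (rule counts_empty)
    moreover have "?c = constc 0" using False by (auto simp: ctx_code_nth)
    ultimately show ?thesis by (simp only:)
  qed
  have "?V (Suc n) = ?V n \<union> ?W" by (auto simp: less_Suc_eq)
  moreover have "expand_vars (Suc n) h (ctx_code e \<Gamma>) (ctx_code e (map Some \<Delta>)) (fm_code e A) = sumc (varsc n h (ctx_code e \<Gamma>) (ctx_code e (map Some \<Delta>)) (fm_code e A)) ?c"
    by (simp add: expand_vars_def)
  moreover have "counts (sumc (varsc n h (ctx_code e \<Gamma>) (ctx_code e (map Some \<Delta>)) (fm_code e A)) ?c) (?V n \<union> ?W)"
    by (rule counts_Un[OF Suc W]) auto
  ultimately show ?case by (simp only: counts_varsc)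
qed

lemma counts_named:
  assumes "\<And>a. a < length \<Delta> \<Longrightarrow> counts (goal_code e h \<Gamma> \<Delta> (\<Delta> ! a)) {t. nf h \<Gamma> \<Delta> t (\<Delta> ! a)}"
  shows "counts (namedc n h (ctx_code e \<Gamma>) (ctx_code e (map Some \<Delta>)) (fm_code e A))
    {t. \<exists>a < n. \<exists>M. t = Named a M \<and> nf (Suc h) \<Gamma> \<Delta> t A}"
proof (induction n)
  case 0
  show ?case by (rule counts_namedc) (simp add: expand_named_def counts_empty)
next
  case (Suc n)
  let ?V = "\<lambda>n. {t. \<exists>a < n. \<exists>M. t = Named a M \<and> nf (Suc h) \<Gamma> \<Delta> t A}"
  let ?W = "{t. \<exists>M. t = Named n M \<and> nf (Suc h) \<Gamma> \<Delta> t A}"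
  let ?D = "ctx_code e (map Some \<Delta>)"
  let ?c = "if nthc ?D n = 0 \<or> \<not> fm_code e A = botc then constc 0
    else goalc h (ctx_code e \<Gamma>) ?D (nthc ?D n - 1)"
  have W: "counts ?c ?W"
  proof (cases "n < length \<Delta> \<and> A = Bot")
    case True
    have "?W = Named n ` {t. nf h \<Gamma> \<Delta> t (\<Delta> ! n)}" using True by (auto simp: nf_iffs(6))
    moreover have "inj_on (Named n) {t. nf h \<Gamma> \<Delta> t (\<Delta> ! n)}" by (simp add: inj_on_def)
    ultimately show ?thesis using counts_image[OF assms[of n]] True
      by (simp add: ctx_code_nth fm_code_bot del: fm_code.simps)
  next
    case False
    then have "?W = {}" by (auto simp: nf_iffs(6))
    then have "counts (constc 0) ?W" by (rule counts_empty)
    moreover have "?c = constc 0" using False by (auto simp: ctx_code_nth fm_code_bot)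
    ultimately show ?thesis by (simp only:)
  qed
  have "?V (Suc n) = ?V n \<union> ?W" by (auto simp: less_Suc_eq)
  moreover have "expand_named (Suc n) h (ctx_code e \<Gamma>) ?D (fm_code e A) = sumc (namedc n h (ctx_code e \<Gamma>) ?D (fm_code e A)) ?c"
    by (simp add: expand_named_def)
  moreover have "counts (sumc (namedc n h (ctx_code e \<Gamma>) ?D (fm_code e A)) ?c) (?V n \<union> ?W)"
    by (rule counts_Un[OF Suc W]) auto
  ultimately show ?case by (simp only: counts_namedc)
qed

lemma counts_intro:
  assumes IH: "\<And>\<Gamma> \<Delta> B. admissible \<Gamma> \<Delta> \<Longrightarrow> atoms B \<subseteq> U \<Longrightarrow> counts (goal_code e h \<Gamma> \<Delta> B) {t. nf h \<Gamma> \<Delta> t B}"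
    and ok: "admissible \<Gamma> \<Delta>" "atoms A \<subseteq> U"
  shows "counts (expand_intro h (ctx_code e \<Gamma>) (ctx_code e (map Some \<Delta>)) (fm_code e A))
    {t. ((\<exists>M. t = Lam M) \<or> (\<exists>M N. t = MkPair M N) \<or> (\<exists>M. t = Inj1 M) \<or> (\<exists>M. t = Inj2 M)) \<and> nf (Suc h) \<Gamma> \<Delta> t A}"
    (is "counts _ ?I")
proof (cases A)
  case (Atom a)
  have "?I = {}" using Atom by (auto simp: nf_iffs)
  from counts_empty[OF this] show ?thesis using Atom by (simp add: expand_intro_def del: fm_code.simps)
next
  case Bot
  have "?I = {}" using Bot by (auto simp: nf_iffs)
  from counts_empty[OF this] show ?thesis using Bot by (simp add: expand_intro_def del: fm_code.simps)
next
  case (Imp B C)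
  have "?I = Lam ` {t. nf h (Some B # \<Gamma>) \<Delta> t C}" using Imp by (auto simp: nf_iffs)
  moreover have "counts (goal_code e h (Some B # \<Gamma>) \<Delta> C) {t. nf h (Some B # \<Gamma>) \<Delta> t C}"
    using ok Imp by (intro IH) (auto simp: admissible_Cons)
  moreover have "inj_on Lam {t. nf h (Some B # \<Gamma>) \<Delta> t C}" by (simp add: inj_on_def)
  ultimately show ?thesis using counts_image Imp
    by (simp add: expand_intro_def ctx_code_Cons del: fm_code.simps)
next
  case (And B C)
  have "?I = (\<lambda>(M, N). MkPair M N) ` ({t. nf h \<Gamma> \<Delta> t B} \<times> {t. nf h \<Gamma> \<Delta> t C})"
    using And by (auto simp: nf_iffs)
  moreover have "counts (prodc (goal_code e h \<Gamma> \<Delta> B) (goal_code e h \<Gamma> \<Delta> C))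
      ((\<lambda>(M, N). MkPair M N) ` ({t. nf h \<Gamma> \<Delta> t B} \<times> {t. nf h \<Gamma> \<Delta> t C}))"
    using ok And by (intro counts_image counts_times IH) (auto simp: inj_on_def)
  ultimately show ?thesis using And by (simp add: expand_intro_def del: fm_code.simps)
next
  case (Or B C)
  have "?I = Inj1 ` {t. nf h \<Gamma> \<Delta> t B} \<union> Inj2 ` {t. nf h \<Gamma> \<Delta> t C}"
    using Or by (auto simp: nf_iffs)
  moreover have "counts (sumc (goal_code e h \<Gamma> \<Delta> B) (goal_code e h \<Gamma> \<Delta> C))
      (Inj1 ` {t. nf h \<Gamma> \<Delta> t B} \<union> Inj2 ` {t. nf h \<Gamma> \<Delta> t C})"
    using ok Or by (intro counts_Un counts_image IH) (auto simp: inj_on_def)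
  ultimately show ?thesis using Or by (simp add: expand_intro_def del: fm_code.simps)
qed

lemma counts_mu:
  assumes IH: "\<And>\<Gamma> \<Delta> B. admissible \<Gamma> \<Delta> \<Longrightarrow> atoms B \<subseteq> U \<Longrightarrow> counts (goal_code e h \<Gamma> \<Delta> B) {t. nf h \<Gamma> \<Delta> t B}"
    and ok: "admissible \<Gamma> \<Delta>" "atoms A \<subseteq> U"
  shows "counts (expand_mu h (ctx_code e \<Gamma>) (ctx_code e (map Some \<Delta>)) (fm_code e A))
    {t. \<exists>M. t = Mu M \<and> nf (Suc h) \<Gamma> \<Delta> t A}" (is "counts _ ?I")
proof -
  let ?D = "ctx_code e (map Some \<Delta>)"
  have neg: "fstc (fm_code e A) = 2 \<and> rightc (fm_code e A) = botc \<longleftrightarrow> (\<exists>C. A = Neg C)"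
    by (cases A) (simp_all add: fm_code_bot del: fm_code.simps)
  have mem: "(\<exists>i < ?D. nthc ?D i = Suc (fm_code e A)) \<longleftrightarrow> A \<in> set \<Delta>"
  proof
    assume "\<exists>i < ?D. nthc ?D i = Suc (fm_code e A)"
    then obtain i where i: "i < length \<Delta>" "fm_code e (\<Delta> ! i) = fm_code e A"
      by (auto simp: ctx_code_nth split: if_splits)
    moreover have "atoms (\<Delta> ! i) \<subseteq> U" using i(1) ok(1) by (simp add: admissible_def)
    ultimately have "\<Delta> ! i = A" using fm_code_eq_iff ok(2) by blast
    then show "A \<in> set \<Delta>" using i(1) by auto
  next
    assume "A \<in> set \<Delta>"
    then obtain i where i: "i < length \<Delta>" "\<Delta> ! i = A" by (auto simp: in_set_conv_nth)
    then have "i < ?D" using length_le_ctx_code[of "map Some \<Delta>" e] by simp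
    then show "\<exists>i < ?D. nthc ?D i = Suc (fm_code e A)" using i by (auto simp: ctx_code_nth)
  qed
  show ?thesis
  proof (cases "fair_contradiction \<Delta> A")
    case True
    have "?I = Mu ` {t. nf h \<Gamma> (A # \<Delta>) t Bot}" using True by (auto simp: nf_iffs)
    moreover have "counts (goal_code e h \<Gamma> (A # \<Delta>) Bot) (Mu ` {t. nf h \<Gamma> (A # \<Delta>) t Bot})"
      using ok by (intro counts_image IH) (auto simp: admissible_Cons inj_on_def)
    ultimately show ?thesis using True
      unfolding expand_mu_def neg mem fm_code_bot fair_contradiction_def
      by (simp add: ctx_code_Cons botc_eq[of e] del: fm_code.simps)
  next
    case False
    then have "?I = {}" by (auto simp: nf_iffs)
    moreover have "A = Bot \<or> (\<exists>C. A = Neg C) \<or> A \<in> set \<Delta>" using False by (auto simp: fair_contradiction_def)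
    ultimately show ?thesis using counts_empty[of ?I] unfolding expand_mu_def neg mem fm_code_bot by simp
  qed
qed

text \<open>An outer induction on the level and an inner one on \<open>weight\<close>: all calls go
  to a lower level, except those for the branches of a case distinction, which lower the weight of
  the context.\<close>

lemma counts_goal:
  "admissible \<Gamma> \<Delta> \<Longrightarrow> atoms A \<subseteq> U \<Longrightarrow> counts (goal_code e h \<Gamma> \<Delta> A) {t. nf h \<Gamma> \<Delta> t A}"
proof (induction h arbitrary: \<Gamma> \<Delta> A)
  case 0
  show ?case by (rule counts_goalc) (simp add: expand_goal_def counts_empty)
next
  case (Suc h)
  note IH = Suc.IH
  from Suc.prems show ?case
  proof (induction \<Gamma> rule: measure_induct_rule[of weight])
    case (less \<Gamma>)
    let ?G = "ctx_code e \<Gamma>" and ?D = "ctx_code e (map Some \<Delta>)" and ?A = "fm_code e A"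
    let ?N = "{t. \<exists>a < ?D. \<exists>M. t = Named a M \<and> nf (Suc h) \<Gamma> \<Delta> t A}"
    let ?V = "{t. \<exists>x < ?G. \<exists>es. t = foldl App (Var x) es \<and> nf (Suc h) \<Gamma> \<Delta> t A}"
    let ?M = "{t. \<exists>M. t = Mu M \<and> nf (Suc h) \<Gamma> \<Delta> t A}"
    let ?I = "{t. ((\<exists>M. t = Lam M) \<or> (\<exists>M N. t = MkPair M N) \<or> (\<exists>M. t = Inj1 M) \<or> (\<exists>M. t = Inj2 M)) \<and>
      nf (Suc h) \<Gamma> \<Delta> t A}"
    have spine: "counts (spinec x (fm_code e S) h ?G ?D ?A) {es. spine h \<Gamma> \<Delta> x S es A}"
      if x: "x < length \<Gamma>" "\<Gamma> ! x = Some S" for x S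
    proof (rule counts_spine[OF IH[OF less.prems(1)] _ x(1) less.prems(2) order_refl])
      show S: "atoms S \<subseteq> U" using x less.prems(1) unfolding admissible_def by (metis nth_mem)
      show "counts (goal_code e (Suc h) (Some B # \<Gamma>[x := None]) \<Delta> A) {t. nf (Suc h) (Some B # \<Gamma>[x := None]) \<Delta> t A}"
        if "atoms B \<subseteq> U" "size B < size S" for B
        by (rule less.IH) (use that less.prems weight_delete[OF x] in \<open>auto simp: admissible_Cons admissible_delete\<close>)
    qed
    have V: "counts (varsc ?G h ?G ?D ?A) ?V" by (rule counts_vars[OF spine])
    have N: "counts (namedc ?D h ?G ?D ?A) ?N"
      by (rule counts_named[OF IH]) (use less.prems(1) in \<open>auto simp: admissible_def\<close>)
    have M: "counts (expand_mu h ?G ?D ?A) ?M" by (rule counts_mu[OF IH less.prems])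
    have I: "counts (expand_intro h ?G ?D ?A) ?I" by (rule counts_intro[OF IH less.prems])
    have "expand_goal (Suc h) ?G ?D ?A = sumc (expand_intro h ?G ?D ?A) (sumc (expand_mu h ?G ?D ?A)
        (sumc (namedc ?D h ?G ?D ?A) (varsc ?G h ?G ?D ?A)))"
      by (simp add: expand_goal_def)
    then have "counts (expand_goal (Suc h) ?G ?D ?A) (?I \<union> (?M \<union> (?N \<union> ?V)))"
      by (simp only:) (intro counts_Un I M N V; auto)
    moreover have "?I \<union> (?M \<union> (?N \<union> ?V)) = {t. nf (Suc h) \<Gamma> \<Delta> t A}"
    proof
      show "{t. nf (Suc h) \<Gamma> \<Delta> t A} \<subseteq> ?I \<union> (?M \<union> (?N \<union> ?V))"
      proof
        fix t assume "t \<in> {t. nf (Suc h) \<Gamma> \<Delta> t A}"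
        then have t: "nf (Suc h) \<Gamma> \<Delta> t A" by simp
        then show "t \<in> ?I \<union> (?M \<union> (?N \<union> ?V))"
        proof cases
          case (nf_Named a M)
          have "a < ?D" using nf_Named length_le_ctx_code[of "map Some \<Delta>" e] by simp
          then show ?thesis using t nf_Named(1) by blast
        next
          case (nf_Var x S es)
          have "x < ?G" using nf_Var length_le_ctx_code[of \<Gamma> e] by simp
          then show ?thesis using t nf_Var(1) by blast
        qed (use t in blast)+
      qed
    qed auto
    ultimately show ?case by (simp only: counts_goalc)
  qed
qed

end

section \<open>Bounds computed from the code of the formula\<close>

primrec subfms :: "'a fm \<Rightarrow> 'a fm set" where
  "subfms (Atom a) = {Atom a}"
| "subfms Bot = {Bot}"
| "subfms (Imp A B) = insert (Imp A B) (subfms A \<union> subfms B)"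
| "subfms (And A B) = insert (And A B) (subfms A \<union> subfms B)"
| "subfms (Or A B) = insert (Or A B) (subfms A \<union> subfms B)"

lemma subfms_refl: "A \<in> subfms A"
  by (cases A) auto

lemma subfms_closed:
  "Imp A B \<in> subfms F \<or> And A B \<in> subfms F \<or> Or A B \<in> subfms F \<Longrightarrow> A \<in> subfms F \<and> B \<in> subfms F"
  by (induction F) (auto simp: subfms_refl)

lemma le_triangle: "n \<le> triangle n"
  by (induction n) auto

text \<open>The tags of the connectives are at least 2 and enter the pairing function twice, as a
  summand and inside a triangular number; hence the 4. In consequence the code bounds the number of
  subformulae and, as an exponent of 3, their capacities.\<close>

lemma fm_code_le:
  "fm_code e A + fm_code e B + 4 \<le> fm_code e (Imp A B)"
  "fm_code e A + fm_code e B + 4 \<le> fm_code e (And A B)"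
  "fm_code e A + fm_code e B + 4 \<le> fm_code e (Or A B)"
proof -
  have "a + b + 4 \<le> prod_encode (Suc (Suc k), prod_encode (a, b))" for a b k
    using le_triangle[of "a + b"] le_triangle[of "Suc (Suc k) + (triangle (a + b) + a)"]
    unfolding prod_encode_def by simp
  from this[of _ _ 0] this[of _ _ 1] this[of _ _ 2] show
    "fm_code e A + fm_code e B + 4 \<le> fm_code e (Imp A B)"
    "fm_code e A + fm_code e B + 4 \<le> fm_code e (And A B)"
    "fm_code e A + fm_code e B + 4 \<le> fm_code e (Or A B)"
    by (simp_all add: numeral_eq_Suc)
qed

lemma card_subfms: "finite (subfms F) \<and> card (subfms F) \<le> Suc (fm_code e F)"
proof -
  have *: "finite (insert C (S \<union> T)) \<and> card (insert C (S \<union> T)) \<le> Suc n"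
    if "finite S \<and> card S \<le> Suc a" "finite T \<and> card T \<le> Suc b" "a + b + 4 \<le> n"
    for C :: "'a fm" and S T a b n
    using that card_insert_le_m1[of "Suc n" "S \<union> T" C] card_Un_le[of S T] by auto
  show ?thesis
  proof (induction F)
    case (Imp A B)
    show ?case unfolding subfms.simps by (rule *[OF Imp.IH fm_code_le(1)])
  next
    case (And A B)
    show ?case unfolding subfms.simps by (rule *[OF And.IH fm_code_le(2)])
  next
    case (Or A B)
    show ?case unfolding subfms.simps by (rule *[OF Or.IH fm_code_le(3)])
  qed auto
qed

lemma capacity_subfms: "A \<in> subfms F \<Longrightarrow> capacity A \<le> 3 ^ fm_code e F"
proof -
  have *: "3 * (3 ^ a + 3 ^ b) \<le> (3::nat) ^ n" if "a + b + 4 \<le> n" for a b n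
  proof -
    have "3 * (3 ^ a + 3 ^ b) \<le> 3 * (3 ^ (a + b) + (3::nat) ^ (a + b))"
      by (intro mult_le_mono add_mono order_refl power_increasing) simp_all
    also have "\<dots> \<le> 81 * 3 ^ (a + b)" by simp
    also have "\<dots> = 3 ^ (a + b + 4)" by (simp add: power_add)
    also have "\<dots> \<le> 3 ^ n" using that by (rule power_increasing) simp
    finally show ?thesis .
  qed
  show "A \<in> subfms F \<Longrightarrow> capacity A \<le> 3 ^ fm_code e F"
  proof (induction F arbitrary: A)
    case (Imp B C)
    show ?case
      using Imp.prems Imp.IH(1)[of A] Imp.IH(2)[of A] Imp.IH(1)[OF subfms_refl] Imp.IH(2)[OF subfms_refl]
        *[OF fm_code_le(1), of e B C]
      by (auto simp del: fm_code.simps)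
  next
    case (And B C)
    show ?case
      using And.prems And.IH(1)[of A] And.IH(2)[of A] And.IH(1)[OF subfms_refl] And.IH(2)[OF subfms_refl]
        *[OF fm_code_le(2), of e B C]
      by (auto simp del: fm_code.simps)
  next
    case (Or B C)
    show ?case
      using Or.prems Or.IH(1)[of A] Or.IH(2)[of A] Or.IH(1)[OF subfms_refl] Or.IH(2)[OF subfms_refl]
        *[OF fm_code_le(3), of e B C]
      by (auto simp del: fm_code.simps)
  qed auto
qed

text \<open>The estimate of \<open>finite_goals\<close> for multiplicities up to
  \<open>2 * 3 ^ n\<close> and \<open>n + 2\<close> formulae, namely at most \<open>n + 1\<close>
  subformulae and \<open>Bot\<close>.\<close>

definition bound :: "nat \<Rightarrow> nat" where
  "bound n = Suc (2 * 3 ^ n) ^ (n + 2) * (2 ^ (n + 2) * (n + 2))"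

lemma computable_bound: "computable f \<Longrightarrow> computable (\<lambda>x. bound (f x))"
  unfolding bound_def by (intro computable_times computable_power computable_Suc computable_plus computable_const)

text \<open>\<open>Bot\<close> joins the subformulae because it is the conclusion of the premise in
  every proof by contradiction.\<close>

lemma finite_universe_subfms:
  "finite_universe (insert Bot (subfms F)) (2 * 3 ^ fm_code e F) (bound (fm_code e F))"
proof
  let ?n = "fm_code e F" and ?X = "insert Bot (subfms F)"
  show fin: "finite ?X" using card_subfms by auto
  show "closed_fms ?X" unfolding closed_fms_def using subfms_closed by blast
  show "\<forall>A \<in> ?X. 2 * capacity A \<le> 2 * 3 ^ ?n" using capacity_subfms[of _ F e] by auto
  have X: "card ?X \<le> ?n + 2"
    using card_subfms[of F e] card_insert_le_m1[of "?n + 2" "subfms F" Bot] by simp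
  have "card (goals ?X (2 * 3 ^ ?n)) \<le> Suc (2 * 3 ^ ?n) ^ card ?X * (2 ^ card ?X * card ?X)"
    by (rule finite_goals(2)[OF fin])
  also have "\<dots> \<le> bound ?n"
    unfolding bound_def by (intro mult_le_mono power_increasing X) simp_all
  finally show "card (goals ?X (2 * 3 ^ ?n)) \<le> bound ?n" .
qed

theorem theorem9:
  shows "\<exists>p. \<forall>(F :: 'a fm) (e :: 'a \<Rightarrow> nat).
           inj_on e (atoms F) \<longrightarrow> computes p [fm_code e F] (enat_code (num_fair_proofs F))"
proof -
  obtain ev where ev: "\<And>x y. Ev expand x y \<Longrightarrow> computes ev [x] y"
    using Ev_computable[OF computable_expand] by blast
  \<comment> \<open>The two zeros are the codes of the empty contexts.\<close>
  have "computable (\<lambda>x. goalc (bound x) 0 0 x)" "computable (\<lambda>x. goalc (2 * bound x) 0 0 x)"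
    unfolding goalc_def envc_def by (intro computable_pairc computable_const computable_bound computable_ident computable_times)+
  then obtain g1 g2 where g: "\<And>x. computes g1 [x] (goalc (bound x) 0 0 x)"
    "\<And>x. computes g2 [x] (goalc (2 * bound x) 0 0 x)" unfolding computable_def by blast
  \<comment> \<open>If both counts agree, the output is the successor of the count, which is its
    code; otherwise it is 0, the code of infinity.\<close>
  have "computable2 (\<lambda>x y. (if x = y then 1 else 0) * Suc x)"
    by (rule computable2_comp2[OF computable2_times computable2_eq computable2_comp1[OF computable_succ computable2_proj(1)]])
  then obtain q where q: "\<And>x y. computes q [x, y] ((if x = y then 1 else 0) * Suc x)"
    unfolding computable2_def by blast
  have "computes (Comp q [Comp ev [g1], Comp ev [g2]]) [fm_code e F] (enat_code (num_fair_proofs F))"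
    if inj: "inj_on e (atoms F)" for F :: "'a fm" and e
  proof -
    interpret atom_numbering e "atoms F" by unfold_locales (rule inj)
    define N where "N = bound (fm_code e F)"
    interpret finite_universe "insert Bot (subfms F)" "2 * 3 ^ fm_code e F" N
      unfolding N_def by (rule finite_universe_subfms)
    define S where "S h = {t. nf h [] [] t F}" for h
    have "counts (goal_code e h [] [] F) (S h)" for h
      unfolding S_def by (rule counts_goal) (auto simp: admissible_def)
    then have S: "finite (S h)" "Ev expand (goalc h 0 0 (fm_code e F)) (card (S h))" for h
      by (simp_all add: counts_def ctx_code_def)
    have prog: "computes (Comp q [Comp ev [g1], Comp ev [g2]]) [fm_code e F]
        ((if card (S N) = card (S (2 * N)) then 1 else 0) * Suc (card (S N)))"
      by (rule computes_Comp2[OF computes_Comp1[OF g(1) ev] computes_Comp1[OF g(2) ev] q])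
         (use S(2) in \<open>simp_all add: N_def\<close>)
    \<comment> \<open>Inclusion of finite sets is what allows the program to compare cardinalities
      instead of the sets of terms.\<close>
    have sub: "S N \<subseteq> S (2 * N)" unfolding S_def by (auto intro: nf_mono)
    have F: "F \<in> insert Bot (subfms F)" by (simp add: subfms_refl)
    show ?thesis
    proof (cases "S (2 * N) \<subseteq> S N")
      case True
      then have eq: "S (2 * N) = S N" using sub by blast
      have "fair_proofs F = S N"
        unfolding S_def by (rule fair_proofs_bounded[OF F]) (use True in \<open>auto simp: S_def\<close>)
      then have "enat_code (num_fair_proofs F) = Suc (card (S N))"
        using S(1) by (simp add: num_fair_proofs_def)
      then show ?thesis using prog eq by simp
    next
      case False
      then obtain t where "nf (2 * N) [] [] t F" "\<not> nf N [] [] t F" by (auto simp: S_def)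
      then have "infinite (fair_proofs F)" by (rule fair_proofs_infinite[OF F])
      then have "enat_code (num_fair_proofs F) = 0" by (simp add: num_fair_proofs_def)
      moreover have "card (S N) < card (S (2 * N))"
        using False sub S(1) by (intro psubset_card_mono) auto
      ultimately show ?thesis using prog by simp
    qed
  qed
  then show ?thesis by blast
qed

end
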